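(* Let $G$ be a connected graph with $2h_G\le N_G$, and let $G'$ be a double triangle reduction of $G$. Then for every prime power $q$, $$c_2(G)_q\equiv c_2(G')_q\mod q .$$
   Context: Graphs are finite, possibly with multiple edges and self-loops. $N_G$ is the number of edges and $h_G$ the number of loops (first Betti number) of $G$. Double triangle reduction: suppose $G$ contains two distinct vertices $P,Q$ of degree exactly $4$ and four further distinct vertices $A,B,C,D$ such that the edges meeting $P$ or $Q$ are exactly the seven edges $AP$, $PQ$, $QD$, $PB$, $BQ$, $PC$, $CQ$ (so $PQB$ and $PQC$ are two triangles sharing the edge $PQ$); anything may be attached to $A,B,C,D$. The double triangle reduction $G'$ of $G$ is obtained by removing $P,Q$ and these seven edges and replacing them with one new vertex $R$ and the five edges $AR$, $RD$, $BR$, $RC$, $BC$. The graph polynomial is $\Psi_G=\sum_T\prod_{e\notin T}\alpha_e$, summed over spanning trees $T$ of $G$; $[\Psi_G]_q$ is the number of its zeros in $\mathbb{F}_q^{N_G}$. The invariant $c_2(G)_q\in\mathbb{Z}/q\mathbb{Z}$ is defined by $[\Psi_G]_q\equiv c_2(G)_q\,q^2\mod q^3$. *)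

theory Defs
  imports "HOL-Number_Theory.Cong" "HOL-Library.Cardinality" "HOL-Library.FuncSet"
    "HOL-Library.Uprod"
begin

section \<open>Finite graphs with multiple edges and self-loops\<close>

text \<open>Edges are names; \<open>ends G e\<close> is the unordered pair of end points of \<open>e\<close>, so \<open>Upair v v\<close>
  is a self-loop at \<open>v\<close>. The value of \<open>ends G\<close> outside \<open>edges G\<close> is irrelevant.\<close>

record ('v, 'e) mgraph =
  verts :: "'v set"
  edges :: "'e set"
  ends :: "'e \<Rightarrow> 'v uprod"

definition finite_graph :: "('v, 'e) mgraph \<Rightarrow> bool" where
  "finite_graph G \<longleftrightarrow> finite (verts G) \<and> finite (edges G) \<and> verts G \<noteq> {} \<and>
     (\<forall>e\<in>edges G. set_uprod (ends G e) \<subseteq> verts G)"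

definition degree :: "('v, 'e) mgraph \<Rightarrow> 'v \<Rightarrow> nat" where
  \<comment> \<open>a self-loop contributes 2\<close>
  "degree G v = card {e \<in> edges G. v \<in> set_uprod (ends G e)}
              + card {e \<in> edges G. ends G e = Upair v v}"

definition adj_rel :: "('v, 'e) mgraph \<Rightarrow> ('v \<times> 'v) set" where
  "adj_rel G = {(u, v). \<exists>e\<in>edges G. ends G e = Upair u v}"

definition connected_rel :: "('v, 'e) mgraph \<Rightarrow> ('v \<times> 'v) set" where
  "connected_rel G = (adj_rel G)\<^sup>* \<inter> verts G \<times> verts G"

definition components :: "('v, 'e) mgraph \<Rightarrow> 'v set set" where
  "components G = verts G // connected_rel G"

definition connected_graph :: "('v, 'e) mgraph \<Rightarrow> bool" where
  "connected_graph G \<longleftrightarrow> verts G \<noteq> {} \<and> (\<forall>u\<in>verts G. \<forall>v\<in>verts G. (u, v) \<in> connected_rel G)"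

text \<open>The first Betti number \<open>h\<^sub>G\<close>, by Euler's formula for the one-dimensional complex \<open>G\<close>.\<close>

definition betti :: "('v, 'e) mgraph \<Rightarrow> int" where
  "betti G = int (card (edges G)) - int (card (verts G)) + int (card (components G))"


section \<open>Spanning trees and the graph polynomial\<close>

text \<open>A cycle with \<open>n \<ge> 1\<close> edges runs through \<open>n\<close> distinct vertices; \<open>n = 1\<close> is a self-loop,
  \<open>n = 2\<close> a pair of parallel edges.\<close>

definition is_cycle :: "('v, 'e) mgraph \<Rightarrow> 'e list \<Rightarrow> bool" where
  "is_cycle G es \<longleftrightarrow> es \<noteq> [] \<and> distinct es \<and> set es \<subseteq> edges G \<and>
     (\<exists>vs. length vs = length es \<and> distinct vs \<and>
        (\<forall>i<length es. ends G (es ! i) = Upair (vs ! i) (vs ! (Suc i mod length es))))"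

definition is_tree :: "('v, 'e) mgraph \<Rightarrow> bool" where
  "is_tree G \<longleftrightarrow> connected_graph G \<and> (\<nexists>es. is_cycle G es)"

definition spanning_trees :: "('v, 'e) mgraph \<Rightarrow> 'e set set" where
  "spanning_trees G = {T. T \<subseteq> edges G \<and> is_tree (G\<lparr>edges := T\<rparr>)}"

text \<open>The polynomial \<open>\<Psi>\<^sub>G\<close>, evaluated at the point \<open>\<alpha>\<close> whose coordinates are indexed by the edges.\<close>

definition graph_poly :: "('v, 'e) mgraph \<Rightarrow> ('e \<Rightarrow> 'k::comm_ring_1) \<Rightarrow> 'k" where
  "graph_poly G \<alpha> = (\<Sum>T\<in>spanning_trees G. \<Prod>e\<in>edges G - T. \<alpha> e)"


section \<open>The \<open>c\<^sub>2\<close> invariant\<close>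

text \<open>The field with \<open>q\<close> elements is a type \<open>'k\<close> with \<open>q = CARD('k)\<close>.\<close>

definition point_count :: "'k::{field,finite} itself \<Rightarrow> ('v, 'e) mgraph \<Rightarrow> nat" where
  "point_count _ G = card {\<alpha> \<in> edges G \<rightarrow>\<^sub>E (UNIV :: 'k set). graph_poly G \<alpha> = 0}"

definition has_c2 :: "'k::{field,finite} itself \<Rightarrow> ('v, 'e) mgraph \<Rightarrow> int \<Rightarrow> bool" where
  "has_c2 K G c \<longleftrightarrow> [int (point_count K G) = c * int CARD('k) ^ 2] (mod int CARD('k) ^ 3)"

text \<open>An element of \<open>\<int>/q\<int>\<close> is given by its representative in \<open>{0..<q}\<close>. The description is
  meaningful only if some \<open>c\<close> satisfies \<open>has_c2 K G c\<close>.\<close>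

definition c2 :: "'k::{field,finite} itself \<Rightarrow> ('v, 'e) mgraph \<Rightarrow> int" where
  "c2 K G = (THE c. 0 \<le> c \<and> c < int CARD('k) \<and> has_c2 K G c)"

lemma has_c2_cong:
  fixes K :: "'k::{field,finite} itself"
  assumes "has_c2 K G c"
  shows "has_c2 K G d \<longleftrightarrow> [c = d] (mod int CARD('k))"
proof -
  let ?q = "int CARD('k)"
  have q: "?q > 0" by simp
  have "has_c2 K G d \<longleftrightarrow> [c * ?q^2 = d * ?q^2] (mod ?q^3)"
    using assms unfolding has_c2_def by (meson cong_sym cong_trans)
  also have "\<dots> \<longleftrightarrow> ?q * ?q^2 dvd (c - d) * ?q^2"
    by (simp add: cong_iff_dvd_diff left_diff_distrib power3_eq_cube power2_eq_square mult.assoc)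
  also have "\<dots> \<longleftrightarrow> [c = d] (mod ?q)"
    using q by (simp add: cong_iff_dvd_diff)
  finally show ?thesis .
qed

lemma c2_cong:
  fixes K :: "'k::{field,finite} itself"
  assumes "has_c2 K G c"
  shows "[c2 K G = c] (mod int CARD('k))"
proof -
  let ?q = "int CARD('k)"
  have q: "?q > 0" by simp
  have "c2 K G = c mod ?q"
    unfolding c2_def
  proof (rule the_equality)
    show "0 \<le> c mod ?q \<and> c mod ?q < ?q \<and> has_c2 K G (c mod ?q)"
      using q has_c2_cong[OF assms] by (simp add: cong_def)
  next
    fix d assume "0 \<le> d \<and> d < ?q \<and> has_c2 K G d"
    then show "d = c mod ?q"
      using has_c2_cong[OF assms, of d] by (simp add: cong_def)
  qed
  then show ?thesis by (simp add: cong_def)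
qed


section \<open>Double triangle reduction\<close>

text \<open>Here \<open>R\<close> and \<open>f\<^sub>1, \<dots>, f\<^sub>5\<close> need only differ from the vertices and edges that are
  kept: the names of the removed ones may be used again.\<close>

definition double_triangle_reduction :: "('v, 'e) mgraph \<Rightarrow> ('v, 'e) mgraph \<Rightarrow> bool" where
  "double_triangle_reduction G G' \<longleftrightarrow>
    (\<exists>P Q A B C D R e1 e2 e3 e4 e5 e6 e7 f1 f2 f3 f4 f5.
       {P, Q, A, B, C, D} \<subseteq> verts G \<and> distinct [P, Q, A, B, C, D] \<and>
       degree G P = 4 \<and> degree G Q = 4 \<and>
       distinct [e1, e2, e3, e4, e5, e6, e7] \<and>
       {e \<in> edges G. P \<in> set_uprod (ends G e) \<or> Q \<in> set_uprod (ends G e)}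
         = {e1, e2, e3, e4, e5, e6, e7} \<and>
       ends G e1 = Upair A P \<and> ends G e2 = Upair P Q \<and> ends G e3 = Upair Q D \<and>
       ends G e4 = Upair P B \<and> ends G e5 = Upair B Q \<and>
       ends G e6 = Upair P C \<and> ends G e7 = Upair C Q \<and>
       R \<notin> verts G - {P, Q} \<and>
       distinct [f1, f2, f3, f4, f5] \<and>
       {f1, f2, f3, f4, f5} \<inter> (edges G - {e1, e2, e3, e4, e5, e6, e7}) = {} \<and>
       verts G' = insert R (verts G - {P, Q}) \<and>
       edges G' = (edges G - {e1, e2, e3, e4, e5, e6, e7}) \<union> {f1, f2, f3, f4, f5} \<and>
       (\<forall>e \<in> edges G - {e1, e2, e3, e4, e5, e6, e7}. ends G' e = ends G e) \<and>
       ends G' f1 = Upair A R \<and> ends G' f2 = Upair R D \<and> ends G' f3 = Upair B R \<and>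
       ends G' f4 = Upair R C \<and> ends G' f5 = Upair B C)"

end

theory Submission
  imports Defs
begin

text \<open>Let \<open>k\<close> be the field with \<open>q\<close> elements. A point \<open>\<alpha>\<close> is read as an electrical network
  whose edges have the resistances \<open>\<alpha>\<^sub>e\<close>, some of them possibly zero. The polynomial \<open>\<Psi>\<^sub>G\<close> does not
  vanish at \<open>\<alpha>\<close> iff the network is nondegenerate: the only current \<open>x\<close> without sources and potential
  \<open>\<xi>\<close> (grounded at a root) with \<open>\<xi>(h e) - \<xi>(t e) = \<alpha>\<^sub>e x\<^sub>e\<close> for all edges are zero (\<open>trivial_of_psi\<close>,
  \<open>psi_of_trivial\<close>). So the zeros of \<open>\<Psi>\<^sub>G\<close> are counted by counting nondegenerate networks.

  This count is analysed with two tools. First, a homogeneous linear system over \<open>k\<close> with more unknowns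
  than equations has a number of solutions divisible by \<open>q\<close>, and a space of solutions is zero iff its
  size is not divisible by \<open>q\<close>. Second, if all resistances but that of \<open>g\<close> are fixed, the pairs
  (current, voltage) that can occur at \<open>g\<close> form a subspace of the plane \<open>k\<^sup>2\<close>; the number of values of
  \<open>\<alpha>\<^sub>g\<close> with a nondegenerate network can be read off from the position of this subspace
  (\<open>pencil\<close>). Three such eliminations, at edges \<open>e\<close>, \<open>f\<close>, \<open>g\<close>, together gain a factor \<open>q\<^sup>2\<close>. For a graph with
  \<open>N\<close> edges and \<open>V \<ge> 4\<close> vertices they give (\<open>count_cong_0\<close>, \<open>has_c2_parallel_configs\<close>):
  the number of nondegenerate networks vanishes modulo \<open>q\<^sup>3\<close> if \<open>N < 2V - 2\<close>, and if \<open>N \<le> 2V - 2\<close> then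
  \<open>c\<^sub>2\<close> exists and is, modulo \<open>q\<close>, the number of parallel configurations: two currents \<open>x, y\<close> and two
  potentials \<open>\<xi>, \<eta>\<close> such that \<open>(x\<^sub>i, y\<^sub>i)\<close> is parallel to the difference of \<open>(\<xi>, \<eta>)\<close> along \<open>i\<close> for every
  edge \<open>i\<close> other than the three, where at \<open>e\<close> all currents and voltages vanish, \<open>f\<close> is unconstrained, and
  \<open>x\<close> and the voltage of \<open>\<eta>\<close> vanish at \<open>g\<close>. The resistances have disappeared: the vertices are points of
  the plane, and \<open>(x, y)\<close> is a system of forces in equilibrium along the edges. For a connected graph
  \<open>2h \<le> N\<close> is the same as \<open>N \<le> 2V - 2\<close>, and the reduction preserves this inequality.

  For the double triangle take \<open>e = AP\<close>, \<open>f = PQ\<close>, \<open>g = QD\<close> in \<open>G\<close> and \<open>e = AR\<close>, \<open>f = BC\<close>, \<open>g = RD\<close> in \<open>G'\<close>,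
  with root \<open>A\<close>. Removing the gadget leaves the same graph \<open>H\<close> in both cases, and the parallel
  configurations of \<open>G\<close> and of \<open>G'\<close> are fibred over configurations of \<open>H\<close> with sources at \<open>B, C, D\<close>. Let
  \<open>b, c \<in> k\<^sup>2\<close> be the positions of \<open>B\<close> and \<open>C\<close>, and \<open>d\<close> the second coordinate of \<open>D\<close>. Modulo \<open>q\<close> the fibre
  is the number of \<open>s \<in> k\<close> such that the vector \<open>(s, d)\<close> is linearly independent of \<open>b\<close> and of \<open>c\<close>
  for \<open>G\<close> (\<open>double_triangle_fibres\<close>), and \<open>1\<close> or \<open>0\<close> for \<open>G'\<close>, according as
  \<open>d = 0\<close> and \<open>b, c\<close> are independent or not (\<open>reduced_triangle_fibres\<close>). The two numbers differ by a
  combination of indicators of at most two linear conditions on the positions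
  (\<open>two_lines_count_cong\<close>). Since \<open>H\<close> has so few edges that the positions belonging to given currents
  satisfy at least three linear conditions less than there are unknowns, each of these indicators sums
  to \<open>0\<close> modulo \<open>q\<close> (\<open>open_configs_cong\<close>).\<close>


section \<open>Free actions and linear systems over a finite field\<close>

text \<open>Functions are extended by zero, not by an undefined value, so that they form a vector space
  under the pointwise operations.\<close>

definition supp_on :: "'a set \<Rightarrow> ('a \<Rightarrow> 'b::zero) set" where
  "supp_on A = {f. \<forall>a. a \<notin> A \<longrightarrow> f a = 0}"

lemma supp_on_mono: "A \<subseteq> B \<Longrightarrow> supp_on A \<subseteq> supp_on B"
  by (auto simp: supp_on_def)

lemma supp_on_zero [simp]: "(\<lambda>_. 0) \<in> supp_on A"
  by (simp add: supp_on_def)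

lemma bij_betw_supp_on_PiE:
  "bij_betw (\<lambda>f. restrict f A) (supp_on A) (A \<rightarrow>\<^sub>E (UNIV :: 'b::zero set))"
  by (rule bij_betwI[where g = "\<lambda>f a. if a \<in> A then f a else 0"])
     (auto simp: supp_on_def fun_eq_iff PiE_def extensional_def)

lemma card_supp_on:
  assumes "finite A"
  shows "card (supp_on A :: ('a \<Rightarrow> 'b::{zero,finite}) set) = CARD('b) ^ card A"
  using bij_betw_same_card[OF bij_betw_supp_on_PiE[of A, where 'b = 'b]] assms
  by (simp add: card_PiE)

lemma finite_supp_on [simp]:
  assumes "finite A"
  shows "finite (supp_on A :: ('a \<Rightarrow> 'b::{zero,finite}) set)"
  using bij_betw_finite[OF bij_betw_supp_on_PiE[of A, where 'b = 'b]] assms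
  by (simp add: finite_PiE)

lemma card_field_ge_2: "2 \<le> CARD('k::{field,finite})"
proof -
  have "card {0, 1 :: 'k} \<le> CARD('k)" by (rule card_mono) auto
  then show ?thesis by simp
qed

lemma sum_supp_on_insert:
  fixes F :: "('a \<Rightarrow> 'k::{zero,finite}) \<Rightarrow> 'c::comm_monoid_add"
  assumes "finite A" "a \<notin> A"
  shows "(\<Sum>f\<in>supp_on (insert a A). F f) = (\<Sum>f\<in>supp_on A. \<Sum>c\<in>UNIV. F (f(a := c)))"
proof -
  have "(\<Sum>f\<in>supp_on A. \<Sum>c\<in>UNIV. F (f(a := c))) = (\<Sum>(f, c)\<in>supp_on A \<times> UNIV. F (f(a := c)))"
    using assms by (simp add: sum.cartesian_product)
  also have "\<dots> = (\<Sum>f\<in>supp_on (insert a A). F f)"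
    by (rule sum.reindex_bij_witness[where i = "\<lambda>f. (f(a := 0), f a)" and j = "\<lambda>(f, c). f(a := c)"])
       (use assms in \<open>auto simp: supp_on_def fun_eq_iff split: if_splits\<close>)
  finally show ?thesis ..
qed

text \<open>The pigeonhole principle: two elements of the larger space have the same image, and their
  difference is a solution.\<close>

lemma exists_nonzero_solution:
  fixes L :: "('a \<Rightarrow> 'k::{field,finite}) \<Rightarrow> 'b \<Rightarrow> 'k"
  assumes fin: "finite A" "finite B" and less: "card B < card A"
    and additive: "\<And>f g b. b \<in> B \<Longrightarrow> L (\<lambda>a. f a - g a) b = L f b - L g b"
  obtains f where "f \<in> supp_on A" "f \<noteq> (\<lambda>_. 0)" "\<And>b. b \<in> B \<Longrightarrow> L f b = 0"
proof -
  let ?R = "\<lambda>f b. if b \<in> B then L f b else 0"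
  have "?R ` supp_on A \<subseteq> supp_on B"
    by (auto simp: supp_on_def)
  then have "card (?R ` supp_on A) \<le> card (supp_on B :: ('b \<Rightarrow> 'k) set)"
    using fin by (intro card_mono) auto
  also have "\<dots> < card (supp_on A :: ('a \<Rightarrow> 'k) set)"
  proof -
    have "CARD('k) ^ card B < CARD('k) ^ card A"
      by (rule power_strict_increasing[OF less]) (use card_field_ge_2[where 'k = 'k] in linarith)
    then show ?thesis by (simp only: card_supp_on[OF fin(1)] card_supp_on[OF fin(2)])
  qed
  finally have "\<not> inj_on ?R (supp_on A)"
    using card_image[of ?R "supp_on A"] by linarith
  then obtain f g where fg: "f \<in> supp_on A" "g \<in> supp_on A" "?R f = ?R g" "f \<noteq> g"
    by (auto simp: inj_on_def)
  show ?thesis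
  proof (rule that[of "\<lambda>a. f a - g a"])
    show "(\<lambda>a. f a - g a) \<in> supp_on A" using fg by (simp add: supp_on_def)
    show "(\<lambda>a. f a - g a) \<noteq> (\<lambda>_. 0)" using fg by (auto simp: fun_eq_iff)
    fix b assume "b \<in> B"
    with fun_cong[OF fg(3), of b] show "L (\<lambda>a. f a - g a) b = 0"
      by (simp add: additive)
  qed
qed

text \<open>The source of all divisibilities below. The additive group of the field acts, usually by
  translation along a nonzero vector, and the orbits have \<open>q\<close> elements.\<close>

lemma card_dvd_card_of_free_action:
  fixes act :: "'k::{field,finite} \<Rightarrow> 's \<Rightarrow> 's"
  assumes fin: "finite S"
    and closed: "\<And>c s. s \<in> S \<Longrightarrow> act c s \<in> S"
    and zero: "\<And>s. s \<in> S \<Longrightarrow> act 0 s = s"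
    and add: "\<And>c d s. s \<in> S \<Longrightarrow> act c (act d s) = act (c + d) s"
    and free: "\<And>c s. s \<in> S \<Longrightarrow> act c s = s \<Longrightarrow> c = 0"
  shows "CARD('k) dvd card S"
proof -
  define r where "r = {(s, s'). s \<in> S \<and> (\<exists>c. s' = act c s)}"
  have refl: "refl_on S r"
  proof (rule refl_onI)
    fix s assume "s \<in> S"
    then show "(s, s) \<in> r" using zero[of s] by (auto simp: r_def intro!: exI[of _ 0])
  qed
  have "equiv S r"
  proof (rule equivI)
    show "r \<subseteq> S \<times> S" using closed by (auto simp: r_def)
    show "refl_on S r" by (rule refl)
    show "sym r"
    proof (rule symI)
      fix s s' assume "(s, s') \<in> r"
      then obtain c where c: "s \<in> S" "s' = act c s" by (auto simp: r_def)
      have "s = act (- c) s'"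
        unfolding c(2) add[OF c(1)] using zero[OF c(1)] by simp
      with closed[OF c(1), of c] c(2) show "(s', s) \<in> r" unfolding r_def by blast
    qed
    show "trans r"
    proof (rule transI)
      fix s s' s'' assume "(s, s') \<in> r" "(s', s'') \<in> r"
      then obtain c d where "s \<in> S" "s' = act c s" "s'' = act d s'" by (auto simp: r_def)
      then have "s \<in> S" "s'' = act (d + c) s" by (simp_all add: add[of s d c])
      then show "(s, s'') \<in> r" unfolding r_def by blast
    qed
  qed
  then show ?thesis
  proof (rule equiv_imp_dvd_card[OF fin])
    fix X assume "X \<in> S // r"
    then obtain s where s: "s \<in> S" "X = r `` {s}" by (auto simp: quotient_def)
    have "X = range (\<lambda>c. act c s)"
      using s by (auto simp: r_def)
    moreover have "inj (\<lambda>c. act c s)"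
    proof (rule injI)
      fix c d assume eq: "act c s = act d s"
      have "act (- d + c) s = act (- d + d) s"
        unfolding add[OF s(1), symmetric] eq ..
      then have "act (- d + c) s = s" using zero[OF s(1)] by simp
      from free[OF s(1) this] show "c = d" by (simp add: eq_neg_iff_add_eq_0)
    qed
    ultimately show "CARD('k) dvd card X"
      by (simp add: card_image)
  qed
qed

section \<open>Currents and potentials\<close>

text \<open>The orientation of the edges by \<open>t\<close> and \<open>h\<close> is arbitrary: reversing \<open>e\<close> changes the sign of
  \<open>x e\<close> and of \<open>grad t h \<xi> e\<close>.\<close>

definition inflow :: "'e set \<Rightarrow> ('e \<Rightarrow> 'v) \<Rightarrow> ('e \<Rightarrow> 'v) \<Rightarrow> ('e \<Rightarrow> 'k::comm_ring_1) \<Rightarrow> 'v \<Rightarrow> 'k" where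
  "inflow E t h x v = (\<Sum>e\<in>E. x e * (of_bool (h e = v) - of_bool (t e = v)))"

definition grad :: "('e \<Rightarrow> 'v) \<Rightarrow> ('e \<Rightarrow> 'v) \<Rightarrow> ('v \<Rightarrow> 'k::comm_ring_1) \<Rightarrow> 'e \<Rightarrow> 'k" where
  "grad t h \<xi> e = \<xi> (h e) - \<xi> (t e)"

type_synonym ('e, 'v, 'k) config = "('e \<Rightarrow> 'k) \<times> ('e \<Rightarrow> 'k) \<times> ('v \<Rightarrow> 'k) \<times> ('v \<Rightarrow> 'k)"

lemma inflow_add_mult:
  "inflow E t h (\<lambda>e. x e + c * y e) v = inflow E t h x v + c * inflow E t h y v"
  by (simp add: inflow_def distrib_right sum.distrib sum_distrib_left mult.assoc)

lemma inflow_diff: "inflow E t h (\<lambda>e. x e - y e) v = inflow E t h x v - inflow E t h y v"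
  using inflow_add_mult[of E t h x "- 1" y v] by simp

lemma inflow_zero [simp]: "inflow E t h (\<lambda>e. 0) v = 0"
  by (simp add: inflow_def)

lemma grad_add_mult: "grad t h (\<lambda>v. \<xi> v + c * \<eta> v) e = grad t h \<xi> e + c * grad t h \<eta> e"
  by (simp add: grad_def algebra_simps)

lemma grad_diff: "grad t h (\<lambda>v. \<xi> v - \<eta> v) e = grad t h \<xi> e - grad t h \<eta> e"
  by (simp add: grad_def)

lemma grad_zero [simp]: "grad t h (\<lambda>v. 0) e = 0"
  by (simp add: grad_def)

text \<open>The relations between the current and the voltage of an edge. A short circuit is
  \<open>resistor 0\<close>, an edge on which nothing is imposed has the relation \<open>UNIV\<close>. At an \<open>opened\<close> edge the
  voltage is free, which amounts to deleting the edge.\<close>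

definition resistor :: "'k::field \<Rightarrow> ('k \<times> 'k) set" where
  "resistor a = {(i, u). u = a * i}"

definition opened :: "('k::field \<times> 'k) set" where
  "opened = {(i, u). i = 0}"

definition dead :: "('k::field \<times> 'k) set" where
  "dead = {(0, 0)}"

definition linear_rel :: "('k::field \<times> 'k) set \<Rightarrow> bool" where
  "linear_rel R \<longleftrightarrow> (0, 0) \<in> R \<and>
     (\<forall>i u j w c. (i, u) \<in> R \<longrightarrow> (j, w) \<in> R \<longrightarrow> (i + c * j, u + c * w) \<in> R)"

lemma linear_rels [simp]:
  "linear_rel (resistor a)" "linear_rel opened" "linear_rel dead" "linear_rel UNIV"
  by (auto simp: linear_rel_def resistor_def opened_def dead_def algebra_simps)

text \<open>Here \<open>S\<close> is the space of solutions of a network in which one edge is free, and \<open>a\<close>, \<open>b\<close> are the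
  current and the voltage of this edge. If only the zero solution vanishes at the edge, \<open>S\<close> embeds into
  the plane by \<open>(a, b)\<close>. If its image is zero, all values of \<open>c\<close> are good. If it is a line, the resistor \<open>c\<close> leaves a nonzero solution iff \<open>c\<close> is
  the slope of the line, so there are \<open>q - 1\<close> good values of \<open>c\<close>, or \<open>q\<close> of them if the line is vertical,
  which is the case where the open edge is degenerate. If the image is the whole plane, all
  values are bad. In the first part isotropy excludes this case; in the second part a nonzero image
  is a line iff the open or the shorted edge is nondegenerate, and the joint term corrects for lines
  with both properties.\<close>

lemma pencil:
  fixes S :: "'s set" and a b :: "'s \<Rightarrow> 'k::{field,finite}" and comb :: "'k \<Rightarrow> 's \<Rightarrow> 's \<Rightarrow> 's"
  assumes comb: "\<And>c z w. z \<in> S \<Longrightarrow> w \<in> S \<Longrightarrow> comb c z w \<in> S"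
    "\<And>c z w. a (comb c z w) = a z + c * a w" "\<And>c z w. b (comb c z w) = b z + c * b w"
    and origin: "a o' = 0" "b o' = 0"
  defines "T \<equiv> \<lambda>R. \<forall>z\<in>S. (a z, b z) \<in> R \<longrightarrow> z = o'"
  shows pencil_isotropic: "(\<And>z w. z \<in> S \<Longrightarrow> w \<in> S \<Longrightarrow> a z * b w = a w * b z) \<Longrightarrow>
      int (card {c. T (resistor c)}) + of_bool (T opened)
      = int CARD('k) * of_bool (T dead) + of_bool (T UNIV)" (is "PROP _ \<Longrightarrow> ?iso")
    and pencil_nontrivial: "\<not> T UNIV \<Longrightarrow>
      int (card {c. T (resistor c)}) + of_bool (T opened)
        + int CARD('k) * of_bool (T opened \<and> T (resistor 0))
      = int CARD('k) * (of_bool (T opened) + of_bool (T (resistor 0)))" (is "_ \<Longrightarrow> ?nontrivial")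
proof -
  have mono: "T R' \<Longrightarrow> R \<subseteq> R' \<Longrightarrow> T R" for R R' by (auto simp: T_def)
  have sub: "dead \<subseteq> opened" "dead \<subseteq> resistor c" for c :: 'k
    by (auto simp: dead_def opened_def resistor_def)
  have all_but_one: "\<exists>c0. \<forall>c. T (resistor c) \<longleftrightarrow> c \<noteq> c0" if op: "T opened" and fr: "\<not> T UNIV"
  proof -
    obtain z where z: "z \<in> S" "z \<noteq> o'" using fr by (auto simp: T_def)
    have az: "a z \<noteq> 0" using op z by (auto simp: T_def opened_def)
    have "T (resistor c) \<longleftrightarrow> c \<noteq> b z / a z" for c
    proof
      assume "T (resistor c)"
      then show "c \<noteq> b z / a z" using z az by (auto simp: T_def resistor_def)
    next
      assume c: "c \<noteq> b z / a z"
      show "T (resistor c)"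
        unfolding T_def
      proof (intro ballI impI)
        fix w assume w: "w \<in> S" "(a w, b w) \<in> resistor c"
        show "w = o'"
        proof (rule ccontr)
          assume "w \<noteq> o'"
          then have aw: "a w \<noteq> 0" using op w by (auto simp: T_def opened_def)
          let ?u = "comb (- (a z / a w)) z w"
          have "a ?u = 0" using aw by (simp add: comb)
          then have "?u = o'" using op comb(1)[OF z(1) w(1)] by (auto simp: T_def opened_def)
          then have "b ?u = 0" using origin by simp
          then have "b z = a z * c" using aw w(2) by (simp add: comb resistor_def)
          then show False using c az by simp
        qed
      qed
    qed
    then show ?thesis by blast
  qed
  have card1: "int (card {c. T (resistor c)}) = int CARD('k) - 1" if op: "T opened" and fr: "\<not> T UNIV"
  proof -
    obtain c0 where "\<And>c. T (resistor c) \<longleftrightarrow> c \<noteq> c0" using all_but_one[OF op fr] by blast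
    then have "{c. T (resistor c)} = UNIV - {c0}" by auto
    moreover have "card (UNIV - {c0}) = CARD('k) - 1" by (simp add: card_Diff_singleton)
    ultimately show ?thesis using card_field_ge_2[where 'k = 'k] by simp
  qed
  have none: "{c. T (resistor c)} = {}" if "\<not> T dead" using that mono sub by blast
  have vertical: "\<exists>z\<in>S. a z = 0 \<and> b z \<noteq> 0" if "\<not> T opened" "T dead"
    using that by (fastforce simp: T_def opened_def dead_def)
  have dead0: "w = o'" if "T dead" "w \<in> S" "a w = 0" "b w = 0" for w
    using that by (auto simp: T_def dead_def)
  {
    assume iso: "\<And>z w. z \<in> S \<Longrightarrow> w \<in> S \<Longrightarrow> a z * b w = a w * b z"
    show ?iso
    proof (cases "T UNIV")
      case True
      then have "{c. T (resistor c)} = UNIV" "T opened" "T dead" using mono by blast+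
      with True show ?thesis by simp
    next
      case fr: False
      show ?thesis
      proof (cases "T opened")
        case True
        then have "T dead" using mono sub by blast
        with True fr card1 show ?thesis by simp
      next
        case op: False
        show ?thesis
        proof (cases "T dead")
          case True
          then obtain z where z: "z \<in> S" "a z = 0" "b z \<noteq> 0" using vertical op by blast
          have "T (resistor c)" for c
            unfolding T_def
          proof (intro ballI impI)
            fix w assume w: "w \<in> S" "(a w, b w) \<in> resistor c"
            have "a w = 0" using iso[OF w(1) z(1)] z by simp
            then show "w = o'" using dead0[OF True w(1)] w(2) by (simp add: resistor_def)
          qed
          then have "{c. T (resistor c)} = UNIV" by blast
          then show ?thesis using True op fr by simp
        next
          case False
          then show ?thesis using none op fr by simp
        qed
      qed
    qed
  next
    assume fr: "\<not> T UNIV"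
    show ?nontrivial
    proof (cases "T opened")
      case True
      then show ?thesis using card1[OF True fr] by (cases "T (resistor 0)") (simp_all add: algebra_simps)
    next
      case op: False
      show ?thesis
      proof (cases "T dead")
        case True
        then obtain z where z: "z \<in> S" "a z = 0" "b z \<noteq> 0" using vertical op by blast
        show ?thesis
        proof (cases "T (resistor 0)")
          case sh: True
          have "T (resistor c)" for c
            unfolding T_def
          proof (intro ballI impI, rule ccontr)
            fix w assume w: "w \<in> S" "(a w, b w) \<in> resistor c" "w \<noteq> o'"
            have aw: "a w \<noteq> 0" using dead0[OF True w(1)] w(2,3) by (auto simp: resistor_def)
            let ?u = "comb (- (b w / b z)) w z"
            have "b ?u = 0" using z by (simp add: comb)
            then have "?u = o'" using sh comb(1)[OF w(1) z(1)] by (auto simp: T_def resistor_def)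
            then have "a ?u = 0" using origin by simp
            then show False using aw z by (simp add: comb)
          qed
          then have "{c. T (resistor c)} = UNIV" by blast
          then show ?thesis using op sh by simp
        next
          case sh: False
          then obtain z1 where z1: "z1 \<in> S" "z1 \<noteq> o'" "b z1 = 0"
            by (auto simp: T_def resistor_def)
          have az1: "a z1 \<noteq> 0" using dead0[OF True z1(1)] z1 by auto
          have "\<not> T (resistor c)" for c
          proof
            assume c: "T (resistor c)"
            let ?u = "comb (c * a z1 / b z) z1 z"
            have "(a ?u, b ?u) \<in> resistor c" using z z1 by (simp add: comb resistor_def)
            then have "?u = o'" using c comb(1)[OF z1(1) z(1)] by (auto simp: T_def)
            then have "a ?u = 0" using origin by simp
            then show False using az1 z by (simp add: comb)
          qed
          then have "{c. T (resistor c)} = {}" by blast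
          then show ?thesis using op sh by simp
        qed
      next
        case False
        moreover have "\<not> T (resistor 0)" using False mono sub by blast
        ultimately show ?thesis using none op by simp
      qed
    qed
  }
qed

text \<open>The vertex \<open>r\<close> is the ground: potentials vanish there, which removes the additive constant, and
  Kirchhoff's law at \<open>r\<close> follows from the law at the other vertices.\<close>

locale network =
  fixes V :: "'v set" and E :: "'e set" and t h :: "'e \<Rightarrow> 'v" and r :: 'v
  assumes finite_V [simp]: "finite V" and finite_E [simp]: "finite E" and root: "r \<in> V"
    and tail_in: "e \<in> E \<Longrightarrow> t e \<in> V" and head_in: "e \<in> E \<Longrightarrow> h e \<in> V"
begin

abbreviation W :: "'v set" where "W \<equiv> V - {r}"

abbreviation net :: "('e \<Rightarrow> 'k::comm_ring_1) \<Rightarrow> 'v \<Rightarrow> 'k" where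
  "net \<equiv> inflow E t h"

abbreviation volt :: "('v \<Rightarrow> 'k::comm_ring_1) \<Rightarrow> 'e \<Rightarrow> 'k" where
  "volt \<equiv> grad t h"

definition sol :: "('e \<Rightarrow> ('k::field \<times> 'k) set) \<Rightarrow> (('e \<Rightarrow> 'k) \<times> ('v \<Rightarrow> 'k)) set" where
  "sol \<rho> = {(x, \<xi>). x \<in> supp_on E \<and> \<xi> \<in> supp_on W \<and> (\<forall>v\<in>W. net x v = 0) \<and>
     (\<forall>e\<in>E. (x e, volt \<xi> e) \<in> \<rho> e)}"

definition trivial :: "('e \<Rightarrow> ('k::field \<times> 'k) set) \<Rightarrow> bool" where
  "trivial \<rho> \<longleftrightarrow> sol \<rho> \<subseteq> {(\<lambda>_. 0, \<lambda>_. 0)}"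

text \<open>A vertex without potential contributes nothing on the right-hand side; this accounts for the
  root.\<close>

lemma summation_by_parts:
  fixes x :: "'e \<Rightarrow> 'k::comm_ring_1"
  assumes "\<xi> \<in> supp_on W"
  shows "(\<Sum>e\<in>E. x e * volt \<xi> e) = (\<Sum>v\<in>W. \<xi> v * net x v)"
proof -
  have pick: "(\<Sum>v\<in>W. \<xi> v * of_bool (u = v)) = \<xi> u" if "u \<in> V" for u
  proof (cases "u = r")
    case True
    then have "(\<Sum>v\<in>W. \<xi> v * of_bool (u = v)) = 0" by (intro sum.neutral) auto
    then show ?thesis using True assms by (simp add: supp_on_def)
  next
    case False
    then have "(\<Sum>v\<in>W. \<xi> v * of_bool (u = v)) = (\<Sum>v\<in>{u}. \<xi> v * of_bool (u = v))"
      using that by (intro sum.mono_neutral_right) auto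
    then show ?thesis by simp
  qed
  have "(\<Sum>v\<in>W. \<xi> v * net x v)
      = (\<Sum>v\<in>W. \<Sum>e\<in>E. x e * (\<xi> v * of_bool (h e = v) - \<xi> v * of_bool (t e = v)))"
    unfolding inflow_def sum_distrib_left
    by (intro sum.cong refl) (simp only: right_diff_distrib ac_simps)
  also have "\<dots> = (\<Sum>e\<in>E. \<Sum>v\<in>W. x e * (\<xi> v * of_bool (h e = v) - \<xi> v * of_bool (t e = v)))"
    by (rule sum.swap)
  also have "\<dots> = (\<Sum>e\<in>E. x e * ((\<Sum>v\<in>W. \<xi> v * of_bool (h e = v)) - (\<Sum>v\<in>W. \<xi> v * of_bool (t e = v))))"
    by (simp only: sum_distrib_left right_diff_distrib sum_subtractf)
  also have "\<dots> = (\<Sum>e\<in>E. x e * volt \<xi> e)"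
    by (intro sum.cong refl) (simp only: pick[OF tail_in] pick[OF head_in] grad_def)
  finally show ?thesis ..
qed

lemma flow_orthogonal:
  fixes x :: "'e \<Rightarrow> 'k::comm_ring_1"
  assumes "\<xi> \<in> supp_on W" "\<And>v. v \<in> W \<Longrightarrow> net x v = 0"
  shows "(\<Sum>e\<in>E. x e * volt \<xi> e) = 0"
  using assms by (simp add: summation_by_parts)

lemma sum_inflow: "(\<Sum>v\<in>V. net x v) = (0 :: 'k::comm_ring_1)"
proof -
  have pick: "(\<Sum>v\<in>V. of_bool (u = v)) = (1 :: 'k)" if "u \<in> V" for u
    using that by (simp add: of_bool_def)
  have "(\<Sum>v\<in>V. net x v) = (\<Sum>e\<in>E. x e * ((\<Sum>v\<in>V. of_bool (h e = v)) - (\<Sum>v\<in>V. of_bool (t e = v))))"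
    unfolding inflow_def by (subst sum.swap) (simp only: sum_distrib_left[symmetric] sum_subtractf)
  also have "\<dots> = 0"
    by (intro sum.neutral ballI) (simp add: pick tail_in head_in)
  finally show ?thesis .
qed

lemma inflow_root:
  assumes "\<And>v. v \<in> W \<Longrightarrow> net x v = 0"
  shows "net x r = (0 :: 'k::comm_ring_1)"
  using sum_inflow[of x] sum.remove[OF finite_V root, of "net x"] assms by simp

text \<open>The operation \<open>z + c w\<close> on pairs of a current and a potential.\<close>

definition combine :: "'k::comm_ring_1 \<Rightarrow> ('e \<Rightarrow> 'k) \<times> ('v \<Rightarrow> 'k) \<Rightarrow> ('e \<Rightarrow> 'k) \<times> ('v \<Rightarrow> 'k) \<Rightarrow>
    ('e \<Rightarrow> 'k) \<times> ('v \<Rightarrow> 'k)" where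
  "combine c z w = (\<lambda>e. fst z e + c * fst w e, \<lambda>v. snd z v + c * snd w v)"

lemma combine_in_sol:
  assumes "\<And>e. e \<in> E \<Longrightarrow> linear_rel (\<rho> e)" "z \<in> sol \<rho>" "w \<in> sol \<rho>"
  shows "combine c z w \<in> sol \<rho>"
  using assms unfolding sol_def combine_def
  by (auto simp: supp_on_def inflow_add_mult grad_add_mult linear_rel_def split: prod.splits)

lemma zero_in_sol:
  assumes "\<And>e. e \<in> E \<Longrightarrow> linear_rel (\<rho> e)"
  shows "(\<lambda>_. 0, \<lambda>_. 0) \<in> sol \<rho>"
  using assms by (simp add: sol_def linear_rel_def)

lemma finite_sol [simp]: "finite (sol (\<rho> :: 'e \<Rightarrow> ('k::{field,finite} \<times> 'k) set))"
  by (rule finite_subset[of _ "supp_on E \<times> supp_on W"]) (auto simp: sol_def)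

text \<open>A nonzero vector space has a size divisible by \<open>q\<close>, the zero space has size \<open>1\<close>.\<close>

lemma trivial_cong_card_sol:
  fixes \<rho> :: "'e \<Rightarrow> ('k::{field,finite} \<times> 'k) set"
  assumes lin: "\<And>e. e \<in> E \<Longrightarrow> linear_rel (\<rho> e)"
  shows "[of_bool (trivial \<rho>) = int (card (sol \<rho>))] (mod int CARD('k))"
proof (cases "trivial \<rho>")
  case True
  then have "sol \<rho> = {(\<lambda>_. 0, \<lambda>_. 0)}"
    using zero_in_sol[OF lin] unfolding trivial_def by auto
  then show ?thesis using True by simp
next
  case False
  then obtain z where z: "z \<in> sol \<rho>" "z \<noteq> (\<lambda>_. 0, \<lambda>_. 0)" by (auto simp: trivial_def)
  have "CARD('k) dvd card (sol \<rho>)"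
  proof (rule card_dvd_card_of_free_action[where act = "\<lambda>c w. combine c w z"])
    fix c w assume "combine c w z = w"
    then have "\<And>e. c * fst z e = 0" "\<And>v. c * snd z v = 0"
      by (auto simp: combine_def prod_eq_iff fun_eq_iff)
    then show "c = 0" using z(2) by (auto simp: prod_eq_iff fun_eq_iff)
  next
    fix c w assume "w \<in> sol \<rho>"
    then show "combine c w z \<in> sol \<rho>" by (intro combine_in_sol lin z(1))
  qed (auto simp: combine_def algebra_simps)
  then have "int CARD('k) dvd int (card (sol \<rho>))" by presburger
  then show ?thesis using False by (simp add: cong_0_iff cong_sym)
qed

text \<open>There are \<open>card E\<close> unknown currents and as many unknown potentials as laws of Kirchhoff, so
  fewer than \<open>card E\<close> further equations leave a nonzero solution. The map \<open>\<pi>\<close> attaches the equation with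
  index \<open>s\<close> to the edge \<open>\<pi> s\<close>, so that one edge can carry two equations.\<close>

lemma nontrivial_of_few_equations:
  fixes \<rho> :: "'e \<Rightarrow> ('k::{field,finite} \<times> 'k) set" and p c :: "'e \<Rightarrow> 'k" and \<pi> :: "'e \<Rightarrow> 'e"
  assumes "finite S" "card S < card E"
    and enough: "\<And>x \<xi>. x \<in> supp_on E \<Longrightarrow> (\<And>s. s \<in> S \<Longrightarrow> p s * x (\<pi> s) + c s * volt \<xi> (\<pi> s) = 0) \<Longrightarrow>
      \<forall>e\<in>E. (x e, volt \<xi> e) \<in> \<rho> e"
  shows "\<not> trivial \<rho>"
proof -
  define L :: "('e + 'v \<Rightarrow> 'k) \<Rightarrow> 'v + 'e \<Rightarrow> 'k" where
    "L = (\<lambda>F b. case b of Inl v \<Rightarrow> net (\<lambda>e. F (Inl e)) v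
        | Inr s \<Rightarrow> p s * F (Inl (\<pi> s)) + c s * volt (\<lambda>v. F (Inr v)) (\<pi> s))"
  obtain F where F: "F \<in> supp_on (E <+> W)" "F \<noteq> (\<lambda>_. 0)" "\<And>b. b \<in> W <+> S \<Longrightarrow> L F b = 0"
  proof (rule exists_nonzero_solution[of "E <+> W" "W <+> S" L])
    show "card (W <+> S) < card (E <+> W)" using assms(1,2) by (simp add: card_Plus)
    show "L (\<lambda>a. f a - g a) b = L f b - L g b" for f g b
      by (simp add: L_def inflow_diff grad_diff algebra_simps split: sum.split)
  qed (use assms in auto)
  let ?x = "\<lambda>e. F (Inl e)" and ?\<xi> = "\<lambda>v. F (Inr v)"
  have x: "?x \<in> supp_on E" "?\<xi> \<in> supp_on W" using F(1) by (auto simp: supp_on_def)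
  have fl: "net ?x v = 0" if "v \<in> W" for v
    using F(3)[OF InlI[OF that]] by (simp add: L_def)
  have eq: "p s * ?x (\<pi> s) + c s * volt ?\<xi> (\<pi> s) = 0" if "s \<in> S" for s
    using F(3)[OF InrI[OF that]] by (simp add: L_def)
  have "(?x, ?\<xi>) \<in> sol \<rho>"
    using x fl enough[OF x(1) eq] by (simp add: sol_def)
  moreover have "(?x, ?\<xi>) \<noteq> (\<lambda>_. 0, \<lambda>_. 0)"
  proof
    assume "(?x, ?\<xi>) = (\<lambda>_. 0, \<lambda>_. 0)"
    then have "F a = 0" for a by (cases a) (auto simp: fun_eq_iff)
    with F(2) show False by auto
  qed
  ultimately show ?thesis by (auto simp: trivial_def)
qed

text \<open>Both products have the same sum over all edges, because currents are orthogonal to gradients.\<close>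

lemma reciprocity:
  fixes x y :: "'e \<Rightarrow> 'k::field"
  assumes "\<xi> \<in> supp_on W" "\<eta> \<in> supp_on W"
    and "\<And>v. v \<in> W \<Longrightarrow> net x v = 0" "\<And>v. v \<in> W \<Longrightarrow> net y v = 0"
    and g: "g \<in> E" and rest: "\<And>e. e \<in> E \<Longrightarrow> e \<noteq> g \<Longrightarrow> x e * volt \<eta> e = y e * volt \<xi> e"
  shows "x g * volt \<eta> g = y g * volt \<xi> g"
proof -
  have "0 = (\<Sum>e\<in>E. x e * volt \<eta> e) - (\<Sum>e\<in>E. y e * volt \<xi> e)"
    using flow_orthogonal[OF assms(2,3)] flow_orthogonal[OF assms(1,4)] by simp
  also have "\<dots> = (\<Sum>e\<in>E. x e * volt \<eta> e - y e * volt \<xi> e)"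
    by (simp add: sum_subtractf)
  also have "\<dots> = x g * volt \<eta> g - y g * volt \<xi> g"
    using sum.remove[OF finite_E g, of "\<lambda>e. x e * volt \<eta> e - y e * volt \<xi> e"] rest
    by (simp add: sum.neutral)
  finally show ?thesis by simp
qed

lemma sol_upd:
  assumes "g \<in> E"
  shows "sol (\<sigma>(g := R)) = {z \<in> sol (\<sigma>(g := UNIV)). (fst z g, volt (snd z) g) \<in> R}"
  using assms by (auto simp: sol_def)

lemma trivial_upd:
  assumes "g \<in> E"
  shows "trivial (\<sigma>(g := R)) \<longleftrightarrow>
    (\<forall>z\<in>sol (\<sigma>(g := UNIV)). (fst z g, volt (snd z) g) \<in> R \<longrightarrow> z = (\<lambda>_. 0, \<lambda>_. 0))"
  unfolding trivial_def sol_upd[OF assms, of _ R] by blast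

text \<open>The two cases of the pencil at an edge \<open>g\<close>. If all other edges are resistors, open or dead,
  reciprocity makes the space of pairs (current, voltage) at \<open>g\<close> isotropic, hence at most a line.\<close>

lemma pencil_edge:
  fixes \<sigma> :: "'e \<Rightarrow> ('k::{field,finite} \<times> 'k) set"
  assumes g: "g \<in> E" and lin: "\<And>e. e \<in> E \<Longrightarrow> linear_rel (\<sigma> e)"
  shows isotropic_pencil_edge:
    "(\<And>e. e \<in> E - {g} \<Longrightarrow> (\<exists>a. \<sigma> e = resistor a) \<or> \<sigma> e = opened \<or> \<sigma> e = dead) \<Longrightarrow>
      int (card {c. trivial (\<sigma>(g := resistor c))}) + of_bool (trivial (\<sigma>(g := opened)))
      = int CARD('k) * of_bool (trivial (\<sigma>(g := dead))) + of_bool (trivial (\<sigma>(g := UNIV)))" (is "PROP _ \<Longrightarrow> ?iso")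
    and nontrivial_pencil_edge: "\<not> trivial (\<sigma>(g := UNIV)) \<Longrightarrow>
      int (card {c. trivial (\<sigma>(g := resistor c))}) + of_bool (trivial (\<sigma>(g := opened)))
        + int CARD('k) * of_bool (trivial (\<sigma>(g := opened)) \<and> trivial (\<sigma>(g := resistor 0)))
      = int CARD('k) * (of_bool (trivial (\<sigma>(g := opened))) + of_bool (trivial (\<sigma>(g := resistor 0))))" (is "_ \<Longrightarrow> ?nontrivial")
proof -
  let ?S = "sol (\<sigma>(g := UNIV))" and ?a = "\<lambda>z. fst z g" and ?b = "\<lambda>z. volt (snd z) g"
  have comb: "combine c z w \<in> ?S" if "z \<in> ?S" "w \<in> ?S" for c z w
    using that lin by (intro combine_in_sol) auto
  {
    assume iso: "\<And>e. e \<in> E - {g} \<Longrightarrow> (\<exists>a. \<sigma> e = resistor a) \<or> \<sigma> e = opened \<or> \<sigma> e = dead"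
    have recip: "?a z * ?b w = ?a w * ?b z" if "z \<in> ?S" "w \<in> ?S" for z w
    proof (rule reciprocity[OF _ _ _ _ g])
      fix e assume e: "e \<in> E" "e \<noteq> g"
      have "(fst z e, volt (snd z) e) \<in> \<sigma> e" "(fst w e, volt (snd w) e) \<in> \<sigma> e"
        using that e by (auto simp: sol_def)
      then show "fst z e * volt (snd w) e = fst w e * volt (snd z) e"
        using iso[of e] e by (auto simp: resistor_def opened_def dead_def)
    qed (use that in \<open>auto simp: sol_def\<close>)
    show ?iso
      unfolding trivial_upd[OF g, of \<sigma>]
      by (rule pencil_isotropic[where comb = combine and S = ?S])
         (assumption | rule comb recip | simp add: combine_def grad_add_mult)+
  next
    assume "\<not> trivial (\<sigma>(g := UNIV))"
    then show ?nontrivial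
      unfolding trivial_upd[OF g, of \<sigma>]
      by (intro pencil_nontrivial[where comb = combine and S = ?S])
         (assumption | rule comb | simp add: combine_def grad_add_mult)+
  }
qed

end

lemma card_dvd_pair_solutions:
  fixes L :: "('a \<Rightarrow> 'k::{field,finite}) \<Rightarrow> ('b \<Rightarrow> 'k) \<Rightarrow> 'c \<Rightarrow> 'k"
  assumes fin: "finite A" "finite B" "finite C" and few: "card C < card A + card B"
    and lin: "\<And>f f' g g' k c. c \<in> C \<Longrightarrow>
      L (\<lambda>a. f a + k * f' a) (\<lambda>b. g b + k * g' b) c = L f g c + k * L f' g' c"
  shows "CARD('k) dvd card {(f, g). f \<in> supp_on A \<and> g \<in> supp_on B \<and> (\<forall>c\<in>C. L f g c = 0)}"
    (is "_ dvd card ?S")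
proof -
  obtain F where F: "F \<in> supp_on (A <+> B)" "F \<noteq> (\<lambda>_. 0)"
      "\<And>c. c \<in> C \<Longrightarrow> L (\<lambda>a. F (Inl a)) (\<lambda>b. F (Inr b)) c = 0"
  proof (rule exists_nonzero_solution[of "A <+> B" C "\<lambda>F. L (\<lambda>a. F (Inl a)) (\<lambda>b. F (Inr b))"])
    show "card C < card (A <+> B)" using few fin by (simp add: card_Plus)
    fix F G :: "'a + 'b \<Rightarrow> 'k" and c assume "c \<in> C"
    then show "L (\<lambda>a. F (Inl a) - G (Inl a)) (\<lambda>b. F (Inr b) - G (Inr b)) c
        = L (\<lambda>a. F (Inl a)) (\<lambda>b. F (Inr b)) c - L (\<lambda>a. G (Inl a)) (\<lambda>b. G (Inr b)) c"
      using lin[of c "\<lambda>a. F (Inl a)" "-1" "\<lambda>a. G (Inl a)" "\<lambda>b. F (Inr b)" "\<lambda>b. G (Inr b)"] by simp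
  qed (use fin in auto)
  have supp: "a \<notin> A \<Longrightarrow> F (Inl a) = 0" "b \<notin> B \<Longrightarrow> F (Inr b) = 0" for a b
    using F(1) by (auto simp: supp_on_def)
  have nz: "(\<exists>a. F (Inl a) \<noteq> 0) \<or> (\<exists>b. F (Inr b) \<noteq> 0)"
  proof (rule ccontr)
    assume "\<not> ?thesis"
    then have "F s = 0" for s by (cases s) auto
    with F(2) show False by auto
  qed
  show ?thesis
  proof (rule card_dvd_card_of_free_action[where
        act = "\<lambda>k (f, g). (\<lambda>a. f a + k * F (Inl a), \<lambda>b. g b + k * F (Inr b))"])
    show "finite ?S"
      by (rule finite_subset[of _ "supp_on A \<times> supp_on B"]) (use fin in auto)
  next
    fix k s assume s: "s \<in> ?S"
    show "(case s of (f, g) \<Rightarrow> (\<lambda>a. f a + k * F (Inl a), \<lambda>b. g b + k * F (Inr b))) \<in> ?S"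
      using s F(3) by (auto simp: lin supp_on_def supp)
  next
    fix k s assume "s \<in> ?S"
      "(case s of (f, g) \<Rightarrow> (\<lambda>a. f a + k * F (Inl a), \<lambda>b. g b + k * F (Inr b))) = s"
    then have "\<And>a. k * F (Inl a) = 0" "\<And>b. k * F (Inr b) = 0"
      by (auto simp: fun_eq_iff split: prod.splits)
    with nz show "k = 0" by auto
  qed (auto simp: algebra_simps split: prod.splits)
qed

text \<open>For fixed \<open>x\<close> and \<open>y\<close> the equations are linear in \<open>\<xi>\<close> and \<open>\<eta>\<close>, with \<open>2 card A\<close> unknowns.\<close>

lemma card_dvd_solution_families:
  fixes L :: "'x \<Rightarrow> 'y \<Rightarrow> ('a \<Rightarrow> 'k::{field,finite}) \<Rightarrow> ('a \<Rightarrow> 'k) \<Rightarrow> 'c \<Rightarrow> 'k"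
  assumes fin: "finite X" "finite A" "finite C" and few: "card C < 2 * card A"
    and lin: "\<And>x y \<xi> \<xi>' \<eta> \<eta>' k c. L x y (\<lambda>a. \<xi> a + k * \<xi>' a) (\<lambda>a. \<eta> a + k * \<eta>' a) c
      = L x y \<xi> \<eta> c + k * L x y \<xi>' \<eta>' c"
  shows "CARD('k) dvd card {(x, y, \<xi>, \<eta>). (x, y) \<in> X \<and> \<xi> \<in> supp_on A \<and> \<eta> \<in> supp_on A \<and>
    (\<forall>c\<in>C. L x y \<xi> \<eta> c = 0)}" (is "_ dvd card ?F")
proof -
  define S where "S = (\<lambda>(x, y). {(\<xi>, \<eta>). \<xi> \<in> supp_on A \<and> \<eta> \<in> supp_on A \<and> (\<forall>c\<in>C. L x y \<xi> \<eta> c = 0)})"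
  have dvd: "CARD('k) dvd card (S p)" for p
  proof (cases p)
    case (Pair x y)
    show ?thesis
      unfolding Pair S_def prod.case
      by (rule card_dvd_pair_solutions[OF fin(2,2,3)]) (use few lin in simp_all)
  qed
  have finS: "finite (S p)" for p
  proof (rule finite_subset)
    show "S p \<subseteq> supp_on A \<times> supp_on A" unfolding S_def by (cases p) auto
    show "finite (supp_on A \<times> supp_on A :: (('a \<Rightarrow> 'k) \<times> ('a \<Rightarrow> 'k)) set)" using fin(2) by simp
  qed
  have "bij_betw (\<lambda>(x, y, \<xi>, \<eta>). ((x, y), (\<xi>, \<eta>))) ?F (Sigma X S)"
    by (rule bij_betwI[where g = "\<lambda>((x, y), (\<xi>, \<eta>)). (x, y, \<xi>, \<eta>)"])
       (auto simp: S_def split: prod.splits)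
  then have "card ?F = card (Sigma X S)"
    by (rule bij_betw_same_card)
  also have "\<dots> = (\<Sum>p\<in>X. card (S p))"
    by (rule card_SigmaI) (simp_all add: fin finS)
  finally show ?thesis by (simp add: dvd dvd_sum)
qed

lemma cong_of_dvd_card:
  assumes "CARD('k::{field,finite}) dvd n"
  shows "[int n = 0] (mod int CARD('k))"
  using assms by (simp add: cong_0_iff)

lemma card_supp_on_pointwise:
  fixes P :: "'a \<Rightarrow> 'k::{zero,finite} \<Rightarrow> bool"
  assumes "finite A"
  shows "card {f \<in> supp_on A. \<forall>a\<in>A. P a (f a)} = (\<Prod>a\<in>A. card {c. P a c})"
proof -
  have "bij_betw (\<lambda>f. restrict f A) {f \<in> supp_on A. \<forall>a\<in>A. P a (f a)} (Pi\<^sub>E A (\<lambda>a. {c. P a c}))"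
    by (rule bij_betwI[where g = "\<lambda>f a. if a \<in> A then f a else 0"])
       (auto simp: supp_on_def fun_eq_iff PiE_def extensional_def)
  from bij_betw_same_card[OF this] show ?thesis using assms by (simp add: card_PiE)
qed

text \<open>For \<open>(i, j) \<noteq> 0\<close> the vector \<open>(u, w)\<close> is at most one multiple of \<open>(i, j)\<close>, and it is one iff the two
  are parallel. For \<open>(i, j) = 0\<close> the count is \<open>q\<close> or \<open>0\<close>, so both vanish modulo \<open>q\<close>; this is why the second
  indicator is subtracted.\<close>

lemma card_scalars_cong:
  fixes i u j w :: "'k::{field,finite}"
  shows "[int (card {c. u = c * i \<and> w = c * j}) = of_bool (i * w = j * u) - of_bool (i = 0 \<and> j = 0)]
    (mod int CARD('k))"
proof (cases "i = 0 \<and> j = 0")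
  case True
  then show ?thesis
    by (cases "u = 0 \<and> w = 0") (auto simp: cong_0_iff)
next
  case False
  then obtain c where c: "\<And>c'. u = c' * i \<and> w = c' * j \<longleftrightarrow> c' = c \<and> i * w = j * u"
  proof (cases "i = 0")
    case True
    then show ?thesis using False by (intro that[of "w / j"]) (auto simp: field_simps)
  next
    case i: False
    then show ?thesis by (intro that[of "u / i"]) (auto simp: field_simps)
  qed
  then have "{c'. u = c' * i \<and> w = c' * j} = (if i * w = j * u then {c} else {})" by auto
  then show ?thesis using False by auto
qed

context network
begin

section \<open>Counting the resistances of nondegenerate networks\<close>

definition mixed :: "'e set \<Rightarrow> ('e \<Rightarrow> 'k::field) \<Rightarrow> ('e \<Rightarrow> ('k \<times> 'k) set) \<Rightarrow> 'e \<Rightarrow> ('k \<times> 'k) set" where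
  "mixed I \<alpha> \<rho> = (\<lambda>e. if e \<in> I then resistor (\<alpha> e) else \<rho> e)"

definition count :: "'e set \<Rightarrow> ('e \<Rightarrow> ('k::{field,finite} \<times> 'k) set) \<Rightarrow> int" where
  "count I \<rho> = (\<Sum>\<alpha>\<in>supp_on I. of_bool (trivial (mixed I \<alpha> \<rho>)))"

lemma mixed_upd: "g \<notin> I \<Longrightarrow> mixed I \<alpha> (\<rho>(g := R)) = (mixed I \<alpha> \<rho>)(g := R)"
  by (auto simp: mixed_def fun_eq_iff)

lemma count_insert:
  fixes \<rho> :: "'e \<Rightarrow> ('k::{field,finite} \<times> 'k) set"
  assumes "finite I" "g \<notin> I"
  shows "count (insert g I) \<rho> =
    (\<Sum>\<alpha>\<in>supp_on I. int (card {c. trivial ((mixed I \<alpha> \<rho>)(g := resistor c))}))"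
proof -
  have "mixed (insert g I) (\<alpha>(g := c)) \<rho> = (mixed I \<alpha> \<rho>)(g := resistor c)" for \<alpha> :: "'e \<Rightarrow> 'k" and c
    using assms by (auto simp: mixed_def fun_eq_iff)
  then have "count (insert g I) \<rho> =
      (\<Sum>\<alpha>\<in>supp_on I. \<Sum>c\<in>UNIV. of_bool (trivial ((mixed I \<alpha> \<rho>)(g := resistor c))))"
    unfolding count_def by (simp only: sum_supp_on_insert[OF assms])
  then show ?thesis by simp
qed

lemma count_pencil_isotropic:
  fixes \<rho> :: "'e \<Rightarrow> ('k::{field,finite} \<times> 'k) set"
  assumes "finite I" "g \<in> E" "g \<notin> I" and \<rho>: "\<And>e. \<rho> e = opened \<or> \<rho> e = dead"
  shows "count (insert g I) \<rho> + count I (\<rho>(g := opened))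
    = int CARD('k) * count I (\<rho>(g := dead)) + count I (\<rho>(g := UNIV))"
proof -
  have lin: "linear_rel (mixed I \<alpha> \<rho> e)" for \<alpha> e using \<rho>[of e] by (auto simp: mixed_def)
  have iso: "(\<exists>a. mixed I \<alpha> \<rho> e = resistor a) \<or> mixed I \<alpha> \<rho> e = opened \<or> mixed I \<alpha> \<rho> e = dead" for \<alpha> e
    using \<rho>[of e] by (auto simp: mixed_def)
  have pencil: "int (card {c. trivial ((mixed I \<alpha> \<rho>)(g := resistor c))}) + of_bool (trivial (mixed I \<alpha> (\<rho>(g := opened))))
      = int CARD('k) * of_bool (trivial (mixed I \<alpha> (\<rho>(g := dead)))) + of_bool (trivial (mixed I \<alpha> (\<rho>(g := UNIV))))"
    for \<alpha> unfolding mixed_upd[OF assms(3)]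
    by (rule isotropic_pencil_edge[OF assms(2)]) (rule lin iso)+
  show ?thesis
    using sum.cong[OF refl[of "supp_on I"] pencil]
    unfolding count_insert[OF assms(1,3)] unfolding count_def
    by (simp only: sum.distrib sum_distrib_left)
qed

definition joint_count :: "'e set \<Rightarrow> ('e \<Rightarrow> ('k::{field,finite} \<times> 'k) set) \<Rightarrow> ('e \<Rightarrow> ('k \<times> 'k) set) \<Rightarrow> int" where
  "joint_count I \<rho> \<rho>' = (\<Sum>\<alpha>\<in>supp_on I. of_bool (trivial (mixed I \<alpha> \<rho>) \<and> trivial (mixed I \<alpha> \<rho>')))"

lemma count_pencil_nontrivial:
  fixes \<rho> :: "'e \<Rightarrow> ('k::{field,finite} \<times> 'k) set"
  assumes "finite I" "g \<in> E" "g \<notin> I" and \<rho>: "\<And>e. linear_rel (\<rho> e)"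
    and nontriv: "\<And>\<alpha>. \<not> trivial (mixed I \<alpha> (\<rho>(g := UNIV)))"
  shows "count (insert g I) \<rho> + count I (\<rho>(g := opened))
      + int CARD('k) * joint_count I (\<rho>(g := opened)) (\<rho>(g := resistor 0))
    = int CARD('k) * (count I (\<rho>(g := opened)) + count I (\<rho>(g := resistor 0)))"
proof -
  have lin: "linear_rel (mixed I \<alpha> \<rho> e)" for \<alpha> e using \<rho>[of e] by (auto simp: mixed_def)
  have pencil: "int (card {c. trivial ((mixed I \<alpha> \<rho>)(g := resistor c))}) + of_bool (trivial (mixed I \<alpha> (\<rho>(g := opened))))
      + int CARD('k) * of_bool (trivial (mixed I \<alpha> (\<rho>(g := opened))) \<and> trivial (mixed I \<alpha> (\<rho>(g := resistor 0))))
      = int CARD('k) * (of_bool (trivial (mixed I \<alpha> (\<rho>(g := opened)))) + of_bool (trivial (mixed I \<alpha> (\<rho>(g := resistor 0)))))"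
    for \<alpha> using nontriv[of \<alpha>] unfolding mixed_upd[OF assms(3)]
    by (intro nontrivial_pencil_edge[OF assms(2)] lin)
  show ?thesis
    using sum.cong[OF refl[of "supp_on I"] pencil]
    unfolding count_insert[OF assms(1,3)] joint_count_def unfolding count_def
    by (simp only: sum.distrib sum_distrib_left distrib_left)
qed

text \<open>Every edge but \<open>e\<close> carries one equation.\<close>

lemma nontrivial_one_free:
  fixes \<alpha> :: "'e \<Rightarrow> 'k::{field,finite}"
  assumes "e \<in> E" "e \<notin> I"
  shows "\<not> trivial (mixed I \<alpha> ((\<lambda>_. opened)(e := UNIV)))"
proof (rule nontrivial_of_few_equations[of "E - {e}"
      "\<lambda>s. if s \<in> I then \<alpha> s else 1" "\<lambda>s. s" "\<lambda>s. if s \<in> I then - 1 else 0"])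
  show "card (E - {e}) < card E" using assms by (intro card_Diff1_less) auto
  show "\<forall>e'\<in>E. (x e', volt \<xi> e') \<in> mixed I \<alpha> ((\<lambda>_. opened)(e := UNIV)) e'"
    if "\<And>s. s \<in> E - {e} \<Longrightarrow> (if s \<in> I then \<alpha> s else 1) * x s + (if s \<in> I then - 1 else 0) * volt \<xi> s = 0"
    for x \<xi>
  proof
    fix e' assume "e' \<in> E"
    with that[of e'] assms(2) show "(x e', volt \<xi> e') \<in> mixed I \<alpha> ((\<lambda>_. opened)(e := UNIV)) e'"
      by (auto simp: mixed_def resistor_def opened_def split: if_splits)
  qed
qed simp

text \<open>The dead edge carries two equations and the two free edges none, so again there is one
  equation less than there are edges. The second equation of \<open>e\<close> gets the vacant index \<open>f\<close>.\<close>

lemma nontrivial_two_free: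
  fixes \<alpha> :: "'e \<Rightarrow> 'k::{field,finite}"
  assumes "e \<in> E" "f \<in> E" "g \<in> E" "distinct [e, f, g]" "{e, f, g} \<inter> I = {}"
  shows "\<not> trivial (mixed I \<alpha> ((\<lambda>_. opened)(e := dead, f := UNIV, g := UNIV)))"
proof (rule nontrivial_of_few_equations[of "E - {g}"
      "\<lambda>s. if s \<in> I then \<alpha> s else if s = f then 0 else 1" "\<lambda>s. if s = f then e else s"
      "\<lambda>s. if s \<in> I then - 1 else if s = f then 1 else 0"])
  show "card (E - {g}) < card E" using assms by (intro card_Diff1_less) auto
  show "\<forall>e'\<in>E. (x e', volt \<xi> e') \<in> mixed I \<alpha> ((\<lambda>_. opened)(e := dead, f := UNIV, g := UNIV)) e'"
    if eq: "\<And>s. s \<in> E - {g} \<Longrightarrow> (if s \<in> I then \<alpha> s else if s = f then 0 else 1) * x (if s = f then e else s)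
      + (if s \<in> I then - 1 else if s = f then 1 else 0) * volt \<xi> (if s = f then e else s) = 0"
    for x \<xi>
  proof
    fix e' assume "e' \<in> E"
    with eq[of e'] eq[of e] eq[of f] assms
    show "(x e', volt \<xi> e') \<in> mixed I \<alpha> ((\<lambda>_. opened)(e := dead, f := UNIV, g := UNIV)) e'"
      by (auto simp: mixed_def resistor_def opened_def dead_def split: if_splits)
  qed
qed simp

lemma count_cong_card:
  fixes \<rho> :: "'e \<Rightarrow> ('k::{field,finite} \<times> 'k) set"
  assumes "\<And>e. linear_rel (\<rho> e)"
  shows "[count I \<rho> = (\<Sum>\<alpha>\<in>supp_on I. int (card (sol (mixed I \<alpha> \<rho>))))] (mod int CARD('k))"
  unfolding count_def
proof (rule cong_sum)
  fix \<alpha> :: "'e \<Rightarrow> 'k"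
  have "linear_rel (mixed I \<alpha> \<rho> e)" for e using assms[of e] by (simp add: mixed_def)
  then show "[of_bool (trivial (mixed I \<alpha> \<rho>)) = int (card (sol (mixed I \<alpha> \<rho>)))] (mod int CARD('k))"
    by (rule trivial_cong_card_sol)
qed

text \<open>For a fixed current \<open>x\<close> the conditions are linear in the resistances and the potential together:
  \<open>card I + card W\<close> unknowns, one equation for each resistor and one for each edge of \<open>Z\<close>, whose voltage
  has to vanish. The relations of the edges outside \<open>I\<close> must be products, so that \<open>x\<close> does not interact
  with the voltage there.\<close>

lemma count_dvd_of_few_shorts:
  fixes \<rho> :: "'e \<Rightarrow> ('k::{field,finite} \<times> 'k) set"
  assumes I: "I \<subseteq> E" and Z: "Z \<subseteq> E - I" "card Z < card W" and lin: "\<And>e. linear_rel (\<rho> e)"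
    and \<rho>: "\<And>e. e \<in> E - I \<Longrightarrow> \<exists>A. \<rho> e = A \<times> (if e \<in> Z then {0} else UNIV)"
  shows "[count I \<rho> = 0] (mod int CARD('k))"
proof -
  have fin: "finite I" "finite Z"
    using finite_subset[OF I finite_E] finite_subset[of Z E] Z by auto
  define L :: "('e \<Rightarrow> 'k) \<Rightarrow> ('e \<Rightarrow> 'k) \<Rightarrow> ('v \<Rightarrow> 'k) \<Rightarrow> 'e \<Rightarrow> 'k" where
    "L = (\<lambda>x \<alpha> \<xi> e. if e \<in> I then \<alpha> e * x e - volt \<xi> e else volt \<xi> e)"
  define X where "X = {x \<in> supp_on E. (\<forall>v\<in>W. net x v = 0) \<and> (\<forall>e\<in>E - I. x e \<in> fst ` \<rho> e)}"
  have finX: "finite X" unfolding X_def by (rule finite_Collect_conjI) simp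
  define S where "S = (\<lambda>x. {(\<alpha>, \<xi>). \<alpha> \<in> supp_on I \<and> \<xi> \<in> supp_on W \<and> (\<forall>e\<in>I \<union> Z. L x \<alpha> \<xi> e = 0)})"
  have dvd: "CARD('k) dvd card (S x)" for x
    unfolding S_def
  proof (rule card_dvd_pair_solutions)
    show "card (I \<union> Z) < card I + card W"
      by (rule le_less_trans[OF card_Un_le add_strict_left_mono[OF Z(2)]])
  next
    fix \<alpha> \<alpha>' :: "'e \<Rightarrow> 'k" and \<xi> \<xi>' :: "'v \<Rightarrow> 'k" and k e
    show "L x (\<lambda>e. \<alpha> e + k * \<alpha>' e) (\<lambda>v. \<xi> v + k * \<xi>' v) e = L x \<alpha> \<xi> e + k * L x \<alpha>' \<xi>' e"
      by (simp add: L_def grad_add_mult algebra_simps)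
    show "finite I" by (rule fin(1))
    show "finite W" by simp
    show "finite (I \<union> Z)" using fin by blast
  qed
  have finS: "finite (S x)" for x
  proof (rule finite_subset)
    show "S x \<subseteq> supp_on I \<times> supp_on W" unfolding S_def by blast
    show "finite (supp_on I \<times> supp_on W :: (('e \<Rightarrow> 'k) \<times> ('v \<Rightarrow> 'k)) set)" using fin(1) by simp
  qed
  have fibre: "(\<alpha> \<in> supp_on I \<and> (x, \<xi>) \<in> sol (mixed I \<alpha> \<rho>)) \<longleftrightarrow> x \<in> X \<and> (\<alpha>, \<xi>) \<in> S x" for \<alpha> x \<xi>
  proof -
    have "(x e, u) \<in> \<rho> e \<longleftrightarrow> x e \<in> fst ` \<rho> e \<and> (e \<in> Z \<longrightarrow> u = 0)" if e: "e \<in> E - I" for e u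
    proof -
      obtain A where "\<rho> e = A \<times> (if e \<in> Z then {0} else UNIV)" using \<rho>[OF e] by blast
      then show ?thesis by simp
    qed
    then have "(\<forall>e\<in>E. (x e, volt \<xi> e) \<in> mixed I \<alpha> \<rho> e) \<longleftrightarrow>
        (\<forall>e\<in>I. L x \<alpha> \<xi> e = 0) \<and> (\<forall>e\<in>E - I. x e \<in> fst ` \<rho> e) \<and> (\<forall>e\<in>Z. L x \<alpha> \<xi> e = 0)"
      using I Z(1) unfolding mixed_def L_def resistor_def by (auto split: if_splits)
    then show ?thesis unfolding sol_def S_def X_def by auto
  qed
  have bij: "{(\<alpha>, z). \<alpha> \<in> supp_on I \<and> z \<in> sol (mixed I \<alpha> \<rho>)}
      = (\<lambda>(x, \<alpha>, \<xi>). (\<alpha>, x, \<xi>)) ` (SIGMA x:X. S x)" (is "?A = ?B")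
  proof (rule set_eqI)
    fix p :: "('e \<Rightarrow> 'k) \<times> ('e \<Rightarrow> 'k) \<times> ('v \<Rightarrow> 'k)"
    obtain \<alpha> x \<xi> where p: "p = (\<alpha>, x, \<xi>)" by (cases p) auto
    have "p \<in> ?A \<longleftrightarrow> \<alpha> \<in> supp_on I \<and> (x, \<xi>) \<in> sol (mixed I \<alpha> \<rho>)" by (simp add: p)
    also have "\<dots> \<longleftrightarrow> (x, \<alpha>, \<xi>) \<in> (SIGMA x:X. S x)"
      unfolding fibre by blast
    also have "\<dots> \<longleftrightarrow> p \<in> ?B" unfolding p by force
    finally show "p \<in> ?A \<longleftrightarrow> p \<in> ?B" .
  qed
  have "(\<Sum>\<alpha>\<in>supp_on I. card (sol (mixed I \<alpha> \<rho>))) = card (SIGMA \<alpha>:supp_on I. sol (mixed I \<alpha> \<rho>))"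
    by (rule card_SigmaI[symmetric]) (simp_all add: fin)
  also have "(SIGMA \<alpha>:supp_on I. sol (mixed I \<alpha> \<rho>)) = {(\<alpha>, z). \<alpha> \<in> supp_on I \<and> z \<in> sol (mixed I \<alpha> \<rho>)}"
    by auto
  also have "card \<dots> = card (SIGMA x:X. S x)"
    unfolding bij by (rule card_image, rule inj_onI) auto
  also have "\<dots> = (\<Sum>x\<in>X. card (S x))"
    by (rule card_SigmaI) (simp_all add: finX finS)
  finally have eq: "(\<Sum>\<alpha>\<in>supp_on I. card (sol (mixed I \<alpha> \<rho>))) = (\<Sum>x\<in>X. card (S x))" .
  have "CARD('k) dvd (\<Sum>\<alpha>\<in>supp_on I. card (sol (mixed I \<alpha> \<rho>)))"
    unfolding eq by (rule dvd_sum) (rule dvd)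
  then have "[int (\<Sum>\<alpha>\<in>supp_on I. card (sol (mixed I \<alpha> \<rho>))) = 0] (mod int CARD('k))"
    by (rule cong_of_dvd_card)
  then show ?thesis
    using cong_trans[OF count_cong_card[OF lin, of I]] by simp
qed


section \<open>Pairs of solutions and parallel configurations\<close>

text \<open>Pairs of a current and a potential as in the two networks of the joint count at \<open>g\<close>: in the
  first \<open>g\<close> is open, in the second it is shorted; in both \<open>e\<close> is dead and \<open>f\<close> is free. The resistors of
  the edges in \<open>J\<close> are not imposed.\<close>

definition configs :: "'e set \<Rightarrow> 'e \<Rightarrow> 'e \<Rightarrow> 'e \<Rightarrow>
    ('e, 'v, 'k::field) config set" where
  "configs J e f g = {(x, y, \<xi>, \<eta>).
     x \<in> supp_on (insert f J) \<and> y \<in> supp_on (insert f (insert g J)) \<and>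
     (\<forall>v\<in>W. net x v = 0) \<and> (\<forall>v\<in>W. net y v = 0) \<and>
     \<xi> \<in> supp_on W \<and> \<eta> \<in> supp_on W \<and>
     volt \<xi> e = 0 \<and> volt \<eta> e = 0 \<and> volt \<eta> g = 0}"

definition parallel_configs :: "'e set \<Rightarrow> 'e \<Rightarrow> 'e \<Rightarrow> 'e \<Rightarrow>
    ('e, 'v, 'k::field) config set" where
  "parallel_configs J e f g = {(x, y, \<xi>, \<eta>) \<in> configs J e f g.
     \<forall>i\<in>J. x i * volt \<eta> i = y i * volt \<xi> i}"

lemma finite_configs:
  assumes "finite J"
  shows "finite (configs J e f g :: ('e, 'v, 'k::{field,finite}) config set)"
  by (rule finite_subset[of _ "supp_on (insert f J) \<times> supp_on (insert f (insert g J)) \<times> supp_on W \<times> supp_on W"])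
     (use assms in \<open>auto simp: configs_def\<close>)

text \<open>For fixed currents the potentials are subject to one linear equation for each edge of \<open>J\<close>
  and to three more at \<open>e\<close> and \<open>g\<close>.\<close>

lemma card_dvd_parallel_configs:
  assumes J: "finite J" and few: "card J + 3 < 2 * card W"
  shows "CARD('k) dvd card (parallel_configs J e f g :: ('e, 'v, 'k::{field,finite}) config set)"
proof -
  define C where "C = Inl ` J \<union> {Inr 0, Inr 1, Inr (2::nat)}"
  define L :: "('e \<Rightarrow> 'k) \<Rightarrow> ('e \<Rightarrow> 'k) \<Rightarrow> ('v \<Rightarrow> 'k) \<Rightarrow> ('v \<Rightarrow> 'k) \<Rightarrow> 'e + nat \<Rightarrow> 'k" where
    "L = (\<lambda>x y \<xi> \<eta> c. case c of Inl i \<Rightarrow> x i * volt \<eta> i - y i * volt \<xi> i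
        | Inr n \<Rightarrow> if n = 0 then volt \<xi> e else if n = 1 then volt \<eta> e else volt \<eta> g)"
  define X :: "(('e \<Rightarrow> 'k) \<times> ('e \<Rightarrow> 'k)) set" where "X = {(x, y). x \<in> supp_on (insert f J) \<and> y \<in> supp_on (insert f (insert g J)) \<and>
     (\<forall>v\<in>W. net x v = 0) \<and> (\<forall>v\<in>W. net y v = 0)}"
  have finX: "finite X"
    by (rule finite_subset[of _ "supp_on (insert f J) \<times> supp_on (insert f (insert g J))"])
       (use J in \<open>auto simp: X_def\<close>)
  have "card C \<le> card J + 3"
    unfolding C_def by (rule order_trans[OF card_Un_le]) (simp add: card_image)
  then have "card C < 2 * card W" using few by (rule le_less_trans)
  moreover have "L x y (\<lambda>v. \<xi> v + k * \<xi>' v) (\<lambda>v. \<eta> v + k * \<eta>' v) c = L x y \<xi> \<eta> c + k * L x y \<xi>' \<eta>' c"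
    for x y \<xi> \<xi>' \<eta> \<eta>' k c
    by (simp add: L_def grad_add_mult algebra_simps split: sum.split)
  moreover have "finite C" using J by (simp add: C_def)
  ultimately have "CARD('k) dvd card {(x, y, \<xi>, \<eta>). (x, y) \<in> X \<and> \<xi> \<in> supp_on W \<and> \<eta> \<in> supp_on W \<and>
      (\<forall>c\<in>C. L x y \<xi> \<eta> c = 0)}"
    by (intro card_dvd_solution_families finX) simp_all
  also have "{(x, y, \<xi>, \<eta>). (x, y) \<in> X \<and> \<xi> \<in> supp_on W \<and> \<eta> \<in> supp_on W \<and> (\<forall>c\<in>C. L x y \<xi> \<eta> c = 0)}
      = parallel_configs J e f g"
    by (auto simp: parallel_configs_def configs_def X_def C_def L_def)
  finally show ?thesis .
qed

text \<open>The joint count is modulo \<open>q\<close> the number of triples of resistances and solutions of the two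
  networks. For fixed solutions the resistances can be chosen edge by edge, and the number of choices
  at \<open>i\<close> is, by \<open>card_scalars_cong\<close>, the indicator of parallelism minus the indicator of zero current.
  Expanding the product over \<open>J\<close>, the terms with zero current on a nonempty set \<open>S\<close> of edges count the
  parallel configurations of the graph without \<open>S\<close>, and vanish modulo \<open>q\<close> because there are fewer
  equations. Only the term of \<open>S = {}\<close> remains.\<close>

lemma joint_count_cong:
  fixes e f g :: 'e and J :: "'e set"
  defines "\<rho> \<equiv> (\<lambda>_. opened)(e := dead, f := UNIV, g := opened :: ('k::{field,finite} \<times> 'k) set)"
    and "\<rho>' \<equiv> (\<lambda>_. opened)(e := dead, f := UNIV, g := resistor (0 :: 'k))"
  assumes J: "insert e (insert f (insert g J)) \<subseteq> E" "{e, f, g} \<inter> J = {}" "distinct [e, f, g]"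
    and few: "card J + 3 \<le> 2 * card W"
  shows "[joint_count J \<rho> \<rho>' =
    int (card (parallel_configs J e f g :: ('e, 'v, 'k) config set))] (mod int CARD('k))"
proof -
  let ?K = "configs J e f g :: ('e, 'v, 'k) config set"
  let ?n = "\<lambda>J. int (card (parallel_configs J e f g :: ('e, 'v, 'k) config set))"
    and ?Q = "\<lambda>S (x, y, \<xi>, \<eta>). (\<forall>i\<in>S. x i = 0 \<and> y i = (0 :: 'k)) \<and>
      (\<forall>i\<in>J - S. x i * volt \<eta> i = y i * volt \<xi> i)"
  have finJ: "finite J" by (rule finite_subset[OF _ finite_E]) (use J in auto)
  have lin: "linear_rel (mixed J \<alpha> \<rho> i)" "linear_rel (mixed J \<alpha> \<rho>' i)" for \<alpha> i
    by (auto simp: mixed_def \<rho>_def \<rho>'_def)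
  define ohm where "ohm = (\<lambda>\<alpha> (x, y, \<xi>, \<eta>). \<forall>i\<in>J. volt \<xi> i = \<alpha> i * x i \<and> volt \<eta> i = \<alpha> i * (y i :: 'k))"
  have sols: "(x, \<xi>) \<in> sol (mixed J \<alpha> \<rho>) \<and> (y, \<eta>) \<in> sol (mixed J \<alpha> \<rho>') \<longleftrightarrow>
      (x, y, \<xi>, \<eta>) \<in> configs J e f g \<and> ohm \<alpha> (x, y, \<xi>, \<eta>)" for x y \<xi> \<eta> \<alpha>
  proof -
    have 1: "(x, \<xi>) \<in> sol (mixed J \<alpha> \<rho>) \<longleftrightarrow> x \<in> supp_on (insert f J) \<and> \<xi> \<in> supp_on W \<and>
        (\<forall>v\<in>W. net x v = 0) \<and> volt \<xi> e = 0 \<and> (\<forall>i\<in>J. volt \<xi> i = \<alpha> i * x i)"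
      using J by (auto simp: sol_def mixed_def \<rho>_def resistor_def opened_def dead_def supp_on_def split: if_splits)
    have 2: "(y, \<eta>) \<in> sol (mixed J \<alpha> \<rho>') \<longleftrightarrow> y \<in> supp_on (insert f (insert g J)) \<and> \<eta> \<in> supp_on W \<and>
        (\<forall>v\<in>W. net y v = 0) \<and> volt \<eta> e = 0 \<and> volt \<eta> g = 0 \<and> (\<forall>i\<in>J. volt \<eta> i = \<alpha> i * y i)"
      using J by (auto simp: sol_def mixed_def \<rho>'_def resistor_def opened_def dead_def supp_on_def split: if_splits)
    show ?thesis unfolding 1 2 by (auto simp: configs_def ohm_def)
  qed
  have "[joint_count J \<rho> \<rho>' = (\<Sum>\<alpha>\<in>supp_on J. int (card (sol (mixed J \<alpha> \<rho>))) * int (card (sol (mixed J \<alpha> \<rho>'))))]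
      (mod int CARD('k))"
    unfolding joint_count_def of_bool_conj
    by (rule cong_sum, rule cong_mult; rule trivial_cong_card_sol; rule lin)
  also have "(\<Sum>\<alpha>\<in>supp_on J. int (card (sol (mixed J \<alpha> \<rho>))) * int (card (sol (mixed J \<alpha> \<rho>'))))
      = (\<Sum>\<alpha>\<in>supp_on J. int (card {b \<in> ?K. ohm \<alpha> b}))"
  proof (rule sum.cong)
    fix \<alpha> :: "'e \<Rightarrow> 'k"
    have "bij_betw (\<lambda>((x, \<xi>), (y, \<eta>)). (x, y, \<xi>, \<eta>)) (sol (mixed J \<alpha> \<rho>) \<times> sol (mixed J \<alpha> \<rho>')) {b \<in> ?K. ohm \<alpha> b}"
      by (rule bij_betwI[where g = "\<lambda>(x, y, \<xi>, \<eta>). ((x, \<xi>), (y, \<eta>))"]) (use sols in \<open>auto split: prod.splits\<close>)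
    from bij_betw_same_card[OF this]
    show "int (card (sol (mixed J \<alpha> \<rho>))) * int (card (sol (mixed J \<alpha> \<rho>'))) = int (card {b \<in> ?K. ohm \<alpha> b})"
      by (simp add: card_cartesian_product flip: of_nat_mult)
  qed simp
  also have "\<dots> = (\<Sum>b\<in>?K. int (card {\<alpha> \<in> supp_on J. ohm \<alpha> b}))"
  proof -
    have "(\<Sum>\<alpha>\<in>supp_on J. int (card {b \<in> ?K. ohm \<alpha> b})) = (\<Sum>\<alpha>\<in>supp_on J. \<Sum>b\<in>?K. of_bool (ohm \<alpha> b))"
      by (rule sum.cong) (simp_all add: finite_configs finJ Collect_conj_eq)
    also have "\<dots> = (\<Sum>b\<in>?K. \<Sum>\<alpha>\<in>supp_on J. of_bool (ohm \<alpha> b))"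
      by (rule sum.swap)
    also have "\<dots> = (\<Sum>b\<in>?K. int (card {\<alpha> \<in> supp_on J. ohm \<alpha> b}))"
      by (rule sum.cong) (simp_all add: finJ Collect_conj_eq)
    finally show ?thesis .
  qed
  also have "[\<dots> = (\<Sum>b\<in>?K. \<Sum>S\<in>Pow J. (- 1) ^ card S *
      of_bool (?Q S b))] (mod int CARD('k))"
  proof (rule cong_sum)
    fix b :: "('e, 'v, 'k) config"
    obtain x y \<xi> \<eta> where b: "b = (x, y, \<xi>, \<eta>)" by (cases b) auto
    let ?p = "\<lambda>i. x i * volt \<eta> i = y i * volt \<xi> i" and ?z = "\<lambda>i. x i = 0 \<and> y i = 0"
    have prod_of_bool: "(\<Prod>i\<in>A. of_bool (P i)) = (of_bool (\<forall>i\<in>A. P i) :: int)" if "finite A" for A and P :: "'e \<Rightarrow> bool"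
      using that by (induction A) auto
    have "int (card {\<alpha> \<in> supp_on J. ohm \<alpha> b})
        = (\<Prod>i\<in>J. int (card {c. volt \<xi> i = c * x i \<and> volt \<eta> i = c * y i}))"
      unfolding b ohm_def prod.case by (subst card_supp_on_pointwise[OF finJ]) simp
    also have "[\<dots> = (\<Prod>i\<in>J. of_bool (?p i) - of_bool (?z i))] (mod int CARD('k))"
      by (rule cong_prod) (rule card_scalars_cong)
    also have "(\<Prod>i\<in>J. of_bool (?p i) - of_bool (?z i) :: int)
        = (\<Sum>S\<in>Pow J. (- 1) ^ card S * (\<Prod>i\<in>S. of_bool (?z i)) * (\<Prod>i\<in>J - S. of_bool (?p i)))"
      by (rule prod_diff_conv_sum[OF finJ])
    also have "\<dots> = (\<Sum>S\<in>Pow J. (- 1) ^ card S * of_bool ((\<forall>i\<in>S. ?z i) \<and> (\<forall>i\<in>J - S. ?p i)))"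
    proof (rule sum.cong)
      fix S assume "S \<in> Pow J"
      then have fin: "finite S" "finite (J - S)" using finJ finite_subset by auto
      show "(- 1) ^ card S * (\<Prod>i\<in>S. of_bool (?z i)) * (\<Prod>i\<in>J - S. of_bool (?p i))
          = ((- 1) ^ card S * of_bool ((\<forall>i\<in>S. ?z i) \<and> (\<forall>i\<in>J - S. ?p i)) :: int)"
        by (simp only: prod_of_bool[OF fin(1), of ?z] prod_of_bool[OF fin(2), of ?p] of_bool_conj[of "\<forall>i\<in>S. ?z i"] mult.assoc)
    qed simp
    finally show "[int (card {\<alpha> \<in> supp_on J. ohm \<alpha> b}) = (\<Sum>S\<in>Pow J. (- 1) ^ card S *
      of_bool (?Q S b))] (mod int CARD('k))"
      by (simp add: b)
  qed
  also have "(\<Sum>b\<in>?K. \<Sum>S\<in>Pow J. (- 1) ^ card S *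
      of_bool (?Q S b))
    = (\<Sum>S\<in>Pow J. (- 1) ^ card S * ?n (J - S))"
  proof (subst sum.swap, rule sum.cong)
    fix S assume S: "S \<in> Pow J"
    have "{b \<in> ?K. ?Q S b} = parallel_configs (J - S) e f g"
      using S J(2) by (fastforce simp: parallel_configs_def configs_def supp_on_def)
    then show "(\<Sum>b\<in>?K. (- 1) ^ card S * of_bool (?Q S b))
        = (- 1) ^ card S * ?n (J - S)"
      by (simp add: finite_configs finJ Collect_conj_eq flip: sum_distrib_left)
  qed simp
  also have "[\<dots> = (\<Sum>S\<in>Pow J. if S = {} then ?n J else 0)]
      (mod int CARD('k))"
  proof (rule cong_sum)
    fix S assume S: "S \<in> Pow J"
    show "[(- 1) ^ card S * ?n (J - S)
      = (if S = {} then ?n J else 0)] (mod int CARD('k))"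
    proof (cases "S = {}")
      case False
      then have "card (J - S) < card J" using S finJ by (intro psubset_card_mono) auto
      then have "CARD('k) dvd card (parallel_configs (J - S) e f g :: ('e, 'v, 'k) config set)"
        using finJ by (intro card_dvd_parallel_configs less_le_trans[OF _ few]) simp_all
      then show ?thesis using False by (simp add: cong_0_iff)
    qed simp
  qed
  also have "(\<Sum>S\<in>Pow J. if S = {} then ?n J else 0)
      = ?n J"
    using finJ by simp
  finally show ?thesis .
qed

end

section \<open>The number of nondegenerate networks modulo the cube of q\<close>

text \<open>The bookkeeping of the three eliminations at \<open>e\<close>, \<open>f\<close>, \<open>g\<close>. The letters \<open>a\<close>, \<open>b\<close>, \<open>d\<close> stand for the
  counts after zero, one and two eliminations, and their suffix for those of the three edges that are
  still resistors, the others being open; \<open>c\<close> counts with both \<open>e\<close> and \<open>f\<close> dead, \<open>s\<close> with \<open>g\<close> shorted,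
  and \<open>j\<close> is the joint count.\<close>

lemma cube_dvd_elimination:
  fixes q :: int
  assumes A: "aefg + afg = q * bfg" "aeg + ag = q * bg" "aef + af = q * bf" "ae + a0 = q * b0"
    and B: "bfg + bg = q * cg + dg" "bf + b0 = q * c0 + d0"
    and C: "dg + d0 + q * j = q * (d0 + s)"
    and cube: "q ^ 3 dvd afg" "q ^ 3 dvd aeg" "q ^ 3 dvd ag" "q ^ 3 dvd aef" "q ^ 3 dvd af" "q ^ 3 dvd ae" "q ^ 3 dvd a0"
    and one: "q dvd cg" "q dvd c0" "q dvd s" "q dvd j - p"
  shows "q ^ 3 dvd aefg + q\<^sup>2 * p"
proof -
  have sq: "q ^ 3 dvd q * (q * z)" if "q dvd z" for z
    using that by (auto simp: power3_eq_cube)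
  have "q * d0 = (aef + af) + (ae + a0) - q * (q * c0)"
    using A(3,4) B(2) by algebra
  then have d0: "q ^ 3 dvd q * d0"
    using cube sq[OF one(2)] by simp
  have "aefg + q\<^sup>2 * p = q * (q * cg) + q * (q * d0) + q * (q * s) - q * d0 - q * (q * (j - p)) - aeg - ag - afg"
    using A(1,2) B(1) C by algebra
  moreover have "q ^ 3 dvd q * (q * cg) + q * (q * d0) + q * (q * s) - q * d0 - q * (q * (j - p)) - aeg - ag - afg"
    by (intro dvd_add dvd_diff sq one cube d0 dvd_mult[OF d0])
  ultimately show ?thesis by simp
qed

context network
begin

abbreviation all_open :: "'e \<Rightarrow> ('k::field \<times> 'k) set" where
  "all_open \<equiv> \<lambda>_. opened"

lemma count_delete:
  assumes "I \<subseteq> E" "e \<in> E" "e \<notin> I"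
  shows "count (insert e I) (all_open :: 'e \<Rightarrow> ('k::{field,finite} \<times> 'k) set) + count I (all_open :: 'e \<Rightarrow> ('k \<times> 'k) set)
    = int CARD('k) * count I (all_open(e := dead :: ('k \<times> 'k) set))"
proof -
  have "count I (all_open(e := UNIV :: ('k \<times> 'k) set)) = 0"
    unfolding count_def using nontrivial_one_free[OF assms(2,3), where 'k = 'k]
    by (intro sum.neutral) simp
  moreover have "all_open(e := opened :: ('k \<times> 'k) set) = all_open" by auto
  ultimately show ?thesis
    using count_pencil_isotropic[OF finite_subset[OF assms(1) finite_E] assms(2,3),
        of "all_open :: 'e \<Rightarrow> ('k \<times> 'k) set"] by simp
qed

lemma count_delete_dead:
  assumes "I \<subseteq> E" "f \<in> E" "f \<notin> I" "f \<noteq> e"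
  shows "count (insert f I) (all_open(e := dead :: ('k::{field,finite} \<times> 'k) set))
      + count I (all_open(e := dead :: ('k \<times> 'k) set))
    = int CARD('k) * count I (all_open(e := dead, f := dead :: ('k \<times> 'k) set))
      + count I (all_open(e := dead, f := UNIV :: ('k \<times> 'k) set))"
proof -
  have "all_open(e := dead, f := opened :: ('k \<times> 'k) set) = all_open(e := dead)"
    using assms(4) by (simp add: fun_eq_iff)
  then show ?thesis
    using count_pencil_isotropic[OF finite_subset[OF assms(1) finite_E] assms(2,3),
        of "all_open(e := dead :: ('k \<times> 'k) set)"] by (simp split: if_splits)
qed

lemma count_delete_dead_free:
  assumes "I \<subseteq> E" "{e, f, g} \<subseteq> E" "{e, f, g} \<inter> I = {}" "distinct [e, f, g]"
  shows "count (insert g I) (all_open(e := dead, f := UNIV :: ('k::{field,finite} \<times> 'k) set))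
      + count I (all_open(e := dead, f := UNIV :: ('k \<times> 'k) set))
      + int CARD('k) * joint_count I (all_open(e := dead, f := UNIV, g := opened))
          (all_open(e := dead, f := UNIV, g := resistor (0 :: 'k)))
    = int CARD('k) * (count I (all_open(e := dead, f := UNIV :: ('k \<times> 'k) set))
      + count I (all_open(e := dead, f := UNIV, g := resistor (0 :: 'k))))"
proof -
  have "all_open(e := dead, f := UNIV, g := opened :: ('k \<times> 'k) set) = all_open(e := dead, f := UNIV)"
    using assms(4) by (simp add: fun_eq_iff)
  moreover have "\<not> trivial (mixed I \<alpha> (all_open(e := dead, f := UNIV, g := UNIV)))" for \<alpha> :: "'e \<Rightarrow> 'k"
    using assms by (intro nontrivial_two_free) auto
  moreover have "linear_rel ((all_open(e := dead, f := UNIV)) i :: ('k \<times> 'k) set)" for i by simp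
  ultimately show ?thesis
    using count_pencil_nontrivial[OF finite_subset[OF assms(1) finite_E], of g
        "all_open(e := dead, f := UNIV :: ('k \<times> 'k) set)"] assms(2,3) by simp
qed

lemma count_two_dead_cong:
  assumes "I \<subseteq> E" "e \<in> E - I" "f \<in> E - I" "2 < card W"
  shows "[count I (all_open(e := dead, f := dead :: ('k::{field,finite} \<times> 'k) set)) = 0] (mod int CARD('k))"
proof (rule count_dvd_of_few_shorts[OF assms(1), of "{e, f}"])
  have "card {e, f} \<le> 2" by (cases "e = f") auto
  then show "card {e, f} < card W" using assms(4) by (rule le_less_trans)
  have "dead = {0} \<times> {0 :: 'k}" "opened = {0} \<times> (UNIV :: 'k set)" by (auto simp: dead_def opened_def)
  then show "\<exists>A. (all_open(e := dead, f := dead)) i = A \<times> (if i \<in> {e, f} then {0} else (UNIV :: 'k set))" for i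
    by (intro exI[of _ "{0}"]) auto
qed (use assms in auto)

lemma count_dead_short_cong:
  assumes "I \<subseteq> E" "{e, f, g} \<subseteq> E - I" "distinct [e, f, g]" "2 < card W"
  shows "[count I (all_open(e := dead, f := UNIV, g := resistor (0 :: 'k::{field,finite}))) = 0] (mod int CARD('k))"
proof (rule count_dvd_of_few_shorts[OF assms(1), of "{e, g}"])
  show "card {e, g} < card W" using assms(3,4) by (simp only: distinct.simps card_2_iff') auto
  have "dead = {0} \<times> {0 :: 'k}" "opened = {0} \<times> (UNIV :: 'k set)" "resistor 0 = UNIV \<times> {0 :: 'k}"
    by (auto simp: dead_def opened_def resistor_def)
  then show "\<exists>A. (all_open(e := dead, f := UNIV, g := resistor 0)) i = A \<times> (if i \<in> {e, g} then {0} else (UNIV :: 'k set))" for i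
    using assms(3) by (intro exI[of _ "if i \<in> {f, g} then UNIV else {0}"]) auto
qed (use assms in auto)

text \<open>All counts with an additional open edge vanish modulo \<open>q\<^sup>3\<close> by assumption, so that only the
  joint count survives the three eliminations, with the factor \<open>- q\<^sup>2\<close>.\<close>

lemma count_cong_parallel_configs_step:
  fixes K :: "'e set"
  assumes K: "insert e (insert f (insert g K)) \<subseteq> E" "{e, f, g} \<inter> K = {}" "distinct [e, f, g]"
    and W: "2 < card W" and few: "card K + 3 \<le> 2 * card W"
    and IH: "\<And>J. J \<subset> insert e (insert f (insert g K)) \<Longrightarrow>
      [count J (all_open :: 'e \<Rightarrow> ('k::{field,finite} \<times> 'k) set) = 0] (mod int CARD('k) ^ 3)"
  shows "[count (insert e (insert f (insert g K))) (all_open :: 'e \<Rightarrow> ('k \<times> 'k) set)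
    = - (int CARD('k) ^ 2 * int (card (parallel_configs K e f g :: ('e, 'v, 'k) config set)))]
    (mod int CARD('k) ^ 3)"
proof -
  let ?q = "int CARD('k)" and ?op = "all_open :: 'e \<Rightarrow> ('k \<times> 'k) set"
  let ?p = "int (card (parallel_configs K e f g :: ('e, 'v, 'k) config set))"
  have dvd: "?q ^ 3 dvd count J ?op" if "J \<subset> insert e (insert f (insert g K))" for J
    using IH[OF that] by (simp add: cong_0_iff)
  have "?q ^ 3 dvd count (insert e (insert f (insert g K))) ?op + ?q\<^sup>2 * ?p"
  proof (rule cube_dvd_elimination)
    show "count (insert e (insert f (insert g K))) ?op + count (insert f (insert g K)) ?op
        = ?q * count (insert f (insert g K)) (?op(e := dead))"
      by (rule count_delete) (use K in auto)
    show "count (insert e (insert g K)) ?op + count (insert g K) ?op = ?q * count (insert g K) (?op(e := dead))"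
      by (rule count_delete) (use K in auto)
    show "count (insert e (insert f K)) ?op + count (insert f K) ?op = ?q * count (insert f K) (?op(e := dead))"
      by (rule count_delete) (use K in auto)
    show "count (insert e K) ?op + count K ?op = ?q * count K (?op(e := dead))"
      by (rule count_delete) (use K in auto)
    show "count (insert f (insert g K)) (?op(e := dead)) + count (insert g K) (?op(e := dead))
        = ?q * count (insert g K) (?op(e := dead, f := dead)) + count (insert g K) (?op(e := dead, f := UNIV))"
      by (rule count_delete_dead) (use K in auto)
    show "count (insert f K) (?op(e := dead)) + count K (?op(e := dead))
        = ?q * count K (?op(e := dead, f := dead)) + count K (?op(e := dead, f := UNIV))"
      by (rule count_delete_dead) (use K in auto)
    show "count (insert g K) (?op(e := dead, f := UNIV)) + count K (?op(e := dead, f := UNIV))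
      + ?q * joint_count K (?op(e := dead, f := UNIV, g := opened)) (?op(e := dead, f := UNIV, g := resistor 0))
      = ?q * (count K (?op(e := dead, f := UNIV)) + count K (?op(e := dead, f := UNIV, g := resistor 0)))"
      by (rule count_delete_dead_free) (use K in auto)
    show "?q dvd joint_count K (?op(e := dead, f := UNIV, g := opened)) (?op(e := dead, f := UNIV, g := resistor 0)) - ?p"
      using joint_count_cong[OF K few, where 'k = 'k] by (simp only: cong_iff_dvd_diff)
    show "?q dvd count (insert g K) (?op(e := dead, f := dead))"
      unfolding cong_0_iff[symmetric] by (rule count_two_dead_cong) (use K W in auto)
    show "?q dvd count K (?op(e := dead, f := dead))"
      unfolding cong_0_iff[symmetric] by (rule count_two_dead_cong) (use K W in auto)
    show "?q dvd count K (?op(e := dead, f := UNIV, g := resistor 0))"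
      unfolding cong_0_iff[symmetric] by (rule count_dead_short_cong) (use K W in auto)
  qed (rule dvd; use K in auto)+
  then show ?thesis by (simp only: cong_iff_dvd_diff diff_minus_eq_add)
qed

text \<open>By induction on the number of resistors. With at least three of them the count is a multiple
  of a number of parallel configurations, which vanishes modulo \<open>q\<close> by \<open>card_dvd_parallel_configs\<close>.
  With less than three, a nonzero potential can be chosen constant along all of them, and every
  network is degenerate.\<close>

lemma count_cong_0:
  fixes I :: "'e set"
  assumes "I \<subseteq> E" "2 < card W" "card I < 2 * card W"
  shows "[count I (all_open :: 'e \<Rightarrow> ('k::{field,finite} \<times> 'k) set) = 0] (mod int CARD('k) ^ 3)"
  using assms(1,3)
proof (induction "card I" arbitrary: I rule: less_induct)
  case (less I)
  have fin: "finite I" using less.prems(1) by (rule finite_subset) simp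
  show ?case
  proof (cases "3 \<le> card I")
    case True
    then obtain T where T: "T \<subseteq> I" "card T = 3" by (rule obtain_subset_with_card_n)
    then obtain e f g where efg: "T = {e, f, g}" "distinct [e, f, g]" by (auto simp: card_3_iff)
    define K where "K = I - {e, f, g}"
    have I: "I = insert e (insert f (insert g K))" "{e, f, g} \<inter> K = {}" using T efg by (auto simp: K_def)
    have "card I = card K + 3"
      using fin T efg True unfolding K_def by (subst card_Diff_subset) auto
    then have few: "card K + 3 < 2 * card W" using less.prems(2) by simp
    have fK: "finite K" using fin by (simp add: K_def)
    let ?p = "int (card (parallel_configs K e f g :: ('e, 'v, 'k) config set))"
    have "[count I (all_open :: 'e \<Rightarrow> ('k \<times> 'k) set) = - (int CARD('k) ^ 2 * ?p)] (mod int CARD('k) ^ 3)"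
      unfolding I(1)
    proof (rule count_cong_parallel_configs_step)
      fix J assume J: "J \<subset> insert e (insert f (insert g K))"
      then have "card J < card I" using fin unfolding I(1)[symmetric] by (rule psubset_card_mono[rotated])
      moreover have "J \<subseteq> E" using J less.prems(1) unfolding I(1)[symmetric] by blast
      moreover have "card J < 2 * card W" using \<open>card J < card I\<close> less.prems(2) by (rule less_trans)
      ultimately show "[count J (all_open :: 'e \<Rightarrow> ('k \<times> 'k) set) = 0] (mod int CARD('k) ^ 3)"
        by (rule less.hyps)
    next
      show "card K + 3 \<le> 2 * card W" using few by (rule less_imp_le)
    qed (use I less.prems(1) efg assms(2) in simp_all)
    moreover have "int CARD('k) ^ 3 dvd - (int CARD('k) ^ 2 * ?p)"
    proof -
      have "CARD('k) dvd card (parallel_configs K e f g :: ('e, 'v, 'k) config set)"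
        by (rule card_dvd_parallel_configs[OF fK few])
      then have "int CARD('k) dvd ?p" by (simp only: int_dvd_int_iff)
      then have "int CARD('k) ^ 2 * int CARD('k) dvd int CARD('k) ^ 2 * ?p" by (rule mult_dvd_mono[OF dvd_refl])
      then show ?thesis by (simp add: power3_eq_cube power2_eq_square)
    qed
    ultimately show ?thesis
      by (meson cong_0_iff cong_dvd_iff cong_trans cong_sym)
  next
    case False
    have "\<not> trivial (mixed I \<alpha> all_open)" for \<alpha> :: "'e \<Rightarrow> 'k"
    proof -
      obtain \<xi> :: "'v \<Rightarrow> 'k" where \<xi>: "\<xi> \<in> supp_on W" "\<xi> \<noteq> (\<lambda>_. 0)" "\<And>i. i \<in> I \<Longrightarrow> volt \<xi> i = 0"
      proof (rule exists_nonzero_solution[of W I "volt"])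
        show "card I < card W" by (rule le_less_trans[OF _ assms(2)]) (use False in simp)
      next
        fix \<xi> :: "'v \<Rightarrow> 'k"
        assume "\<xi> \<in> supp_on W" "\<xi> \<noteq> (\<lambda>_. 0)" "\<And>i. i \<in> I \<Longrightarrow> volt \<xi> i = 0"
        then show thesis by (rule that)
      qed (use fin in \<open>simp_all add: grad_diff\<close>)
      have "(\<lambda>_. 0, \<xi>) \<in> sol (mixed I \<alpha> all_open)"
        using \<xi>(1,3) by (simp add: sol_def mixed_def resistor_def opened_def)
      then show ?thesis using \<xi>(2) by (auto simp: trivial_def)
    qed
    then show ?thesis by (simp add: count_def)
  qed
qed

theorem count_cong_parallel_configs:
  assumes K: "insert e (insert f (insert g K)) \<subseteq> E" "{e, f, g} \<inter> K = {}" "distinct [e, f, g]"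
    and W: "2 < card W" and few: "card K + 3 \<le> 2 * card W"
  shows "[count (insert e (insert f (insert g K))) (all_open :: 'e \<Rightarrow> ('k::{field,finite} \<times> 'k) set)
    = - (int CARD('k) ^ 2 * int (card (parallel_configs K e f g :: ('e, 'v, 'k) config set)))]
    (mod int CARD('k) ^ 3)"
proof (rule count_cong_parallel_configs_step[OF K W few])
  fix J assume J: "J \<subset> insert e (insert f (insert g K))"
  have fin: "finite (insert e (insert f (insert g K)))" using K(1) by (rule finite_subset) simp
  have "card (insert e (insert f (insert g K))) = card K + 3" using K(2,3) fin by auto
  with psubset_card_mono[OF fin J] few have "card J < 2 * card W" by (metis less_le_trans)
  then show "[count J (all_open :: 'e \<Rightarrow> ('k \<times> 'k) set) = 0] (mod int CARD('k) ^ 3)"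
    using J K(1) W by (intro count_cong_0) auto
qed

end

section \<open>Configurations with sources at three vertices\<close>

text \<open>If the vectors \<open>(b1, b2)\<close> and \<open>(g1, g2)\<close> are nonzero, the left-hand side counts the points
  \<open>(s, d)\<close> of a horizontal line outside the two lines that they span. Each of these removes one point, unless it is horizontal, and
  a point is removed twice if the two lines meet in it: at the origin, if \<open>d = 0\<close>, or because the
  lines coincide. The set of slopes \<open>c\<close> on the right-hand side has one element if the lines coincide
  and are not horizontal.\<close>

lemma two_lines_count_cong:
  fixes b1 b2 g1 g2 d :: "'k::{field,finite}"
  shows "[int (card {s. b1 * d \<noteq> b2 * s \<and> g1 * d \<noteq> g2 * s})
    = of_bool (d = 0 \<and> b1 * g2 \<noteq> b2 * g1) + int (card {c. b1 = c * b2 \<and> g1 = c * g2}) - 2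
      + of_bool (b2 = 0) + of_bool (g2 = 0)] (mod int CARD('k))"
proof -
  have q: "2 \<le> CARD('k)" by (rule card_field_ge_2)
  have slope: "a * d \<noteq> b * s \<longleftrightarrow> s \<noteq> a * d / b" if "b \<noteq> 0" for a b s :: 'k
    using that by (auto simp: field_simps)
  have one: "int (card {s. s \<noteq> u}) = int CARD('k) - 1" for u :: 'k
  proof -
    have "{s. s \<noteq> u} = UNIV - {u}" by auto
    then show ?thesis using q by (simp add: card_Diff_singleton)
  qed
  have two: "int (card {s. s \<noteq> u \<and> s \<noteq> u'}) = int CARD('k) - 2" if "u \<noteq> u'" for u u' :: 'k
  proof -
    have "{s. s \<noteq> u \<and> s \<noteq> u'} = UNIV - {u, u'}" by auto
    then show ?thesis using q that by (simp add: card_Diff_subset)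
  qed
  show ?thesis
  proof (cases "b2 = 0")
    case b: True
    show ?thesis
    proof (cases "g2 = 0")
      case True
      then show ?thesis using b by (auto simp: cong_def)
    next
      case g: False
      have "{c. b1 = 0 \<and> g1 = c * g2} = (if b1 = 0 then {g1 / g2} else {})"
        using g by (auto simp: field_simps)
      then show ?thesis using b g by (cases "b1 = 0"; cases "d = 0") (auto simp: slope one cong_iff_dvd_diff)
    qed
  next
    case b: False
    show ?thesis
    proof (cases "g2 = 0")
      case g: True
      have "{c. b1 = c * b2 \<and> g1 = 0} = (if g1 = 0 then {b1 / b2} else {})"
        using b by (auto simp: field_simps)
      then show ?thesis using b g by (cases "g1 = 0"; cases "d = 0") (auto simp: slope one cong_iff_dvd_diff)
    next
      case g: False
      have "{c. b1 = c * b2 \<and> g1 = c * g2} = (if b1 * g2 = b2 * g1 then {b1 / b2} else {})"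
        using b g by (auto simp: field_simps)
      then have slopes: "int (card {c. b1 = c * b2 \<and> g1 = c * g2}) = of_bool (b1 * g2 = b2 * g1)" by simp
      have meet: "b1 * d / b2 = g1 * d / g2 \<longleftrightarrow> d = 0 \<or> b1 * g2 = b2 * g1"
        using b g by (auto simp: field_simps)
      show ?thesis
      proof (cases "d = 0 \<or> b1 * g2 = b2 * g1")
        case True
        then show ?thesis using b g meet by (auto simp: slope one slopes cong_iff_dvd_diff)
      next
        case False
        then show ?thesis using b g meet by (auto simp: slope two slopes cong_iff_dvd_diff)
      qed
    qed
  qed
qed

text \<open>Two affine conditions on \<open>(a, b)\<close>: there is exactly one solution if the linear parts are
  independent, and otherwise the solutions are stable under translation along a common kernel vector.\<close>

lemma card_two_linear_conditions_cong:
  fixes p r j p' r' k :: "'k::{field,finite}"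
  shows "[int (card {(a, b). a * p = b * r \<and> (a + j) * p' = (b + k) * r'}) = of_bool (p * r' \<noteq> r * p')]
    (mod int CARD('k))"
proof (cases "p * r' = r * p'")
  case False
  define D where "D = r * p' - p * r'"
  have D: "D \<noteq> 0" using False by (simp add: D_def)
  define m where "m = k * r' - j * p'"
  have "a * p = b * r \<and> (a + j) * p' = (b + k) * r' \<longleftrightarrow> (a, b) = (m * r / D, m * p / D)" for a b
  proof
    assume eq: "a * p = b * r \<and> (a + j) * p' = (b + k) * r'"
    have "a * D = m * r" "b * D = m * p" using eq unfolding D_def m_def by algebra+
    then show "(a, b) = (m * r / D, m * p / D)" using D by (simp add: field_simps)
  next
    assume "(a, b) = (m * r / D, m * p / D)"
    then have ab: "a * D = m * r" "b * D = m * p" using D by (simp_all add: field_simps)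
    have "D * (a * p - b * r) = 0" "D * ((a + j) * p' - (b + k) * r') = 0"
      using ab unfolding D_def m_def by algebra+
    then show "a * p = b * r \<and> (a + j) * p' = (b + k) * r'" using D by simp
  qed
  then have "{(a, b). a * p = b * r \<and> (a + j) * p' = (b + k) * r'} = {(m * r / D, m * p / D)}" by auto
  then show ?thesis using False by simp
next
  case True
  obtain u v where uv: "(u, v) \<noteq> (0, 0)" "u * p = v * r" "u * p' = v * r'"
  proof (cases "p = 0 \<and> r = 0")
    case z: True
    show ?thesis
    proof (cases "p' = 0 \<and> r' = 0")
      case True
      then show ?thesis using z by (intro that[of 1 0]) auto
    next
      case False
      then show ?thesis using z by (intro that[of r' p']) (auto simp: mult.commute)
    qed
  next
    case False
    then show ?thesis using True by (intro that[of r p]) (auto simp: mult.commute)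
  qed
  have "CARD('k) dvd card {(a, b). a * p = b * r \<and> (a + j) * p' = (b + k) * r'}"
  proof (rule card_dvd_card_of_free_action[where act = "\<lambda>c (a, b). (a + c * u, b + c * v)"])
    fix c s assume "s \<in> {(a, b). a * p = b * r \<and> (a + j) * p' = (b + k) * r'}"
    then obtain a b where s: "s = (a, b)" "a * p = b * r" "(a + j) * p' = (b + k) * r'" by auto
    have "(a + c * u) * p = a * p + c * (u * p)" "(b + c * v) * r = b * r + c * (v * r)"
      "(a + c * u + j) * p' = (a + j) * p' + c * (u * p')" "(b + c * v + k) * r' = (b + k) * r' + c * (v * r')"
      by (simp_all add: algebra_simps)
    then show "(case s of (a, b) \<Rightarrow> (a + c * u, b + c * v)) \<in> {(a, b). a * p = b * r \<and> (a + j) * p' = (b + k) * r'}"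
      using s uv(2,3) by simp
  next
    fix c s assume "(case s of (a, b) \<Rightarrow> (a + c * u, b + c * v)) = s"
    then show "c = 0" using uv(1) by (auto split: prod.splits)
  qed (auto simp: algebra_simps split: prod.splits)
  then show ?thesis using True by (simp add: cong_0_iff)
qed

context network
begin

text \<open>The graph is what remains when the gadget of the reduction is removed; the currents may
  leave it at \<open>B\<close> and \<open>C\<close>, and \<open>y\<close> also at \<open>D\<close>. They satisfy Kirchhoff's law at the root, which is the
  vertex \<open>A\<close> of the reduction: the only edge of the gadget at \<open>A\<close> is dead.\<close>

definition open_configs :: "'v \<Rightarrow> 'v \<Rightarrow> 'v \<Rightarrow>
    ('e, 'v, 'k::field) config set" where
  "open_configs B C D = {(x, y, \<xi>, \<eta>).
     x \<in> supp_on E \<and> y \<in> supp_on E \<and>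
     (\<forall>v\<in>V - {B, C}. net x v = 0) \<and> (\<forall>v\<in>V - {B, C, D}. net y v = 0) \<and>
     \<xi> \<in> supp_on W \<and> \<eta> \<in> supp_on W \<and>
     (\<forall>i\<in>E. x i * volt \<eta> i = y i * volt \<xi> i)}"

lemma finite_open_configs [simp]:
  "finite (open_configs B C D :: ('e, 'v, 'k::{field,finite}) config set)"
  by (rule finite_subset[of _ "supp_on E \<times> supp_on E \<times> supp_on W \<times> supp_on W"])
     (auto simp: open_configs_def)

lemma card_dvd_open_configs:
  fixes M N :: "('v \<Rightarrow> 'k::{field,finite}) \<Rightarrow> ('v \<Rightarrow> 'k) \<Rightarrow> 'k"
  assumes few: "card E + 2 < 2 * card W"
    and M: "\<And>\<xi> \<xi>' \<eta> \<eta>' k. M (\<lambda>v. \<xi> v + k * \<xi>' v) (\<lambda>v. \<eta> v + k * \<eta>' v) = M \<xi> \<eta> + k * M \<xi>' \<eta>'"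
    and N: "\<And>\<xi> \<xi>' \<eta> \<eta>' k. N (\<lambda>v. \<xi> v + k * \<xi>' v) (\<lambda>v. \<eta> v + k * \<eta>' v) = N \<xi> \<eta> + k * N \<xi>' \<eta>'"
  shows "CARD('k) dvd card {(x, y, \<xi>, \<eta>) \<in> open_configs B C D. M \<xi> \<eta> = 0 \<and> N \<xi> \<eta> = 0}"
proof -
  define I where "I = Inl ` E \<union> {Inr True, Inr False}"
  define L :: "('e \<Rightarrow> 'k) \<Rightarrow> ('e \<Rightarrow> 'k) \<Rightarrow> ('v \<Rightarrow> 'k) \<Rightarrow> ('v \<Rightarrow> 'k) \<Rightarrow> 'e + bool \<Rightarrow> 'k" where
    "L = (\<lambda>x y \<xi> \<eta> c. case c of Inl i \<Rightarrow> x i * volt \<eta> i - y i * volt \<xi> i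
        | Inr b \<Rightarrow> if b then M \<xi> \<eta> else N \<xi> \<eta>)"
  define X :: "(('e \<Rightarrow> 'k) \<times> ('e \<Rightarrow> 'k)) set" where "X = {(x, y). x \<in> supp_on E \<and> y \<in> supp_on E \<and>
     (\<forall>v\<in>V - {B, C}. net x v = 0) \<and> (\<forall>v\<in>V - {B, C, D}. net y v = 0)}"
  have finX: "finite X"
    by (rule finite_subset[of _ "supp_on E \<times> supp_on E"]) (auto simp: X_def)
  have "card I \<le> card E + 2"
    unfolding I_def by (rule order_trans[OF card_Un_le]) (simp add: card_image)
  then have "card I < 2 * card W" using few by (rule le_less_trans)
  moreover have "L x y (\<lambda>v. \<xi> v + k * \<xi>' v) (\<lambda>v. \<eta> v + k * \<eta>' v) c = L x y \<xi> \<eta> c + k * L x y \<xi>' \<eta>' c"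
    for x y \<xi> \<xi>' \<eta> \<eta>' k c
    by (simp add: L_def grad_add_mult M N algebra_simps split: sum.split)
  moreover have "finite I" by (simp add: I_def)
  ultimately have "CARD('k) dvd card {(x, y, \<xi>, \<eta>). (x, y) \<in> X \<and> \<xi> \<in> supp_on W \<and> \<eta> \<in> supp_on W \<and>
      (\<forall>c\<in>I. L x y \<xi> \<eta> c = 0)}"
    by (intro card_dvd_solution_families finX) simp_all
  also have "{(x, y, \<xi>, \<eta>). (x, y) \<in> X \<and> \<xi> \<in> supp_on W \<and> \<eta> \<in> supp_on W \<and> (\<forall>c\<in>I. L x y \<xi> \<eta> c = 0)}
      = {(x, y, \<xi>, \<eta>) \<in> open_configs B C D. M \<xi> \<eta> = 0 \<and> N \<xi> \<eta> = 0}"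
    by (auto simp: open_configs_def X_def I_def L_def)
  finally show ?thesis .
qed

text \<open>By \<open>two_lines_count_cong\<close> the summands differ by indicators of the conditions
  \<open>\<xi> B = c \<eta> B\<close>, \<open>\<xi> C = c \<eta> C\<close> for a fixed \<open>c\<close>, of \<open>\<eta> B = 0\<close>, of \<open>\<eta> C = 0\<close>, and by a constant. None of them
  uses more than two linear conditions, so that \<open>card_dvd_open_configs\<close> applies to each.\<close>

theorem open_configs_cong:
  assumes few: "card E + 2 < 2 * card W"
  shows "[(\<Sum>(x, y, \<xi>, \<eta>)\<in>open_configs B C D.
        int (card {s :: 'k::{field,finite}. \<xi> B * \<eta> D \<noteq> \<eta> B * s \<and> \<xi> C * \<eta> D \<noteq> \<eta> C * s}))
      = (\<Sum>(x, y, \<xi>, \<eta>)\<in>open_configs B C D. of_bool (\<eta> D = (0 :: 'k) \<and> \<xi> B * \<eta> C \<noteq> \<eta> B * \<xi> C))]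
    (mod int CARD('k))"
proof -
  let ?O = "open_configs B C D :: ('e, 'v, 'k) config set" and ?q = "int CARD('k)"
  have dvd: "[(\<Sum>(x, y, \<xi>, \<eta>)\<in>?O. of_bool (M \<xi> \<eta> = 0 \<and> N \<xi> \<eta> = 0)) = 0] (mod ?q)"
    if "\<And>\<xi> \<xi>' \<eta> \<eta>' k. M (\<lambda>v. \<xi> v + k * \<xi>' v) (\<lambda>v. \<eta> v + k * \<eta>' v) = M \<xi> \<eta> + k * M \<xi>' \<eta>'"
      "\<And>\<xi> \<xi>' \<eta> \<eta>' k. N (\<lambda>v. \<xi> v + k * \<xi>' v) (\<lambda>v. \<eta> v + k * \<eta>' v) = N \<xi> \<eta> + k * N \<xi>' \<eta>'"
    for M N :: "('v \<Rightarrow> 'k) \<Rightarrow> ('v \<Rightarrow> 'k) \<Rightarrow> 'k"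
  proof -
    have "(\<Sum>(x, y, \<xi>, \<eta>)\<in>?O. of_bool (M \<xi> \<eta> = 0 \<and> N \<xi> \<eta> = 0))
        = (\<Sum>p\<in>?O. of_bool (p \<in> {(x, y, \<xi>, \<eta>) \<in> ?O. M \<xi> \<eta> = 0 \<and> N \<xi> \<eta> = 0}) :: int)"
      by (rule sum.cong) auto
    also have "\<dots> = int (card {(x, y, \<xi>, \<eta>) \<in> ?O. M \<xi> \<eta> = 0 \<and> N \<xi> \<eta> = 0})"
      by (simp add: Int_def case_prod_unfold cong: conj_cong)
    finally have eq: "(\<Sum>(x, y, \<xi>, \<eta>)\<in>?O. of_bool (M \<xi> \<eta> = 0 \<and> N \<xi> \<eta> = 0))
        = int (card {(x, y, \<xi>, \<eta>) \<in> ?O. M \<xi> \<eta> = 0 \<and> N \<xi> \<eta> = 0})" .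
    have "CARD('k) dvd card {(x, y, \<xi>, \<eta>) \<in> ?O. M \<xi> \<eta> = 0 \<and> N \<xi> \<eta> = 0}"
      by (rule card_dvd_open_configs[OF few]) (rule that)+
    then show ?thesis unfolding eq by (rule cong_of_dvd_card)
  qed
  (* The count of slopes is exchanged with the sum over configurations: for each slope there are
     two linear conditions. *)
  have slopes: "(\<Sum>(x, y, \<xi>, \<eta>)\<in>?O. int (card {c. \<xi> B = c * \<eta> B \<and> \<xi> C = c * \<eta> C}))
      = (\<Sum>c\<in>UNIV. (\<Sum>(x, y, \<xi>, \<eta>)\<in>?O. of_bool (\<xi> B - c * \<eta> B = 0 \<and> \<xi> C - c * \<eta> C = 0)))"
  proof -
    have "int (card {c. a = c * b \<and> a' = c * b'}) = (\<Sum>c\<in>UNIV. of_bool (a - c * b = 0 \<and> a' - c * b' = 0))"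
      for a b a' b' :: 'k by simp
    then show ?thesis by (subst sum.swap) (simp only: case_prod_unfold)
  qed
  have "[(\<Sum>(x, y, \<xi>, \<eta>)\<in>?O. int (card {s. \<xi> B * \<eta> D \<noteq> \<eta> B * s \<and> \<xi> C * \<eta> D \<noteq> \<eta> C * s}))
      = (\<Sum>(x, y, \<xi>, \<eta>)\<in>?O. of_bool (\<eta> D = 0 \<and> \<xi> B * \<eta> C \<noteq> \<eta> B * \<xi> C)
        + int (card {c. \<xi> B = c * \<eta> B \<and> \<xi> C = c * \<eta> C}) - 2 + of_bool (\<eta> B = 0) + of_bool (\<eta> C = 0))] (mod ?q)"
  proof (rule cong_sum)
    fix p :: "('e, 'v, 'k) config"
    obtain x y \<xi> \<eta> where p: "p = (x, y, \<xi>, \<eta>)" by (cases p) auto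
    show "[case p of (x, y, \<xi>, \<eta>) \<Rightarrow> int (card {s. \<xi> B * \<eta> D \<noteq> \<eta> B * s \<and> \<xi> C * \<eta> D \<noteq> \<eta> C * s})
      = case p of (x, y, \<xi>, \<eta>) \<Rightarrow> of_bool (\<eta> D = 0 \<and> \<xi> B * \<eta> C \<noteq> \<eta> B * \<xi> C)
        + int (card {c. \<xi> B = c * \<eta> B \<and> \<xi> C = c * \<eta> C}) - 2 + of_bool (\<eta> B = 0) + of_bool (\<eta> C = 0)] (mod ?q)"
      unfolding p prod.case by (rule two_lines_count_cong)
  qed
  also have "(\<Sum>(x, y, \<xi>, \<eta>)\<in>?O. of_bool (\<eta> D = 0 \<and> \<xi> B * \<eta> C \<noteq> \<eta> B * \<xi> C)
        + int (card {c. \<xi> B = c * \<eta> B \<and> \<xi> C = c * \<eta> C}) - 2 + of_bool (\<eta> B = 0) + of_bool (\<eta> C = 0))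
      = (\<Sum>(x, y, \<xi>, \<eta>)\<in>?O. of_bool (\<eta> D = 0 \<and> \<xi> B * \<eta> C \<noteq> \<eta> B * \<xi> C))
        + (\<Sum>c\<in>UNIV. (\<Sum>(x, y, \<xi>, \<eta>)\<in>?O. of_bool (\<xi> B - c * \<eta> B = 0 \<and> \<xi> C - c * \<eta> C = 0)))
        - 2 * (\<Sum>(x, y, \<xi>, \<eta>)\<in>?O. of_bool (0 = (0 :: 'k) \<and> 0 = (0 :: 'k)))
        + (\<Sum>(x, y, \<xi>, \<eta>)\<in>?O. of_bool (\<eta> B = 0 \<and> 0 = (0 :: 'k)))
        + (\<Sum>(x, y, \<xi>, \<eta>)\<in>?O. of_bool (\<eta> C = 0 \<and> 0 = (0 :: 'k)))"
    unfolding slopes[symmetric] by (simp add: case_prod_unfold sum.distrib sum_subtractf)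
  also have "[\<dots> = (\<Sum>(x, y, \<xi>, \<eta>)\<in>?O. of_bool (\<eta> D = 0 \<and> \<xi> B * \<eta> C \<noteq> \<eta> B * \<xi> C))
      + (\<Sum>c\<in>(UNIV :: 'k set). 0) - 2 * 0 + 0 + 0] (mod ?q)"
    by (intro cong_add cong_diff cong_mult cong_refl cong_sum dvd) (simp_all add: algebra_simps)
  finally show ?thesis by simp
qed

end

section \<open>The two gadgets of the double triangle reduction\<close>

definition restrict0 :: "'a set \<Rightarrow> ('a \<Rightarrow> 'b::zero) \<Rightarrow> 'a \<Rightarrow> 'b" where
  "restrict0 A f = (\<lambda>a. if a \<in> A then f a else 0)"

lemma inflow_cong: "(\<And>e. e \<in> E \<Longrightarrow> x e = y e) \<Longrightarrow> inflow E t h x v = inflow E t h y v"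
  by (simp add: inflow_def cong: sum.cong)

lemma inflow_restrict0 [simp]: "inflow E t h (restrict0 E x) v = inflow E t h x v"
  by (rule inflow_cong) (simp add: restrict0_def)

lemma inflow_upd_outside [simp]: "e \<notin> E \<Longrightarrow> inflow E t h (x(e := c)) v = inflow E t h x v"
  by (rule inflow_cong) auto

lemma inflow_insert:
  assumes "finite E" "e \<notin> E"
  shows "inflow (insert e E) t h x v = x e * (of_bool (h e = v) - of_bool (t e = v)) + inflow E t h x v"
  using assms by (simp add: inflow_def)

lemma inflow_cong_ends:
  assumes "\<And>e. e \<in> E \<Longrightarrow> t' e = t e" "\<And>e. e \<in> E \<Longrightarrow> h' e = h e"
  shows "inflow E t' h' x v = inflow E t h x v"
  using assms by (simp add: inflow_def cong: sum.cong)

context network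
begin

lemma inflow_outside:
  assumes "v \<notin> V"
  shows "net x v = 0"
  unfolding inflow_def using assms head_in tail_in by (intro sum.neutral) auto

lemma sum_inflow_terminals:
  assumes "{B, C, D} \<subseteq> V" "distinct [B, C, D]" "\<And>v. v \<in> V - {B, C, D} \<Longrightarrow> net x v = 0"
  shows "net x B + net x C + net x D = (0 :: 'k::comm_ring_1)"
proof -
  have "0 = (\<Sum>v\<in>V. net x v)" by (rule sum_inflow[symmetric])
  also have "\<dots> = (\<Sum>v\<in>{B, C, D}. net x v)"
    by (rule sum.mono_neutral_right) (use assms in auto)
  also have "\<dots> = net x B + net x C + net x D"
    using assms(2) by (simp add: add.assoc)
  finally show ?thesis ..
qed

text \<open>The gadget is given by the vertices \<open>P\<close>, \<open>Q\<close> and the edges \<open>e1 = AP\<close>, \<open>e2 = PQ\<close>, \<open>e3 = QD\<close>,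
  \<open>e4 = PB\<close>, \<open>e5 = BQ\<close>, \<open>e6 = PC\<close>, \<open>e7 = CQ\<close>, where \<open>A\<close> is the root. The dead edge \<open>e1\<close> puts \<open>P\<close> at the
  origin, and \<open>e3\<close> puts \<open>Q\<close> at \<open>(s, \<eta> D)\<close> with \<open>s\<close> free. Kirchhoff's law determines all currents from those
  of \<open>e4\<close> and \<open>e6\<close>. At \<open>B\<close> the two edges to \<open>P\<close> and \<open>Q\<close> give two linear conditions on the current of \<open>e4\<close>,
  which modulo \<open>q\<close> have one solution or none according as \<open>P\<close>, \<open>Q\<close>, \<open>B\<close> are not or are collinear; likewise
  at \<open>C\<close> with \<open>e6\<close>. The free edge \<open>e2\<close> imposes nothing.\<close>

lemma double_triangle_fibres:
  fixes B C D P Q :: 'v and e1 e2 e3 e4 e5 e6 e7 :: 'e and t' h' :: "'e \<Rightarrow> 'v"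
  defines "V' \<equiv> insert P (insert Q V)"
    and "E' \<equiv> insert e1 (insert e2 (insert e3 (insert e4 (insert e5 (insert e6 (insert e7 E))))))"
    and "J \<equiv> insert e4 (insert e5 (insert e6 (insert e7 E)))"
  assumes V: "{B, C, D} \<subseteq> V" "P \<notin> V" "Q \<notin> V" "distinct [r, B, C, D, P, Q]"
    and new: "{e1, e2, e3, e4, e5, e6, e7} \<inter> E = {}" "distinct [e1, e2, e3, e4, e5, e6, e7]"
    and old: "\<And>e. e \<in> E \<Longrightarrow> t' e = t e" "\<And>e. e \<in> E \<Longrightarrow> h' e = h e"
    and t': "t' e1 = r" "t' e2 = P" "t' e3 = Q" "t' e4 = P" "t' e5 = B" "t' e6 = P" "t' e7 = C"
    and h': "h' e1 = P" "h' e2 = Q" "h' e3 = D" "h' e4 = B" "h' e5 = Q" "h' e6 = C" "h' e7 = Q"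
  shows "[int (card (network.parallel_configs V' E' t' h' r J e1 e2 e3 :: ('e, 'v, 'k::{field,finite}) config set))
    = (\<Sum>(x, y, \<xi>, \<eta>)\<in>open_configs B C D.
        int (card {s :: 'k. \<xi> B * \<eta> D \<noteq> \<eta> B * s \<and> \<xi> C * \<eta> D \<noteq> \<eta> C * s}))] (mod int CARD('k))"
proof -
  interpret G: network V' E' t' h' r
    by unfold_locales
       (use root tail_in head_in old t' h' V in \<open>auto simp: V'_def E'_def\<close>)
  let ?I = "inflow E t h :: ('e \<Rightarrow> 'k) \<Rightarrow> 'v \<Rightarrow> 'k"
  let ?good = "\<lambda>x. (\<forall>v\<in>V - {B, C, D}. ?I x v = 0) \<and> x e2 = - (x e4 + x e6) \<and> x e3 = - ?I x D \<and>
      x e5 = x e4 + ?I x B \<and> x e7 = x e6 + ?I x C"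
  have inflow_G: "inflow E' t' h' x v = ?I x v
      + x e1 * (of_bool (P = v) - of_bool (r = v)) + x e2 * (of_bool (Q = v) - of_bool (P = v))
      + x e3 * (of_bool (D = v) - of_bool (Q = v)) + x e4 * (of_bool (B = v) - of_bool (P = v))
      + x e5 * (of_bool (Q = v) - of_bool (B = v)) + x e6 * (of_bool (C = v) - of_bool (P = v))
      + x e7 * (of_bool (Q = v) - of_bool (C = v))" for x :: "'e \<Rightarrow> 'k" and v
  proof -
    have "inflow E t' h' x v = ?I x v" by (rule inflow_cong_ends) (use old in auto)
    then show ?thesis
      unfolding E'_def using new by (simp add: inflow_insert t' h' add_ac)
  qed
  have flow: "(\<forall>v\<in>G.W. inflow E' t' h' x v = 0) \<longleftrightarrow> ?good x" if x1: "x e1 = 0" for x :: "'e \<Rightarrow> 'k"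
  proof
    assume all: "\<forall>v\<in>G.W. inflow E' t' h' x v = 0"
    then have all': "inflow E' t' h' x v = 0" if "v \<in> V'" for v
      using G.inflow_root[of x] that by (cases "v = r") auto
    have "?I x v = 0" if "v \<in> V - {B, C, D}" for v
    proof -
      have "P \<noteq> v" "Q \<noteq> v" "v \<in> V'" using that V by (auto simp: V'_def)
      then show ?thesis using all'[of v] that x1 unfolding inflow_G by auto
    qed
    moreover have bal: "?I x B + x e4 - x e5 = 0" "?I x C + x e6 - x e7 = 0" "?I x D + x e3 = 0"
        "?I x P - x e2 - x e4 - x e6 = 0"
      using all'[of B] all'[of C] all'[of D] all'[of P] V x1 unfolding inflow_G V'_def by auto
    moreover have "?I x P = 0" using V by (intro inflow_outside)
    then have "x e2 = - (x e4 + x e6)" "x e3 = - ?I x D" "x e5 = x e4 + ?I x B" "x e7 = x e6 + ?I x C"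
      using bal by algebra+
    ultimately show "?good x" by blast
  next
    assume good: "?good x"
    have "?I x B + ?I x C + ?I x D = 0"
      by (rule sum_inflow_terminals) (use good V in auto)
    moreover have "?I x P = 0" "?I x Q = 0" using V by (auto intro: inflow_outside)
    ultimately have bal: "?I x B + x e4 - x e5 = 0" "?I x C + x e6 - x e7 = 0" "?I x D + x e3 = 0"
        "?I x P - x e2 - x e4 - x e6 = 0" "?I x Q + x e2 - x e3 + x e5 + x e7 = 0"
      using good by algebra+
    have "?I x v = 0" if "v \<in> V - {B, C, D}" for v using good that by blast
    then show "\<forall>v\<in>G.W. inflow E' t' h' x v = 0"
      unfolding inflow_G V'_def using bal V x1 by auto
  qed
  have mem: "(x, y, \<xi>, \<eta>) \<in> G.parallel_configs J e1 e2 e3 \<longleftrightarrow>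
      x \<in> supp_on (insert e2 J) \<and> y \<in> supp_on (insert e2 (insert e3 J)) \<and> ?good x \<and> ?good y \<and>
      \<xi> \<in> supp_on (insert Q W) \<and> \<eta> \<in> supp_on (insert Q W) \<and> \<eta> Q = \<eta> D \<and>
      (\<forall>i\<in>E. x i * volt \<eta> i = y i * volt \<xi> i) \<and>
      x e4 * \<eta> B = y e4 * \<xi> B \<and> x e5 * (\<eta> D - \<eta> B) = y e5 * (\<xi> Q - \<xi> B) \<and>
      x e6 * \<eta> C = y e6 * \<xi> C \<and> x e7 * (\<eta> D - \<eta> C) = y e7 * (\<xi> Q - \<xi> C)"
    for x y :: "'e \<Rightarrow> 'k" and \<xi> \<eta> :: "'v \<Rightarrow> 'k"
  proof (cases "x \<in> supp_on (insert e2 J) \<and> y \<in> supp_on (insert e2 (insert e3 J))")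
    case True
    have "x e1 = 0" "y e1 = 0" using True new by (auto simp: supp_on_def J_def)
    note fl = flow[of x, OF this(1)] flow[of y, OF this(2)]
    have supp: "\<zeta> \<in> supp_on (insert Q W) \<longleftrightarrow> \<zeta> \<in> supp_on G.W \<and> \<zeta> P = 0" for \<zeta> :: "'v \<Rightarrow> 'k"
      using V by (auto simp: supp_on_def V'_def)
    have r0: "\<zeta> r = 0" if "\<zeta> \<in> supp_on G.W" for \<zeta> :: "'v \<Rightarrow> 'k"
      using that by (simp add: supp_on_def)
    have gr: "grad t' h' \<zeta> i = volt \<zeta> i" if "i \<in> E" for \<zeta> :: "'v \<Rightarrow> 'k" and i
      using old that by (simp add: grad_def)
    have par: "(\<forall>i\<in>J. x i * grad t' h' \<eta> i = y i * grad t' h' \<xi> i) \<longleftrightarrow>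
        (\<forall>i\<in>E. x i * volt \<eta> i = y i * volt \<xi> i) \<and>
        x e4 * (\<eta> B - \<eta> P) = y e4 * (\<xi> B - \<xi> P) \<and> x e5 * (\<eta> Q - \<eta> B) = y e5 * (\<xi> Q - \<xi> B) \<and>
        x e6 * (\<eta> C - \<eta> P) = y e6 * (\<xi> C - \<xi> P) \<and> x e7 * (\<eta> Q - \<eta> C) = y e7 * (\<xi> Q - \<xi> C)"
      unfolding J_def by (auto simp: gr) (auto simp: grad_def t' h')
    have dead: "grad t' h' \<zeta> e1 = \<zeta> P - \<zeta> r" "grad t' h' \<zeta> e3 = \<zeta> D - \<zeta> Q" for \<zeta> :: "'v \<Rightarrow> 'k"
      by (simp_all add: grad_def t' h')
    show ?thesis
      unfolding G.parallel_configs_def G.configs_def mem_Collect_eq prod.case par dead fl supp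
      using True r0[of \<xi>] r0[of \<eta>] by auto
  next
    case False
    then show ?thesis by (auto simp: G.parallel_configs_def G.configs_def)
  qed
  define F :: "('e, 'v, 'k) config \<Rightarrow> 'k \<Rightarrow> 'v \<Rightarrow> ('k \<times> 'k) set" where
    "F = (\<lambda>(x, y, \<xi>, \<eta>) s v. {(a, b). a * \<eta> v = b * \<xi> v \<and> (a + ?I x v) * (\<eta> D - \<eta> v) = (b + ?I y v) * (s - \<xi> v)})"
  let ?O = "open_configs B C D :: ('e, 'v, 'k) config set"
  let ?T = "SIGMA p:?O. SIGMA s:UNIV. F p s B \<times> F p s C"
  let ?f = "\<lambda>(x, y, \<xi>, \<eta>). ((restrict0 E x, restrict0 E y, restrict0 W \<xi>, restrict0 W \<eta>), \<xi> Q, (x e4, y e4), (x e6, y e6))"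
  let ?gx = "\<lambda>x a c. x(e2 := - (a + c), e4 := a, e5 := a + ?I x B, e6 := c, e7 := c + ?I x C)"
    and ?gy = "\<lambda>y b d. y(e2 := - (b + d), e3 := - ?I y D, e4 := b, e5 := b + ?I y B, e6 := d, e7 := d + ?I y C)"
  let ?g = "\<lambda>((x, y, \<xi>, \<eta>), s, (a, b), (c, d)).
      (?gx x a c, ?gy y b d,
       \<xi>(Q := s), \<eta>(Q := \<eta> D))"
  have W: "B \<in> W" "C \<in> W" "D \<in> W" "Q \<notin> W" using V by auto
  have gradW: "volt (restrict0 W \<zeta>) i = volt \<zeta> i" if "i \<in> E" "\<zeta> \<in> supp_on (insert Q W)" for \<zeta> :: "'v \<Rightarrow> 'k" and i
  proof -
    have "\<zeta> r = 0" using that(2) V by (auto simp: supp_on_def)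
    then have "restrict0 W \<zeta> v = \<zeta> v" if "v \<in> V" for v using that by (auto simp: restrict0_def)
    then show ?thesis using tail_in[OF that(1)] head_in[OF that(1)] by (simp add: grad_def)
  qed
  have gradQ: "volt (\<zeta>(Q := c)) i = volt \<zeta> i" if "i \<in> E" for \<zeta> :: "'v \<Rightarrow> 'k" and i c
    using tail_in[OF that] head_in[OF that] V by (auto simp: grad_def)
  have "bij_betw ?f (G.parallel_configs J e1 e2 e3) ?T"
  proof (rule bij_betwI[where g = ?g])
    show "?f \<in> G.parallel_configs J e1 e2 e3 \<rightarrow> ?T"
    proof
      fix p :: "('e, 'v, 'k) config"
      assume "p \<in> G.parallel_configs J e1 e2 e3"
      then obtain x y \<xi> \<eta> where p: "p = (x, y, \<xi>, \<eta>)" and m: "(x, y, \<xi>, \<eta>) \<in> G.parallel_configs J e1 e2 e3"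
        by (cases p) auto
      note m = m[unfolded mem]
      have x3: "x e3 = 0" using m new by (auto simp: supp_on_def J_def)
      have "(restrict0 E x, restrict0 E y, restrict0 W \<xi>, restrict0 W \<eta>) \<in> ?O"
        unfolding open_configs_def mem_Collect_eq prod.case inflow_restrict0
      proof (intro conjI ballI)
        show "?I x v = 0" if "v \<in> V - {B, C}" for v using m that x3 by (cases "v = D") auto
        show "restrict0 E x i * volt (restrict0 W \<eta>) i = restrict0 E y i * volt (restrict0 W \<xi>) i" if "i \<in> E" for i
          using m that by (simp add: gradW) (simp add: restrict0_def)
      qed (use m in \<open>auto simp: supp_on_def restrict0_def\<close>)
      moreover have "(x e4, y e4) \<in> F (restrict0 E x, restrict0 E y, restrict0 W \<xi>, restrict0 W \<eta>) (\<xi> Q) B"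
        "(x e6, y e6) \<in> F (restrict0 E x, restrict0 E y, restrict0 W \<xi>, restrict0 W \<eta>) (\<xi> Q) C"
        using m W by (auto simp: F_def restrict0_def[of W])
      ultimately show "?f p \<in> ?T" by (simp add: p)
    qed
    show "?g \<in> ?T \<rightarrow> G.parallel_configs J e1 e2 e3"
    proof
      fix z assume "z \<in> ?T"
      then obtain x y \<xi> \<eta> s a b c d where z: "z = ((x, y, \<xi>, \<eta>), s, (a, b), (c, d))"
        and o: "(x, y, \<xi>, \<eta>) \<in> ?O" and B: "(a, b) \<in> F (x, y, \<xi>, \<eta>) s B" and C: "(c, d) \<in> F (x, y, \<xi>, \<eta>) s C"
        by auto
      have D: "?I x D = 0" using o V by (auto simp: open_configs_def)
      show "?g z \<in> G.parallel_configs J e1 e2 e3"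
        unfolding z prod.case mem
      proof (intro conjI)
        show "\<forall>i\<in>E. ?gx x a c i * volt (\<eta>(Q := \<eta> D)) i
          = ?gy y b d i * volt (\<xi>(Q := s)) i"
          using o new by (auto simp: gradQ open_configs_def)
      qed (use o B C D new V in \<open>auto simp: open_configs_def F_def supp_on_def J_def\<close>)
    qed
    show "?g (?f p) = p" if "p \<in> G.parallel_configs J e1 e2 e3" for p
    proof -
      obtain x y \<xi> \<eta> where p: "p = (x, y, \<xi>, \<eta>)" by (cases p) auto
      note m = that[unfolded p mem]
      have "(restrict0 E x)(e2 := - (x e4 + x e6), e4 := x e4, e5 := x e4 + ?I x B, e6 := x e6, e7 := x e6 + ?I x C) = x"
        using m by (auto simp: fun_eq_iff restrict0_def supp_on_def J_def)
      moreover have "(restrict0 E y)(e2 := - (y e4 + y e6), e3 := - ?I y D, e4 := y e4, e5 := y e4 + ?I y B, e6 := y e6, e7 := y e6 + ?I y C) = y"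
        using m by (auto simp: fun_eq_iff restrict0_def supp_on_def J_def)
      moreover have "(restrict0 W \<xi>)(Q := \<xi> Q) = \<xi>" "(restrict0 W \<eta>)(Q := restrict0 W \<eta> D) = \<eta>"
        using m W by (auto simp: fun_eq_iff restrict0_def supp_on_def)
      ultimately show ?thesis by (simp add: p)
    qed
    show "?f (?g z) = z" if zT: "z \<in> ?T" for z
    proof -
      obtain x y \<xi> \<eta> s a b c d where z: "z = ((x, y, \<xi>, \<eta>), s, (a, b), (c, d))"
        and o: "(x, y, \<xi>, \<eta>) \<in> ?O" using zT by auto
      have "restrict0 E (?gx x a c) = x"
        "restrict0 E (?gy y b d) = y"
        "restrict0 W (\<xi>(Q := s)) = \<xi>" "restrict0 W (\<eta>(Q := \<eta> D)) = \<eta>"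
        using o new W by (auto simp: fun_eq_iff restrict0_def supp_on_def open_configs_def)
      then show ?thesis using new by (simp add: z)
    qed
  qed
  then have "int (card (G.parallel_configs J e1 e2 e3 :: ('e, 'v, 'k) config set)) = int (card ?T)"
    by (simp add: bij_betw_same_card)
  also have "\<dots> = (\<Sum>p\<in>?O. \<Sum>s\<in>UNIV. int (card (F p s B)) * int (card (F p s C)))"
    by (simp add: card_cartesian_product)
  also have "[\<dots> = (\<Sum>p\<in>?O. case p of (x, y, \<xi>, \<eta>) \<Rightarrow>
      int (card {s :: 'k. \<xi> B * \<eta> D \<noteq> \<eta> B * s \<and> \<xi> C * \<eta> D \<noteq> \<eta> C * s}))] (mod int CARD('k))"
  proof (rule cong_sum)
    fix p :: "('e, 'v, 'k) config"
    obtain x y \<xi> \<eta> where p: "p = (x, y, \<xi>, \<eta>)" by (cases p) auto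
    have F: "[int (card (F p s v)) = of_bool (\<xi> v * \<eta> D \<noteq> \<eta> v * s)] (mod int CARD('k))" for s v
    proof -
      have "\<eta> v * (s - \<xi> v) \<noteq> \<xi> v * (\<eta> D - \<eta> v) \<longleftrightarrow> \<xi> v * \<eta> D \<noteq> \<eta> v * s"
        by (auto simp: algebra_simps)
      then show ?thesis
        using card_two_linear_conditions_cong[of "\<eta> v" "\<xi> v" "?I x v" "\<eta> D - \<eta> v" "?I y v" "s - \<xi> v"]
        by (simp add: F_def p)
    qed
    have "[(\<Sum>s\<in>UNIV. int (card (F p s B)) * int (card (F p s C)))
        = (\<Sum>s\<in>UNIV. of_bool (\<xi> B * \<eta> D \<noteq> \<eta> B * s) * of_bool (\<xi> C * \<eta> D \<noteq> \<eta> C * s))] (mod int CARD('k))"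
      by (intro cong_sum cong_mult F)
    then show "[(\<Sum>s\<in>UNIV. int (card (F p s B)) * int (card (F p s C)))
        = (case p of (x, y, \<xi>, \<eta>) \<Rightarrow>
      int (card {s :: 'k. \<xi> B * \<eta> D \<noteq> \<eta> B * s \<and> \<xi> C * \<eta> D \<noteq> \<eta> C * s}))] (mod int CARD('k))"
      by (simp add: p flip: of_bool_conj)
  qed
  finally show ?thesis .
qed

text \<open>The gadget is given by the vertex \<open>R\<close> and the edges \<open>f1 = AR\<close>, \<open>f2 = RD\<close>, \<open>f3 = BR\<close>, \<open>f4 = RC\<close>,
  \<open>f5 = BC\<close>. The dead edge \<open>f1\<close> puts \<open>R\<close> at the origin, and then \<open>f2\<close> forces \<open>\<eta> D = 0\<close>. All currents are
  determined by that of \<open>f3\<close>, on which \<open>f3\<close> and \<open>f4\<close> impose two linear conditions; the triangle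
  \<open>R\<close>, \<open>B\<close>, \<open>C\<close> must be nondegenerate for exactly one solution.\<close>

lemma reduced_triangle_fibres:
  fixes B C D R :: 'v and f1 f2 f3 f4 f5 :: 'e and t' h' :: "'e \<Rightarrow> 'v"
  defines "V' \<equiv> insert R V"
    and "E' \<equiv> insert f1 (insert f2 (insert f3 (insert f4 (insert f5 E))))"
    and "J \<equiv> insert f3 (insert f4 E)"
  assumes V: "{B, C, D} \<subseteq> V" "R \<notin> V" "distinct [r, B, C, D, R]"
    and new: "{f1, f2, f3, f4, f5} \<inter> E = {}" "distinct [f1, f2, f3, f4, f5]"
    and old: "\<And>e. e \<in> E \<Longrightarrow> t' e = t e" "\<And>e. e \<in> E \<Longrightarrow> h' e = h e"
    and t': "t' f1 = r" "t' f2 = R" "t' f3 = B" "t' f4 = R" "t' f5 = B"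
    and h': "h' f1 = R" "h' f2 = D" "h' f3 = R" "h' f4 = C" "h' f5 = C"
  shows "[int (card (network.parallel_configs V' E' t' h' r J f1 f5 f2 :: ('e, 'v, 'k::{field,finite}) config set))
    = (\<Sum>(x, y, \<xi>, \<eta>)\<in>open_configs B C D. of_bool (\<eta> D = (0 :: 'k) \<and> \<xi> B * \<eta> C \<noteq> \<eta> B * \<xi> C))]
    (mod int CARD('k))"
proof -
  interpret G: network V' E' t' h' r
    by unfold_locales
       (use root tail_in head_in old t' h' V in \<open>auto simp: V'_def E'_def\<close>)
  let ?I = "inflow E t h :: ('e \<Rightarrow> 'k) \<Rightarrow> 'v \<Rightarrow> 'k"
  let ?good = "\<lambda>x. (\<forall>v\<in>V - {B, C, D}. ?I x v = 0) \<and> x f2 = - ?I x D \<and>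
      x f5 = ?I x B - x f3 \<and> x f4 = x f3 - ?I x B - ?I x C"
  have inflow_G: "inflow E' t' h' x v = ?I x v
      + x f1 * (of_bool (R = v) - of_bool (r = v)) + x f2 * (of_bool (D = v) - of_bool (R = v))
      + x f3 * (of_bool (R = v) - of_bool (B = v)) + x f4 * (of_bool (C = v) - of_bool (R = v))
      + x f5 * (of_bool (C = v) - of_bool (B = v))" for x :: "'e \<Rightarrow> 'k" and v
  proof -
    have "inflow E t' h' x v = ?I x v" by (rule inflow_cong_ends) (use old in auto)
    then show ?thesis
      unfolding E'_def using new by (simp add: inflow_insert t' h' add_ac)
  qed
  have flow: "(\<forall>v\<in>G.W. inflow E' t' h' x v = 0) \<longleftrightarrow> ?good x" if x1: "x f1 = 0" for x :: "'e \<Rightarrow> 'k"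
  proof
    assume all: "\<forall>v\<in>G.W. inflow E' t' h' x v = 0"
    then have all': "inflow E' t' h' x v = 0" if "v \<in> V'" for v
      using G.inflow_root[of x] that by (cases "v = r") auto
    have "?I x v = 0" if "v \<in> V - {B, C, D}" for v
    proof -
      have "R \<noteq> v" "v \<in> V'" using that V by (auto simp: V'_def)
      then show ?thesis using all'[of v] that x1 unfolding inflow_G by auto
    qed
    moreover have "?I x B - x f3 - x f5 = 0" "?I x C + x f4 + x f5 = 0" "?I x D + x f2 = 0"
      using all'[of B] all'[of C] all'[of D] V x1 unfolding inflow_G V'_def by auto
    then have "x f2 = - ?I x D" "x f5 = ?I x B - x f3" "x f4 = x f3 - ?I x B - ?I x C"
      by algebra+
    ultimately show "?good x" by blast
  next
    assume good: "?good x"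
    have "?I x B + ?I x C + ?I x D = 0"
      by (rule sum_inflow_terminals) (use good V in auto)
    moreover have "?I x R = 0" using V by (auto intro: inflow_outside)
    ultimately have bal: "?I x B - x f3 - x f5 = 0" "?I x C + x f4 + x f5 = 0" "?I x D + x f2 = 0"
        "?I x R - x f2 + x f3 - x f4 = 0"
      using good by algebra+
    have "?I x v = 0" if "v \<in> V - {B, C, D}" for v using good that by blast
    then show "\<forall>v\<in>G.W. inflow E' t' h' x v = 0"
      unfolding inflow_G V'_def using bal V x1 by auto
  qed
  have mem: "(x, y, \<xi>, \<eta>) \<in> G.parallel_configs J f1 f5 f2 \<longleftrightarrow>
      x \<in> supp_on (insert f5 J) \<and> y \<in> supp_on (insert f5 (insert f2 J)) \<and> ?good x \<and> ?good y \<and>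
      \<xi> \<in> supp_on W \<and> \<eta> \<in> supp_on W \<and> \<eta> D = 0 \<and>
      (\<forall>i\<in>E. x i * volt \<eta> i = y i * volt \<xi> i) \<and>
      x f3 * (- \<eta> B) = y f3 * (- \<xi> B) \<and> x f4 * \<eta> C = y f4 * \<xi> C"
    for x y :: "'e \<Rightarrow> 'k" and \<xi> \<eta> :: "'v \<Rightarrow> 'k"
  proof (cases "x \<in> supp_on (insert f5 J) \<and> y \<in> supp_on (insert f5 (insert f2 J))")
    case True
    have "x f1 = 0" "y f1 = 0" using True new by (auto simp: supp_on_def J_def)
    note fl = flow[of x, OF this(1)] flow[of y, OF this(2)]
    have supp: "\<zeta> \<in> supp_on W \<longleftrightarrow> \<zeta> \<in> supp_on G.W \<and> \<zeta> R = 0" for \<zeta> :: "'v \<Rightarrow> 'k"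
      using V by (auto simp: supp_on_def V'_def)
    have r0: "\<zeta> r = 0" if "\<zeta> \<in> supp_on G.W" for \<zeta> :: "'v \<Rightarrow> 'k"
      using that by (simp add: supp_on_def)
    have gr: "grad t' h' \<zeta> i = volt \<zeta> i" if "i \<in> E" for \<zeta> :: "'v \<Rightarrow> 'k" and i
      using old that by (simp add: grad_def)
    have par: "(\<forall>i\<in>J. x i * grad t' h' \<eta> i = y i * grad t' h' \<xi> i) \<longleftrightarrow>
        (\<forall>i\<in>E. x i * volt \<eta> i = y i * volt \<xi> i) \<and>
        x f3 * (\<eta> R - \<eta> B) = y f3 * (\<xi> R - \<xi> B) \<and> x f4 * (\<eta> C - \<eta> R) = y f4 * (\<xi> C - \<xi> R)"
      unfolding J_def by (auto simp: gr) (auto simp: grad_def t' h')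
    have dead: "grad t' h' \<zeta> f1 = \<zeta> R - \<zeta> r" "grad t' h' \<zeta> f2 = \<zeta> D - \<zeta> R" for \<zeta> :: "'v \<Rightarrow> 'k"
      by (simp_all add: grad_def t' h')
    show ?thesis
      unfolding G.parallel_configs_def G.configs_def mem_Collect_eq prod.case par dead fl supp
      using True r0[of \<xi>] r0[of \<eta>] by auto
  next
    case False
    then show ?thesis by (auto simp: G.parallel_configs_def G.configs_def)
  qed
  define F :: "('e, 'v, 'k) config \<Rightarrow> ('k \<times> 'k) set" where
    "F = (\<lambda>(x, y, \<xi>, \<eta>). {(a, b). a * (- \<eta> B) = b * (- \<xi> B) \<and>
      (a + (- ?I x B - ?I x C)) * \<eta> C = (b + (- ?I y B - ?I y C)) * \<xi> C})"
  let ?O = "open_configs B C D :: ('e, 'v, 'k) config set"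
  let ?grounded = "{(x, y, \<xi>, \<eta>) \<in> ?O. \<eta> D = 0}"
  let ?T = "SIGMA p:?grounded. F p"
  let ?f = "\<lambda>(x, y, \<xi>, \<eta>). ((restrict0 E x, restrict0 E y, \<xi>, \<eta>), (x f3, y f3))"
  let ?gx = "\<lambda>x a. x(f3 := a, f4 := a - ?I x B - ?I x C, f5 := ?I x B - a)"
    and ?gy = "\<lambda>y b. y(f2 := - ?I y D, f3 := b, f4 := b - ?I y B - ?I y C, f5 := ?I y B - b)"
  let ?g = "\<lambda>((x, y, \<xi>, \<eta>), (a, b)).
      (?gx x a,
       ?gy y b, \<xi>, \<eta>)"
  have "bij_betw ?f (G.parallel_configs J f1 f5 f2) ?T"
  proof (rule bij_betwI[where g = ?g])
    show "?f \<in> G.parallel_configs J f1 f5 f2 \<rightarrow> ?T"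
    proof
      fix p :: "('e, 'v, 'k) config"
      assume "p \<in> G.parallel_configs J f1 f5 f2"
      then obtain x y \<xi> \<eta> where p: "p = (x, y, \<xi>, \<eta>)" and m: "(x, y, \<xi>, \<eta>) \<in> G.parallel_configs J f1 f5 f2"
        by (cases p) auto
      note m = m[unfolded mem]
      have x2: "x f2 = 0" using m new by (auto simp: supp_on_def J_def)
      have "(restrict0 E x, restrict0 E y, \<xi>, \<eta>) \<in> ?O"
        unfolding open_configs_def mem_Collect_eq prod.case inflow_restrict0
      proof (intro conjI ballI)
        show "?I x v = 0" if "v \<in> V - {B, C}" for v using m that x2 by (cases "v = D") auto
        show "restrict0 E x i * volt \<eta> i = restrict0 E y i * volt \<xi> i" if "i \<in> E" for i
          using m that by (simp add: restrict0_def)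
      qed (use m in \<open>auto simp: supp_on_def restrict0_def\<close>)
      moreover have "(x f3, y f3) \<in> F (restrict0 E x, restrict0 E y, \<xi>, \<eta>)"
      proof -
        have next_edge: "x f3 + (- ?I x B - ?I x C) = x f4" "y f3 + (- ?I y B - ?I y C) = y f4"
          using m by simp_all
        show ?thesis
          unfolding F_def prod.case mem_Collect_eq inflow_restrict0 next_edge using m by blast
      qed
      ultimately show "?f p \<in> ?T" using m by (simp add: p)
    qed
    show "?g \<in> ?T \<rightarrow> G.parallel_configs J f1 f5 f2"
    proof
      fix z assume "z \<in> ?T"
      then obtain x y \<xi> \<eta> a b where z: "z = ((x, y, \<xi>, \<eta>), (a, b))"
        and o: "(x, y, \<xi>, \<eta>) \<in> ?O" "\<eta> D = 0" and F: "(a, b) \<in> F (x, y, \<xi>, \<eta>)"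
        by auto
      have D: "?I x D = 0" using o V by (auto simp: open_configs_def)
      show "?g z \<in> G.parallel_configs J f1 f5 f2"
        unfolding z prod.case mem
      proof (intro conjI)
        show "\<forall>i\<in>E. ?gx x a i * volt \<eta> i
          = ?gy y b i * volt \<xi> i"
          using o new by (auto simp: open_configs_def)
      qed (use o F D new V in \<open>auto simp: open_configs_def F_def supp_on_def J_def algebra_simps\<close>)
    qed
    show "?g (?f p) = p" if "p \<in> G.parallel_configs J f1 f5 f2" for p
    proof -
      obtain x y \<xi> \<eta> where p: "p = (x, y, \<xi>, \<eta>)" by (cases p) auto
      note m = that[unfolded p mem]
      have "(restrict0 E x)(f3 := x f3, f4 := x f3 - ?I x B - ?I x C, f5 := ?I x B - x f3) = x"
        using m by (auto simp: fun_eq_iff restrict0_def supp_on_def J_def)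
      moreover have "(restrict0 E y)(f2 := - ?I y D, f3 := y f3, f4 := y f3 - ?I y B - ?I y C, f5 := ?I y B - y f3) = y"
        using m by (auto simp: fun_eq_iff restrict0_def supp_on_def J_def)
      ultimately show ?thesis by (simp add: p)
    qed
    show "?f (?g z) = z" if zT: "z \<in> ?T" for z
    proof -
      obtain x y \<xi> \<eta> a b where z: "z = ((x, y, \<xi>, \<eta>), (a, b))"
        and o: "(x, y, \<xi>, \<eta>) \<in> ?O" using zT by auto
      have "restrict0 E (?gx x a) = x"
        "restrict0 E (?gy y b) = y"
        using o new by (auto simp: fun_eq_iff restrict0_def supp_on_def open_configs_def)
      then show ?thesis using new by (simp add: z)
    qed
  qed
  then have "int (card (G.parallel_configs J f1 f5 f2 :: ('e, 'v, 'k) config set)) = int (card ?T)"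
    by (simp add: bij_betw_same_card)
  also have "\<dots> = (\<Sum>p\<in>?grounded. int (card (F p)))"
  proof -
    have "finite ?grounded" by (rule finite_subset[OF _ finite_open_configs]) auto
    then have "card ?T = (\<Sum>p\<in>?grounded. card (F p))" by (rule card_SigmaI) simp
    then show ?thesis by (simp only: of_nat_sum)
  qed
  also have "\<dots> = (\<Sum>p\<in>?O. case p of (x, y, \<xi>, \<eta>) \<Rightarrow> of_bool (\<eta> D = 0) * int (card (F p)))"
    by (rule sum.mono_neutral_cong_left) auto
  also have "[\<dots> = (\<Sum>p\<in>?O. case p of (x, y, \<xi>, \<eta>) \<Rightarrow>
      of_bool (\<eta> D = 0 \<and> \<xi> B * \<eta> C \<noteq> \<eta> B * \<xi> C))] (mod int CARD('k))"
  proof (rule cong_sum)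
    fix p :: "('e, 'v, 'k) config"
    obtain x y \<xi> \<eta> where p: "p = (x, y, \<xi>, \<eta>)" by (cases p) auto
    have "- \<eta> B * \<xi> C \<noteq> - \<xi> B * \<eta> C \<longleftrightarrow> \<xi> B * \<eta> C \<noteq> \<eta> B * \<xi> C"
      by auto
    then have "[int (card (F p)) = of_bool (\<xi> B * \<eta> C \<noteq> \<eta> B * \<xi> C)] (mod int CARD('k))"
      using card_two_linear_conditions_cong[of "- \<eta> B" "- \<xi> B" "- ?I x B - ?I x C" "\<eta> C" "- ?I y B - ?I y C" "\<xi> C"]
      by (simp add: F_def p)
    then show "[case p of (x, y, \<xi>, \<eta>) \<Rightarrow> of_bool (\<eta> D = 0) * int (card (F p))
        = (case p of (x, y, \<xi>, \<eta>) \<Rightarrow> of_bool (\<eta> D = 0 \<and> \<xi> B * \<eta> C \<noteq> \<eta> B * \<xi> C))] (mod int CARD('k))"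
      unfolding p prod.case of_bool_conj by (rule cong_mult[OF cong_refl])
  qed
  finally show ?thesis .
qed


section \<open>Spanning trees in terms of currents and potentials\<close>

definition link :: "'e set \<Rightarrow> ('v \<times> 'v) set" where
  "link T = {(u, v). \<exists>e\<in>T. (t e = u \<and> h e = v) \<or> (t e = v \<and> h e = u)}"

text \<open>Acyclic and connected subgraphs in linear terms: only the zero current on \<open>T\<close> obeys
  Kirchhoff's law, and only the zero potential is constant along \<open>T\<close>.\<close>

definition no_flow :: "'k::comm_ring_1 itself \<Rightarrow> 'e set \<Rightarrow> bool" where
  "no_flow _ T \<longleftrightarrow> (\<forall>x :: 'e \<Rightarrow> 'k. x \<in> supp_on T \<longrightarrow> (\<forall>v\<in>W. net x v = 0) \<longrightarrow> x = (\<lambda>_. 0))"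

definition spans :: "'k::comm_ring_1 itself \<Rightarrow> 'e set \<Rightarrow> bool" where
  "spans _ T \<longleftrightarrow> (\<forall>\<xi> :: 'v \<Rightarrow> 'k. \<xi> \<in> supp_on W \<longrightarrow> (\<forall>e\<in>T. volt \<xi> e = 0) \<longrightarrow> \<xi> = (\<lambda>_. 0))"

lemma sym_link: "sym (link T)"
  by (auto simp: sym_def link_def)

lemma link_rtrancl_sym: "(u, v) \<in> (link T)\<^sup>* \<Longrightarrow> (v, u) \<in> (link T)\<^sup>*"
  using sym_rtrancl[OF sym_link, of T] by (auto dest: symD)

text \<open>The indicator of \<open>S\<close>, shifted so that it vanishes at the root.\<close>

definition cut_potential :: "'v set \<Rightarrow> 'v \<Rightarrow> 'k::comm_ring_1" where
  "cut_potential S v = (if v \<in> V then of_bool (v \<in> S) - of_bool (r \<in> S) else 0)"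

lemma cut_potential_supp: "cut_potential S \<in> supp_on W"
  by (auto simp: supp_on_def cut_potential_def)

lemma grad_cut_potential:
  "e \<in> E \<Longrightarrow> volt (cut_potential S) e = (of_bool (h e \<in> S) - of_bool (t e \<in> S) :: 'k::comm_ring_1)"
  by (simp add: grad_def cut_potential_def tail_in head_in)

text \<open>The cut potential of the component of the root is constant along \<open>T\<close>.\<close>

lemma spans_iff:
  assumes "T \<subseteq> E"
  shows "spans TYPE('k::field) T \<longleftrightarrow> (\<forall>u\<in>V. \<forall>v\<in>V. (u, v) \<in> (link T)\<^sup>*)"
proof
  assume spans: "spans TYPE('k) T"
  let ?S = "(link T)\<^sup>* `` {r}"
  have "volt (cut_potential ?S) e = (0 :: 'k)" if "e \<in> T" for e
  proof -
    have "(t e, h e) \<in> link T" "(h e, t e) \<in> link T" using that by (auto simp: link_def)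
    then have "h e \<in> ?S \<longleftrightarrow> t e \<in> ?S" by (meson Image_singleton_iff rtrancl.rtrancl_into_rtrancl)
    moreover have "e \<in> E" using that assms by blast
    ultimately show ?thesis by (simp add: grad_cut_potential)
  qed
  then have "cut_potential ?S = (\<lambda>_. 0 :: 'k)"
    using spans cut_potential_supp by (auto simp: spans_def)
  then have "v \<in> ?S" if "v \<in> V" for v
  proof -
    have "r \<in> ?S" by simp
    moreover have "of_bool (v \<in> ?S) - of_bool (r \<in> ?S) = (0 :: 'k)"
      using fun_cong[OF \<open>cut_potential ?S = (\<lambda>_. 0 :: 'k)\<close>, of v] that unfolding cut_potential_def by simp
    ultimately show ?thesis by (cases "v \<in> ?S") simp_all
  qed
  then show "\<forall>u\<in>V. \<forall>v\<in>V. (u, v) \<in> (link T)\<^sup>*"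
    by (meson Image_singleton_iff link_rtrancl_sym rtrancl_trans)
next
  assume conn: "\<forall>u\<in>V. \<forall>v\<in>V. (u, v) \<in> (link T)\<^sup>*"
  show "spans TYPE('k) T"
    unfolding spans_def
  proof (intro allI impI)
    fix \<xi> :: "'v \<Rightarrow> 'k" assume \<xi>: "\<xi> \<in> supp_on W" "\<forall>e\<in>T. volt \<xi> e = 0"
    have same: "\<xi> v = \<xi> u" if "(u, v) \<in> (link T)\<^sup>*" for u v
      using that by (induction rule: rtrancl_induct) (use \<xi>(2) in \<open>auto simp: link_def grad_def\<close>)
    show "\<xi> = (\<lambda>_. 0)"
    proof
      fix v show "\<xi> v = 0"
        using \<xi>(1) conn root same[of r v] by (cases "v \<in> V") (auto simp: supp_on_def)
    qed
  qed
qed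

lemma path_flow:
  assumes "T \<subseteq> E" "(u, v) \<in> (link T)\<^sup>*"
  shows "\<exists>x\<in>supp_on T. \<forall>w. net x w = (of_bool (v = w) - of_bool (u = w) :: 'k::comm_ring_1)"
  using assms(2)
proof (induction rule: rtrancl_induct)
  case base
  show ?case by (intro bexI[of _ "\<lambda>_. 0"]) auto
next
  case (step v v')
  then obtain x :: "'e \<Rightarrow> 'k" where x: "x \<in> supp_on T"
    "\<And>w. net x w = of_bool (v = w) - of_bool (u = w)" by blast
  from step(2) obtain e where e: "e \<in> T" "(t e = v \<and> h e = v') \<or> (t e = v' \<and> h e = v)"
    by (auto simp: link_def)
  define c :: 'k where "c = (if t e = v \<and> h e = v' then 1 else - 1)"
  have "e \<in> E" using e assms(1) by blast
  have unit: "net (\<lambda>e'. of_bool (e' = e) :: 'k) w = of_bool (h e = w) - of_bool (t e = w)" for w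
  proof -
    have "net (\<lambda>e'. of_bool (e' = e) :: 'k) w
        = (\<Sum>e'\<in>E. if e' = e then of_bool (h e = w) - of_bool (t e = w) else 0)"
      unfolding inflow_def by (intro sum.cong) auto
    then show ?thesis using \<open>e \<in> E\<close> by simp
  qed
  have "net (\<lambda>e'. x e' + c * of_bool (e' = e)) w = of_bool (v' = w) - of_bool (u = w)" for w
    unfolding inflow_add_mult unit x(2) using e(2) by (auto simp: c_def)
  moreover have "(\<lambda>e'. x e' + c * of_bool (e' = e)) \<in> supp_on T"
    using x(1) e(1) by (auto simp: supp_on_def)
  ultimately show ?case by blast
qed

lemma flow_through_edge:
  assumes "e \<in> E"
  shows "net (y(e := c)) w = net y w + (c - y e) * (of_bool (h e = w) - of_bool (t e = w) :: 'k::comm_ring_1)"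
  using assms by (simp add: inflow_def sum.remove[of E e] algebra_simps)

text \<open>A path around \<open>e\<close> carries a unit current, which returns through \<open>e\<close>.\<close>

lemma flow_of_bypass:
  assumes "T \<subseteq> E" "e \<in> T" "(t e, h e) \<in> (link (T - {e}))\<^sup>*"
  shows "\<not> no_flow TYPE('k::field) T"
proof -
  obtain y :: "'e \<Rightarrow> 'k" where y: "y \<in> supp_on (T - {e})"
    "\<And>w. net y w = of_bool (h e = w) - of_bool (t e = w)"
    using path_flow[OF _ assms(3)] assms(1) by blast
  have "y e = 0" "e \<in> E" using y(1) assms by (auto simp: supp_on_def)
  then have "net (y(e := - 1)) w = 0" for w by (simp add: flow_through_edge y(2))
  moreover have "y(e := - 1) \<in> supp_on T" using y(1) assms(2) by (auto simp: supp_on_def)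
  moreover have "y(e := - 1) \<noteq> (\<lambda>_. 0)" by (auto simp: fun_eq_iff intro!: exI[of _ e])
  ultimately show ?thesis unfolding no_flow_def by blast
qed

text \<open>Otherwise \<open>e\<close> would be the only edge of \<open>T\<close> leaving the set of vertices reachable from its tail
  without \<open>e\<close>, and the current through this cut would be \<open>x e\<close> instead of \<open>0\<close>.\<close>

lemma bypass_of_flow:
  fixes x :: "'e \<Rightarrow> 'k::field"
  assumes "T \<subseteq> E" "x \<in> supp_on T" "\<And>v. v \<in> W \<Longrightarrow> net x v = 0" "x e \<noteq> 0"
  shows "(t e, h e) \<in> (link (T - {e}))\<^sup>*"
proof (rule ccontr)
  let ?S = "(link (T - {e}))\<^sup>* `` {t e}"
  assume "\<not> ?thesis"
  then have ends: "t e \<in> ?S" "h e \<notin> ?S" by auto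
  have "e \<in> T" "e \<in> E" using assms by (auto simp: supp_on_def)
  have "x f * volt (cut_potential ?S) f = (if f = e then - x e else 0)" if "f \<in> E" for f
  proof (cases "f = e \<or> x f = 0")
    case True
    then show ?thesis using ends that by (auto simp: grad_cut_potential)
  next
    case False
    then have "f \<in> T - {e}" using assms(2) by (auto simp: supp_on_def)
    then have "(t f, h f) \<in> link (T - {e})" "(h f, t f) \<in> link (T - {e})" by (auto simp: link_def)
    then have "h f \<in> ?S \<longleftrightarrow> t f \<in> ?S" by (meson Image_singleton_iff rtrancl.rtrancl_into_rtrancl)
    then show ?thesis using that False by (simp add: grad_cut_potential)
  qed
  then have "(\<Sum>f\<in>E. x f * volt (cut_potential ?S) f) = - x e"
    using \<open>e \<in> E\<close> by (simp cong: sum.cong)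
  then show False
    using flow_orthogonal[OF cut_potential_supp assms(3)] assms(4) by simp
qed

text \<open>When the walk returns to an earlier vertex, the path is cut back to it.\<close>

lemma simple_path:
  assumes "(u, v) \<in> (link T)\<^sup>*"
  shows "\<exists>vs es. length vs = Suc (length es) \<and> vs ! 0 = u \<and> vs ! length es = v \<and> distinct vs \<and> set es \<subseteq> T \<and>
    (\<forall>i<length es. Upair (t (es ! i)) (h (es ! i)) = Upair (vs ! i) (vs ! Suc i))"
  using assms
proof (induction rule: rtrancl_induct)
  case base
  show ?case by (intro exI[of _ "[u]"] exI[of _ "[]"]) auto
next
  case (step v w)
  then obtain vs es where p: "length vs = Suc (length es)" "vs ! 0 = u" "vs ! length es = v" "distinct vs" "set es \<subseteq> T"
    "\<And>i. i < length es \<Longrightarrow> Upair (t (es ! i)) (h (es ! i)) = Upair (vs ! i) (vs ! Suc i)" by blast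
  from step(2) obtain e where e: "e \<in> T" "Upair (t e) (h e) = Upair v w" by (auto simp: link_def)
  show ?case
  proof (cases "w \<in> set vs")
    case True
    then obtain n where n: "n < length vs" "vs ! n = w" by (auto simp: in_set_conv_nth)
    show ?thesis
    proof (intro exI conjI allI impI)
      show "length (take (Suc n) vs) = Suc (length (take n es))" using n p(1) by simp
      show "take (Suc n) vs ! 0 = u" using p by simp
      show "take (Suc n) vs ! length (take n es) = w" using n p(1) by simp
      show "distinct (take (Suc n) vs)" using p by simp
      show "set (take n es) \<subseteq> T" using p(5) set_take_subset by fast
    next
      fix i assume "i < length (take n es)"
      then show "Upair (t (take n es ! i)) (h (take n es ! i)) = Upair (take (Suc n) vs ! i) (take (Suc n) vs ! Suc i)"
        using p(6)[of i] by simp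
    qed
  next
    case False
    show ?thesis
    proof (intro exI conjI allI impI)
      show "length (vs @ [w]) = Suc (length (es @ [e]))" using p by simp
      show "(vs @ [w]) ! 0 = u" using p(1,2) by (simp add: nth_append)
      show "(vs @ [w]) ! length (es @ [e]) = w" using p(1) by (simp add: nth_append)
      show "distinct (vs @ [w])" using p(4) False by simp
      show "set (es @ [e]) \<subseteq> T" using p(5) e by simp
    next
      fix i assume "i < length (es @ [e])"
      then show "Upair (t ((es @ [e]) ! i)) (h ((es @ [e]) ! i)) = Upair ((vs @ [w]) ! i) ((vs @ [w]) ! Suc i)"
        using p(6)[of i] p(1,3) e(2) by (cases "i = length es") (auto simp: nth_append)
    qed
  qed
qed

lemma cycle_of_bypass:
  assumes G: "edges G = T" "\<And>f. f \<in> T \<Longrightarrow> ends G f = Upair (t f) (h f)"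
    and e: "e \<in> T" "(t e, h e) \<in> (link (T - {e}))\<^sup>*"
  shows "\<exists>es. is_cycle G es"
proof -
  obtain vs es where p: "length vs = Suc (length es)" "vs ! 0 = t e" "vs ! length es = h e" "distinct vs"
    "set es \<subseteq> T - {e}" "\<And>i. i < length es \<Longrightarrow> Upair (t (es ! i)) (h (es ! i)) = Upair (vs ! i) (vs ! Suc i)"
    using simple_path[OF e(2)] by blast
  have "i = j" if "i < length es" "j < length es" "es ! i = es ! j" for i j
  proof -
    have "Upair (vs ! i) (vs ! Suc i) = Upair (vs ! j) (vs ! Suc j)" using p(6) that by metis
    then have "(i = j \<and> Suc i = Suc j) \<or> (i = Suc j \<and> Suc i = j)"
      using p(1,4) that by (auto simp: nth_eq_iff_index_eq)
    then show ?thesis by auto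
  qed
  then have "distinct es" by (auto simp: distinct_conv_nth)
  then have "is_cycle G (es @ [e])"
    unfolding is_cycle_def
  proof (intro conjI exI[of _ vs] allI impI)
    fix i assume i: "i < length (es @ [e])"
    show "ends G ((es @ [e]) ! i) = Upair (vs ! i) (vs ! (Suc i mod length (es @ [e])))"
    proof (cases "i = length es")
      case True
      then show ?thesis using G(2)[OF e(1)] p(2,3) by simp
    next
      case False
      then have "i < length es" using i by simp
      moreover have "es ! i \<in> T" using p(5) nth_mem[OF \<open>i < length es\<close>] by blast
      ultimately show ?thesis using G(2) p(6) by (simp add: nth_append)
    qed
  qed (use p e G in auto)
  then show ?thesis by blast
qed

text \<open>The remaining edges of the cycle lead around its first edge.\<close>

lemma bypass_of_cycle:
  assumes G: "edges G = T" "\<And>f. f \<in> T \<Longrightarrow> ends G f = Upair (t f) (h f)"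
    and c: "is_cycle G es"
  shows "\<exists>e\<in>T. (t e, h e) \<in> (link (T - {e}))\<^sup>*"
proof -
  obtain vs where vs: "es \<noteq> []" "distinct es" "set es \<subseteq> T" "length vs = length es"
    "\<And>i. i < length es \<Longrightarrow> ends G (es ! i) = Upair (vs ! i) (vs ! (Suc i mod length es))"
    using c unfolding is_cycle_def G(1) by blast
  let ?n = "length es" and ?e = "es ! 0"
  have e: "?e \<in> T" using vs(1,3) by auto
  have "(vs ! (1 mod ?n), vs ! (Suc i mod ?n)) \<in> (link (T - {?e}))\<^sup>*" if "Suc i \<le> ?n" for i
    using that
  proof (induction i)
    case (Suc i)
    then have i: "Suc i < ?n" by simp
    then have "es ! Suc i \<noteq> ?e" using vs(2) by (metis Suc_lessD Zero_not_Suc length_pos_if_in_set nth_eq_iff_index_eq nth_mem)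
    moreover have "es ! Suc i \<in> T" using vs(3) i by auto
    moreover have "Upair (t (es ! Suc i)) (h (es ! Suc i)) = Upair (vs ! (Suc i mod ?n)) (vs ! (Suc (Suc i) mod ?n))"
      using vs(5)[OF i] G(2)[OF calculation(2)] i by simp
    ultimately have "(vs ! (Suc i mod ?n), vs ! (Suc (Suc i) mod ?n)) \<in> link (T - {?e})"
      by (auto simp: link_def)
    then show ?case using Suc by (meson Suc_leD rtrancl.rtrancl_into_rtrancl)
  qed simp
  from this[of "?n - 1"] have "(vs ! (1 mod ?n), vs ! 0) \<in> (link (T - {?e}))\<^sup>*" using vs(1) by simp
  moreover have "Upair (t ?e) (h ?e) = Upair (vs ! 0) (vs ! (1 mod ?n))"
    using vs(1) vs(5)[of 0] G(2)[OF e] by simp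
  ultimately have "(t ?e, h ?e) \<in> (link (T - {?e}))\<^sup>*"
    using link_rtrancl_sym by auto
  then show ?thesis using e by blast
qed

definition tree :: "'k::field itself \<Rightarrow> 'e set \<Rightarrow> bool" where
  "tree K T \<longleftrightarrow> T \<subseteq> E \<and> no_flow K T \<and> spans K T"

lemma spanning_trees_eq:
  assumes G: "verts G = V" "edges G = E" "\<And>f. f \<in> E \<Longrightarrow> ends G f = Upair (t f) (h f)"
  shows "spanning_trees G = {T. tree TYPE('k::field) T}"
proof -
  have "is_tree (G\<lparr>edges := T\<rparr>) \<longleftrightarrow> no_flow TYPE('k) T \<and> spans TYPE('k) T" if T: "T \<subseteq> E" for T
  proof -
    have GT: "edges (G\<lparr>edges := T\<rparr>) = T" "\<And>f. f \<in> T \<Longrightarrow> ends (G\<lparr>edges := T\<rparr>) f = Upair (t f) (h f)"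
      using G(3) T by auto
    have "adj_rel (G\<lparr>edges := T\<rparr>) = link T"
      unfolding adj_rel_def link_def using GT(2) by auto
    then have "connected_graph (G\<lparr>edges := T\<rparr>) \<longleftrightarrow> spans TYPE('k) T"
      using root G(1) unfolding connected_graph_def connected_rel_def spans_iff[OF T] by auto
    moreover have "(\<nexists>es. is_cycle (G\<lparr>edges := T\<rparr>) es) \<longleftrightarrow> no_flow TYPE('k) T"
    proof
      assume acyclic: "\<nexists>es. is_cycle (G\<lparr>edges := T\<rparr>) es"
      show "no_flow TYPE('k) T"
        unfolding no_flow_def
      proof (intro allI impI, rule ccontr)
        fix x :: "'e \<Rightarrow> 'k" assume x: "x \<in> supp_on T" "\<forall>v\<in>W. net x v = 0" "x \<noteq> (\<lambda>_. 0)"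
        then obtain e where e: "x e \<noteq> 0" by auto
        then have "e \<in> T" using x(1) by (auto simp: supp_on_def)
        then show False
          using acyclic cycle_of_bypass[OF GT _ bypass_of_flow[OF T x(1) _ e]] x(2) by blast
      qed
    next
      assume "no_flow TYPE('k) T"
      then show "\<nexists>es. is_cycle (G\<lparr>edges := T\<rparr>) es"
        using bypass_of_cycle[OF GT] flow_of_bypass[OF T] by blast
    qed
    ultimately show ?thesis by (auto simp: is_tree_def)
  qed
  then show ?thesis unfolding spanning_trees_def tree_def G(2) by auto
qed

end

section \<open>Fundamental flows and the graph polynomial\<close>

lemma inflow_sum:
  "inflow E t h (\<lambda>i. \<Sum>a\<in>A. c a * y a i) v = (\<Sum>a\<in>A. c a * inflow E t h (y a) v)"
  unfolding inflow_def sum_distrib_left sum_distrib_right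
  by (subst sum.swap) (simp only: mult.assoc)

context network
begin

text \<open>The unit current through \<open>e\<close> that returns in the tree \<open>T\<close>.\<close>

definition fundamental_flow :: "'e set \<Rightarrow> 'e \<Rightarrow> 'e \<Rightarrow> 'k::field" where
  "fundamental_flow T e = (SOME c. c \<in> supp_on (insert e T) \<and> (\<forall>v\<in>W. net c v = 0) \<and> c e = 1)"

lemma
  assumes T: "tree TYPE('k::field) T" and e: "e \<in> E" "e \<notin> T"
  shows fundamental_flow_supp: "(fundamental_flow T e :: 'e \<Rightarrow> 'k) \<in> supp_on (insert e T)"
    and fundamental_flow_flow: "\<And>v. v \<in> W \<Longrightarrow> net (fundamental_flow T e :: 'e \<Rightarrow> 'k) v = 0"
    and fundamental_flow_self: "fundamental_flow T e e = (1 :: 'k)"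
proof -
  have "T \<subseteq> E" "spans TYPE('k) T" using T by (auto simp: tree_def)
  then have "(h e, t e) \<in> (link T)\<^sup>*"
    using spans_iff tail_in[OF e(1)] head_in[OF e(1)] by blast
  then obtain y :: "'e \<Rightarrow> 'k" where y: "y \<in> supp_on T" "\<And>w. net y w = of_bool (t e = w) - of_bool (h e = w)"
    using path_flow[OF \<open>T \<subseteq> E\<close>] by blast
  have "y e = 0" using y(1) e(2) by (auto simp: supp_on_def)
  then have "net (y(e := 1)) w = 0" for w
    using e(1) by (simp add: flow_through_edge y(2))
  moreover have "y(e := 1) \<in> supp_on (insert e T)" using y(1) by (auto simp: supp_on_def)
  ultimately have "\<exists>c :: 'e \<Rightarrow> 'k. c \<in> supp_on (insert e T) \<and> (\<forall>v\<in>W. net c v = 0) \<and> c e = 1"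
    by (intro exI[of _ "y(e := 1)"]) auto
  from someI_ex[OF this] show "(fundamental_flow T e :: 'e \<Rightarrow> 'k) \<in> supp_on (insert e T)"
    "\<And>v. v \<in> W \<Longrightarrow> net (fundamental_flow T e :: 'e \<Rightarrow> 'k) v = 0"
    "fundamental_flow T e e = (1 :: 'k)"
    unfolding fundamental_flow_def by blast+
qed

lemma no_flowD:
  assumes "no_flow TYPE('k::comm_ring_1) T" "x \<in> supp_on T" "\<And>v. v \<in> W \<Longrightarrow> net x v = 0"
  shows "x i = (0 :: 'k)"
proof -
  have "x = (\<lambda>_. 0)" using assms unfolding no_flow_def by blast
  then show ?thesis by simp
qed

lemma fundamental_flow_unique:
  fixes x :: "'e \<Rightarrow> 'k::field"
  assumes T: "tree TYPE('k) T" and e: "e \<in> E" "e \<notin> T"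
    and x: "x \<in> supp_on (insert e T)" "\<And>v. v \<in> W \<Longrightarrow> net x v = 0"
  shows "x i = x e * fundamental_flow T e i"
proof -
  note F = fundamental_flow_supp[OF T e] fundamental_flow_flow[OF T e] fundamental_flow_self[OF T e]
  have "(\<lambda>i. x i + (- x e) * fundamental_flow T e i) i = 0"
  proof (rule no_flowD)
    show "no_flow TYPE('k) T" using T by (simp add: tree_def)
    show "(\<lambda>i. x i + (- x e) * fundamental_flow T e i) \<in> supp_on T"
      unfolding supp_on_def mem_Collect_eq
    proof (intro allI impI)
      fix a assume "a \<notin> T"
      then show "x a + (- x e) * fundamental_flow T e a = 0"
        using x(1) F(1,3) by (cases "a = e") (auto simp: supp_on_def)
    qed
    show "net (\<lambda>i. x i + (- x e) * fundamental_flow T e i) v = 0" if "v \<in> W" for v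
      unfolding inflow_add_mult using x(2)[OF that] F(2)[OF that] by simp
  qed
  then show ?thesis by simp
qed

text \<open>Removing \<open>f\<close> cuts the tree in two parts, and among the edges of the tree and \<open>e\<close> only \<open>f\<close> and
  possibly \<open>e\<close> cross the cut; so the value at \<open>f\<close> is \<open>0\<close>, \<open>1\<close> or \<open>- 1\<close>.\<close>

lemma fundamental_flow_square:
  assumes T: "tree TYPE('k::field) T" and e: "e \<in> E" "e \<notin> T" and f: "f \<in> T"
    and nz: "fundamental_flow T e f \<noteq> (0 :: 'k)"
  shows "fundamental_flow T e f * fundamental_flow T e f = (1 :: 'k)"
proof -
  let ?c = "fundamental_flow T e :: 'e \<Rightarrow> 'k"
  define S where "S = (link (T - {f}))\<^sup>* `` {t f}"
  note F = fundamental_flow_supp[OF T e] fundamental_flow_flow[OF T e] fundamental_flow_self[OF T e]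
  have TE: "T \<subseteq> E" "f \<in> E" "e \<noteq> f" using T f e by (auto simp: tree_def)
  have "t f \<in> S" "h f \<notin> S"
    using flow_of_bypass[OF TE(1) f] T by (auto simp: S_def tree_def)
  have other: "?c g * volt (cut_potential S) g = 0" if g: "g \<in> E" "g \<noteq> e" "g \<noteq> f" for g
  proof (cases "g \<in> T")
    case True
    then have "(t g, h g) \<in> link (T - {f})" "(h g, t g) \<in> link (T - {f})" using g by (auto simp: link_def)
    then have "h g \<in> S \<longleftrightarrow> t g \<in> S" unfolding S_def by (meson Image_singleton_iff rtrancl.rtrancl_into_rtrancl)
    then show ?thesis using g by (simp add: grad_cut_potential)
  next
    case False
    then show ?thesis using g F(1) by (auto simp: supp_on_def)
  qed
  have "0 = (\<Sum>g\<in>E. ?c g * volt (cut_potential S) g)"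
    using flow_orthogonal[OF cut_potential_supp F(2)] by simp
  also have "\<dots> = (\<Sum>g\<in>{e, f}. ?c g * volt (cut_potential S) g)"
    by (rule sum.mono_neutral_right) (use e TE other in auto)
  also have "\<dots> = of_bool (h e \<in> S) - of_bool (t e \<in> S) - ?c f"
    using TE e F(3) \<open>t f \<in> S\<close> \<open>h f \<notin> S\<close> by (simp add: grad_cut_potential)
  finally have "?c f = of_bool (h e \<in> S) - of_bool (t e \<in> S)" by simp
  then show ?thesis using nz by (cases "h e \<in> S"; cases "t e \<in> S") auto
qed

lemma tree_exchange:
  assumes T: "tree TYPE('k::field) T" and e: "e \<in> E" "e \<notin> T" and f: "f \<in> T"
    and nz: "fundamental_flow T e f \<noteq> (0 :: 'k)"
  shows "tree TYPE('k) (insert e (T - {f}))"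
proof -
  let ?c = "fundamental_flow T e :: 'e \<Rightarrow> 'k"
  note F = fundamental_flow_supp[OF T e] fundamental_flow_flow[OF T e] fundamental_flow_self[OF T e]
  have TE: "T \<subseteq> E" "f \<in> E" "e \<noteq> f" using T f e by (auto simp: tree_def)
  have "no_flow TYPE('k) (insert e (T - {f}))"
    unfolding no_flow_def
  proof (intro allI impI)
    fix x :: "'e \<Rightarrow> 'k" assume x: "x \<in> supp_on (insert e (T - {f}))" "\<forall>v\<in>W. net x v = 0"
    have eq: "x i = x e * ?c i" for i
      by (rule fundamental_flow_unique[OF T e]) (use x in \<open>auto simp: supp_on_def\<close>)
    have "x f = 0" using x(1) TE by (auto simp: supp_on_def)
    then have e0: "x e = 0" using eq[of f] nz by simp
    show "x = (\<lambda>_. 0)"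
    proof
      fix i show "x i = 0" using eq[of i] unfolding e0 by simp
    qed
  qed
  moreover have "spans TYPE('k) (insert e (T - {f}))"
    unfolding spans_def
  proof (intro allI impI)
    fix \<xi> :: "'v \<Rightarrow> 'k" assume \<xi>: "\<xi> \<in> supp_on W" "\<forall>g\<in>insert e (T - {f}). volt \<xi> g = 0"
    have "0 = (\<Sum>g\<in>E. ?c g * volt \<xi> g)"
      using flow_orthogonal[OF \<xi>(1) F(2)] by simp
    also have "\<dots> = (\<Sum>g\<in>{f}. ?c g * volt \<xi> g)"
      by (rule sum.mono_neutral_right) (use TE \<xi>(2) F(1) in \<open>auto simp: supp_on_def\<close>)
    finally have "volt \<xi> f = 0" using nz by simp
    then have "\<forall>g\<in>T. volt \<xi> g = 0" using \<xi>(2) by auto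
    then show "\<xi> = (\<lambda>_. 0)" using T \<xi>(1) by (auto simp: tree_def spans_def)
  qed
  ultimately show ?thesis using TE e by (auto simp: tree_def)
qed

text \<open>The two fundamental flows are proportional with factor \<open>\<plusminus>1\<close>, which is its own inverse.\<close>

lemma exchanged_fundamental_flow:
  assumes T: "tree TYPE('k::field) T" and e: "e \<in> E" "e \<notin> T" and f: "f \<in> T"
    and nz: "fundamental_flow T e f \<noteq> (0 :: 'k)"
  shows "fundamental_flow (insert e (T - {f})) f e = (fundamental_flow T e f :: 'k)"
proof -
  let ?T = "insert e (T - {f})" and ?a = "fundamental_flow T e f :: 'k"
  have f': "f \<in> E" "f \<notin> ?T" using T f e by (auto simp: tree_def)
  have "fundamental_flow T e e = ?a * (fundamental_flow ?T f e :: 'k)"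
  proof (rule fundamental_flow_unique[OF tree_exchange[OF T e f nz] f'])
    have "insert f ?T = insert e T" using f by auto
    then show "(fundamental_flow T e :: 'e \<Rightarrow> 'k) \<in> supp_on (insert f ?T)"
      using fundamental_flow_supp[OF T e] by simp
  qed (rule fundamental_flow_flow[OF T e])
  then have "?a * fundamental_flow ?T f e = 1" using fundamental_flow_self[OF T e] by simp
  then show ?thesis
    using fundamental_flow_square[OF T e f nz] nz by (metis mult_left_cancel)
qed

lemma flow_expansion:
  fixes x :: "'e \<Rightarrow> 'k::field"
  assumes T: "tree TYPE('k) T" and x: "x \<in> supp_on E" "\<And>v. v \<in> W \<Longrightarrow> net x v = 0"
  shows "x i = (\<Sum>e\<in>E - T. x e * fundamental_flow T e i)"
proof -
  let ?y = "\<lambda>i. \<Sum>e\<in>E - T. x e * fundamental_flow T e i"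
  have "(\<lambda>i. x i - ?y i) i = 0"
  proof (rule no_flowD)
    show "no_flow TYPE('k) T" using T by (simp add: tree_def)
    show "(\<lambda>i. x i - ?y i) \<in> supp_on T"
      unfolding supp_on_def mem_Collect_eq
    proof (intro allI impI)
      fix i assume i: "i \<notin> T"
      have "fundamental_flow T e i = (of_bool (i = e) :: 'k)" if "e \<in> E - T" for e
        using fundamental_flow_supp[OF T, of e] fundamental_flow_self[OF T, of e] that i
        by (auto simp: supp_on_def)
      then have "?y i = (\<Sum>e\<in>E - T. if i = e then x e else 0)" by (intro sum.cong) auto
      also have "\<dots> = x i" using i x(1) by (auto simp: supp_on_def)
      finally show "x i - ?y i = 0" by simp
    qed
    show "net (\<lambda>i. x i - ?y i) v = 0" if "v \<in> W" for v
      unfolding inflow_diff inflow_sum using x(2)[OF that] fundamental_flow_flow[OF T _ _ that] by simp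
  qed
  then show ?thesis by simp
qed

text \<open>The graph polynomial of the graph with the edges \<open>I\<close>; edges of \<open>E\<close> outside \<open>I\<close> count as deleted.\<close>

definition psi :: "'e set \<Rightarrow> ('e \<Rightarrow> 'k::field) \<Rightarrow> 'k" where
  "psi I \<alpha> = (\<Sum>T | tree TYPE('k) T \<and> T \<subseteq> I. \<Prod>e\<in>I - T. \<alpha> e)"

lemma finite_trees [simp]: "finite {T. tree TYPE('k::field) T \<and> P T}"
  by (rule finite_subset[of _ "Pow E"]) (auto simp: tree_def)

text \<open>A solution \<open>x\<close> of the network is annihilated by the graph polynomial. A tree \<open>T\<close> without \<open>f\<close>
  contributes a multiple of \<open>\<alpha>\<^sub>f x\<^sub>f\<close>, which by orthogonality of the gradient \<open>\<alpha> x\<close> to the fundamental flow of \<open>f\<close> is a sum over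
  the edges \<open>e\<close> of \<open>T\<close>; a tree containing \<open>f\<close> contributes a multiple of \<open>x\<^sub>f\<close>, which expands in the fundamental flows of the
  edges \<open>e\<close> outside it. The exchange of \<open>e\<close> and \<open>f\<close> is a bijection between the two kinds of terms, and
  they cancel.\<close>

lemma flow_times_psi:
  fixes x \<alpha> :: "'e \<Rightarrow> 'k::field"
  assumes I: "I \<subseteq> E" and x: "x \<in> supp_on I" "\<And>v. v \<in> W \<Longrightarrow> net x v = 0"
    and \<xi>: "\<xi> \<in> supp_on W" "\<And>e. e \<in> I \<Longrightarrow> volt \<xi> e = \<alpha> e * x e" and f: "f \<in> I"
  shows "psi I \<alpha> * x f = 0"
proof -
  let ?w = "\<lambda>T. \<Prod>e\<in>I - T. \<alpha> e"
  let ?A = "{T. tree TYPE('k) T \<and> T \<subseteq> I \<and> f \<notin> T}" and ?B = "{T. tree TYPE('k) T \<and> T \<subseteq> I \<and> f \<in> T}"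
  have finI: "finite I" using I by (rule finite_subset) simp
  have fE: "f \<in> E" using f I by blast
  have xE: "x \<in> supp_on E" using x(1) supp_on_mono[OF I] by blast
  have finT: "finite T" if "T \<in> ?A" for T using that finI finite_subset by blast
  have 1: "?w T * x f = - (\<Sum>e\<in>T. ?w (insert f (T - {e})) * (x e * fundamental_flow T f e))" if T: "T \<in> ?A" for T
  proof -
    let ?c = "fundamental_flow T f :: 'e \<Rightarrow> 'k" and ?w' = "\<Prod>e\<in>I - T - {f}. \<alpha> e"
    have tree: "tree TYPE('k) T" "f \<notin> T" "T \<subseteq> I" using T by auto
    note F = fundamental_flow_supp[OF tree(1) fE tree(2)] fundamental_flow_flow[OF tree(1) fE tree(2)]
      fundamental_flow_self[OF tree(1) fE tree(2)]
    have "0 = (\<Sum>e\<in>E. ?c e * volt \<xi> e)"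
      using flow_orthogonal[OF \<xi>(1) F(2)] by simp
    also have "\<dots> = (\<Sum>e\<in>insert f T. ?c e * volt \<xi> e)"
      by (rule sum.mono_neutral_right) (use F(1) I tree fE in \<open>auto simp: supp_on_def\<close>)
    also have "\<dots> = (\<Sum>e\<in>insert f T. ?c e * (\<alpha> e * x e))"
      by (intro sum.cong refl) (use \<xi>(2) f tree in auto)
    also have "\<dots> = \<alpha> f * x f + (\<Sum>e\<in>T. ?c e * (\<alpha> e * x e))"
      using finT[OF T] tree F(3) by simp
    finally have sum: "\<alpha> f * x f = - (\<Sum>e\<in>T. ?c e * (\<alpha> e * x e))" by (simp add: eq_neg_iff_add_eq_0)
    have "?w T = ?w' * \<alpha> f"
      using finI f tree prod.remove[of "I - T" f \<alpha>] by (simp add: mult.commute)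
    then have "?w T * x f = ?w' * (\<alpha> f * x f)" by (simp add: mult.assoc)
    also have "\<dots> = - (\<Sum>e\<in>T. ?w' * (?c e * (\<alpha> e * x e)))"
      unfolding sum by (simp add: sum_distrib_left)
    also have "(\<Sum>e\<in>T. ?w' * (?c e * (\<alpha> e * x e))) = (\<Sum>e\<in>T. ?w (insert f (T - {e})) * (x e * ?c e))"
    proof (rule sum.cong)
      fix e assume e: "e \<in> T"
      have "I - insert f (T - {e}) = insert e (I - T - {f})" using e tree by auto
      then have "?w (insert f (T - {e})) = \<alpha> e * ?w'" using e finI by simp
      then show "?w' * (?c e * (\<alpha> e * x e)) = ?w (insert f (T - {e})) * (x e * ?c e)" by simp
    qed simp
    finally show ?thesis .
  qed
  have 2: "?w T * x f = (\<Sum>e\<in>I - T. ?w T * (x e * fundamental_flow T e f))" if T: "T \<in> ?B" for T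
  proof -
    have "x f = (\<Sum>e\<in>E - T. x e * fundamental_flow T e f)"
      by (rule flow_expansion) (use T xE x(2) in auto)
    also have "\<dots> = (\<Sum>e\<in>I - T. x e * fundamental_flow T e f)"
      by (rule sum.mono_neutral_right) (use I x(1) in \<open>auto simp: supp_on_def\<close>)
    finally show ?thesis by (metis sum_distrib_left)
  qed
  have "(\<Sum>T\<in>?A. \<Sum>e\<in>T. ?w (insert f (T - {e})) * (x e * fundamental_flow T f e))
      = (\<Sum>(T, e)\<in>(SIGMA T:?A. T). ?w (insert f (T - {e})) * (x e * fundamental_flow T f e))"
    by (rule sum.Sigma) (use finT in auto)
  also have "\<dots> = (\<Sum>(T, e)\<in>{(T, e) \<in> (SIGMA T:?A. T). fundamental_flow T f e \<noteq> (0 :: 'k)}.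
      ?w (insert f (T - {e})) * (x e * fundamental_flow T f e))"
    by (rule sum.mono_neutral_right) (use finT in auto)
  also have "\<dots> = (\<Sum>(T, e)\<in>{(T, e) \<in> (SIGMA T:?B. I - T). fundamental_flow T e f \<noteq> (0 :: 'k)}.
      ?w T * (x e * fundamental_flow T e f))"
  proof (rule sum.reindex_bij_witness[where
        j = "\<lambda>(T, e). (insert f (T - {e}), e)" and i = "\<lambda>(T, e). (insert e (T - {f}), e)"])
    fix p assume "p \<in> {(T, e) \<in> (SIGMA T:?A. T). fundamental_flow T f e \<noteq> (0 :: 'k)}"
    then obtain T e where p: "p = (T, e)" and T: "tree TYPE('k) T" "T \<subseteq> I" "f \<notin> T" "e \<in> T"
      "fundamental_flow T f e \<noteq> (0 :: 'k)" by auto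
    note ex = tree_exchange[OF T(1) fE T(3,4,5)] exchanged_fundamental_flow[OF T(1) fE T(3,4,5)]
    show "(case case p of (T, e) \<Rightarrow> (insert f (T - {e}), e) of (T, e) \<Rightarrow> (insert e (T - {f}), e)) = p"
      using T by (auto simp: p)
    show "(case p of (T, e) \<Rightarrow> (insert f (T - {e}), e)) \<in> {(T, e) \<in> (SIGMA T:?B. I - T). fundamental_flow T e f \<noteq> (0 :: 'k)}"
      using T ex f by (auto simp: p)
    show "(case case p of (T, e) \<Rightarrow> (insert f (T - {e}), e) of (T, e) \<Rightarrow> ?w T * (x e * fundamental_flow T e f))
        = (case p of (T, e) \<Rightarrow> ?w (insert f (T - {e})) * (x e * fundamental_flow T f e))"
      using ex(2) by (simp add: p)
  next
    fix p assume "p \<in> {(T, e) \<in> (SIGMA T:?B. I - T). fundamental_flow T e f \<noteq> (0 :: 'k)}"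
    then obtain T e where p: "p = (T, e)" and T: "tree TYPE('k) T" "T \<subseteq> I" "f \<in> T" "e \<in> I" "e \<notin> T"
      "fundamental_flow T e f \<noteq> (0 :: 'k)" by auto
    have eE: "e \<in> E" using T(4) I by blast
    note ex = tree_exchange[OF T(1) eE T(5,3,6)] exchanged_fundamental_flow[OF T(1) eE T(5,3,6)]
    show "(case case p of (T, e) \<Rightarrow> (insert e (T - {f}), e) of (T, e) \<Rightarrow> (insert f (T - {e}), e)) = p"
      using T by (auto simp: p)
    show "(case p of (T, e) \<Rightarrow> (insert e (T - {f}), e)) \<in> {(T, e) \<in> (SIGMA T:?A. T). fundamental_flow T f e \<noteq> (0 :: 'k)}"
      using T ex by (auto simp: p)
  qed
  also have "\<dots> = (\<Sum>(T, e)\<in>(SIGMA T:?B. I - T). ?w T * (x e * fundamental_flow T e f))"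
    by (rule sum.mono_neutral_left) (use finI in auto)
  also have "\<dots> = (\<Sum>T\<in>?B. \<Sum>e\<in>I - T. ?w T * (x e * fundamental_flow T e f))"
    by (rule sum.Sigma[symmetric]) (use finI in auto)
  finally have swap: "(\<Sum>T\<in>?A. \<Sum>e\<in>T. ?w (insert f (T - {e})) * (x e * fundamental_flow T f e))
      = (\<Sum>T\<in>?B. \<Sum>e\<in>I - T. ?w T * (x e * fundamental_flow T e f))" .
  have "psi I \<alpha> * x f = (\<Sum>T\<in>?A \<union> ?B. ?w T * x f)"
    unfolding psi_def sum_distrib_right by (rule sum.cong) auto
  also have "\<dots> = (\<Sum>T\<in>?A. ?w T * x f) + (\<Sum>T\<in>?B. ?w T * x f)"
    by (rule sum.union_disjoint) auto
  also have "(\<Sum>T\<in>?A. ?w T * x f) = - (\<Sum>T\<in>?A. \<Sum>e\<in>T. ?w (insert f (T - {e})) * (x e * fundamental_flow T f e))"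
    using 1 by (simp add: sum_negf)
  also have "(\<Sum>T\<in>?B. ?w T * x f) = (\<Sum>T\<in>?B. \<Sum>e\<in>I - T. ?w T * (x e * fundamental_flow T e f))"
    using 2 by simp
  finally show ?thesis unfolding swap by simp
qed


lemma psi_upd:
  fixes \<alpha> :: "'e \<Rightarrow> 'k::field"
  assumes I: "I \<subseteq> E" and e: "e \<in> I"
  shows "psi I (\<alpha>(e := c)) = c * psi (I - {e}) \<alpha> + psi I (\<alpha>(e := 0))"
proof -
  have finI: "finite I" using I by (rule finite_subset) simp
  let ?A = "{T. tree TYPE('k) T \<and> T \<subseteq> I - {e}}" and ?B = "{T. tree TYPE('k) T \<and> T \<subseteq> I \<and> e \<in> T}"
  have split: "psi I \<beta> = (\<Sum>T\<in>?A. \<beta> e * (\<Prod>i\<in>I - {e} - T. \<beta> i)) + (\<Sum>T\<in>?B. \<Prod>i\<in>I - T. \<beta> i)"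
    for \<beta> :: "'e \<Rightarrow> 'k"
  proof -
    have "psi I \<beta> = (\<Sum>T\<in>?A \<union> ?B. \<Prod>i\<in>I - T. \<beta> i)"
      unfolding psi_def by (rule sum.cong) auto
    also have "\<dots> = (\<Sum>T\<in>?A. \<Prod>i\<in>I - T. \<beta> i) + (\<Sum>T\<in>?B. \<Prod>i\<in>I - T. \<beta> i)"
      by (rule sum.union_disjoint) auto
    also have "(\<Sum>T\<in>?A. \<Prod>i\<in>I - T. \<beta> i) = (\<Sum>T\<in>?A. \<beta> e * (\<Prod>i\<in>I - {e} - T. \<beta> i))"
    proof (rule sum.cong)
      fix T assume T: "T \<in> ?A"
      then have "I - T = insert e (I - {e} - T)" using e by auto
      then show "(\<Prod>i\<in>I - T. \<beta> i) = \<beta> e * (\<Prod>i\<in>I - {e} - T. \<beta> i)" using finI by simp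
    qed simp
    finally show ?thesis .
  qed
  have outside: "(\<Prod>i\<in>I - {e} - T. (\<alpha>(e := c)) i) = (\<Prod>i\<in>I - {e} - T. \<alpha> i)"
      "(\<Prod>i\<in>I - {e} - T. (\<alpha>(e := 0)) i) = (\<Prod>i\<in>I - {e} - T. \<alpha> i)" for T
    by (intro prod.cong; simp)+
  have inside: "(\<Prod>i\<in>I - T. (\<alpha>(e := c)) i) = (\<Prod>i\<in>I - T. (\<alpha>(e := 0)) i)" if "T \<in> ?B" for T
    using that by (intro prod.cong) auto
  show ?thesis
    unfolding split outside psi_def[of "I - {e}"] using inside by (simp add: sum_distrib_left)
qed

lemma trivial_of_psi:
  fixes \<alpha> :: "'e \<Rightarrow> 'k::field"
  assumes I: "I \<subseteq> E" and nz: "psi I \<alpha> \<noteq> 0"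
  shows "trivial (mixed I \<alpha> all_open)"
  unfolding trivial_def
proof
  fix z assume "z \<in> sol (mixed I \<alpha> all_open)"
  then obtain x \<xi> where z: "z = (x, \<xi>)" and s: "x \<in> supp_on E" "\<xi> \<in> supp_on W"
    "\<And>v. v \<in> W \<Longrightarrow> net x v = 0" "\<And>e. e \<in> E \<Longrightarrow> (x e, volt \<xi> e) \<in> mixed I \<alpha> all_open e"
    by (auto simp: sol_def)
  have ohm: "volt \<xi> e = \<alpha> e * x e" if "e \<in> I" for e
    using s(4)[of e] that I by (auto simp: mixed_def resistor_def)
  have xI: "x \<in> supp_on I"
    unfolding supp_on_def mem_Collect_eq
  proof (intro allI impI)
    fix e assume "e \<notin> I"
    then show "x e = 0" using s(1) s(4)[of e] by (cases "e \<in> E") (auto simp: supp_on_def mixed_def opened_def)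
  qed
  have "x f = 0" for f
  proof (cases "f \<in> I")
    case True
    have "psi I \<alpha> * x f = 0" by (rule flow_times_psi[OF I xI s(3) s(2) ohm True])
    then show ?thesis using nz by simp
  qed (use xI in \<open>simp add: supp_on_def\<close>)
  then have x: "x = (\<lambda>_. 0)" by auto
  have "{T. tree TYPE('k) T \<and> T \<subseteq> I} \<noteq> {}"
    using nz unfolding psi_def by (metis sum.empty)
  then obtain T where "tree TYPE('k) T" "T \<subseteq> I" by blast
  then have "\<forall>e\<in>T. volt \<xi> e = 0" using ohm by (auto simp: x)
  then have "\<xi> = (\<lambda>_. 0)" using \<open>tree TYPE('k) T\<close> s(2) unfolding tree_def spans_def by blast
  then show "z \<in> {(\<lambda>_. 0, \<lambda>_. 0)}" by (simp add: z x)
qed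

text \<open>As a function of \<open>\<alpha>\<^sub>e\<close> the polynomial is affine, with \<open>psi (I - {e})\<close> as slope. If the network
  without \<open>e\<close> is nondegenerate, the slope is nonzero by induction and the pencil at \<open>e\<close> has a bad
  resistance \<open>c\<close>, which is the root of the affine function by \<open>trivial_of_psi\<close>; a nondegenerate value is
  different from \<open>c\<close>. If the network without \<open>e\<close> is degenerate, the slope vanishes, and all resistances
  at \<open>e\<close> are good, in particular \<open>0\<close>, where the induction hypothesis applies. The induction is on the
  number of nonzero resistances; if there are none, the edges form a tree.\<close>

lemma psi_of_trivial:
  fixes \<alpha> :: "'e \<Rightarrow> 'k::{field,finite}"
  assumes "I \<subseteq> E" "trivial (mixed I \<alpha> all_open)"
  shows "psi I \<alpha> \<noteq> 0"
  using assms
proof (induction "card {e \<in> I. \<alpha> e \<noteq> 0}" arbitrary: I \<alpha> rule: less_induct)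
  case (less I \<alpha>)
  have finI: "finite I" using less.prems(1) by (rule finite_subset) simp
  show ?case
  proof (cases "\<exists>e\<in>I. \<alpha> e \<noteq> 0")
    case False
    have "tree TYPE('k) I"
      unfolding tree_def no_flow_def spans_def
    proof (intro conjI allI impI)
      show "x = (\<lambda>_. 0)" if x: "x \<in> supp_on I" "\<forall>v\<in>W. net x v = 0" for x :: "'e \<Rightarrow> 'k"
      proof -
        have "(x, \<lambda>_. 0) \<in> sol (mixed I \<alpha> all_open)"
          using x False supp_on_mono[OF less.prems(1)]
          by (auto simp: sol_def mixed_def resistor_def opened_def supp_on_def)
        then show ?thesis using less.prems(2) by (auto simp: trivial_def)
      qed
      show "\<xi> = (\<lambda>_. 0)" if \<xi>: "\<xi> \<in> supp_on W" "\<forall>e\<in>I. volt \<xi> e = 0" for \<xi> :: "'v \<Rightarrow> 'k"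
      proof -
        have "(\<lambda>_. 0, \<xi>) \<in> sol (mixed I \<alpha> all_open)"
          using \<xi> by (auto simp: sol_def mixed_def resistor_def opened_def)
        then show ?thesis using less.prems(2) by (auto simp: trivial_def)
      qed
    qed (rule less.prems(1))
    moreover have "(\<Prod>e\<in>I - T. \<alpha> e) = 0" if "T \<subseteq> I" "T \<noteq> I" for T
    proof -
      obtain e where "e \<in> I - T" using \<open>T \<subseteq> I\<close> \<open>T \<noteq> I\<close> by blast
      then show ?thesis using False finI by (intro prod_zero) auto
    qed
    then have "psi I \<alpha> = (\<Sum>T | tree TYPE('k) T \<and> T \<subseteq> I. of_bool (T = I))"
      unfolding psi_def by (intro sum.cong) auto
    ultimately have "psi I \<alpha> = 1" by (simp add: of_bool_def)
    then show ?thesis by simp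
  next
    case True
    then obtain e where e: "e \<in> I" "\<alpha> e \<noteq> 0" by blast
    have eE: "e \<in> E" using e less.prems(1) by blast
    let ?\<sigma> = "mixed (I - {e}) \<alpha> all_open"
    have mixed: "mixed I (\<alpha>(e := c)) all_open = ?\<sigma>(e := resistor c)" for c
      using e by (auto simp: mixed_def fun_eq_iff)
    have opened: "?\<sigma>(e := opened) = ?\<sigma>" by (auto simp: mixed_def fun_eq_iff)
    have here: "trivial (?\<sigma>(e := resistor (\<alpha> e)))"
      using less.prems(2) mixed[of "\<alpha> e"] by simp
    have nontriv: "\<not> trivial (?\<sigma>(e := UNIV))"
    proof -
      have "?\<sigma>(e := UNIV) = mixed (I - {e}) \<alpha> (all_open(e := UNIV))" by (auto simp: mixed_def fun_eq_iff)
      then show ?thesis using nontrivial_one_free[OF eE, of "I - {e}" \<alpha>] by simp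
    qed
    have pencil: "int (card {c. trivial (?\<sigma>(e := resistor c))}) + of_bool (trivial ?\<sigma>)
        = int CARD('k) * of_bool (trivial (?\<sigma>(e := dead)))"
    proof -
      have "linear_rel (?\<sigma> i)" for i by (simp add: mixed_def)
      moreover have "(\<exists>a. ?\<sigma> i = resistor a) \<or> ?\<sigma> i = opened \<or> ?\<sigma> i = dead" for i
        by (auto simp: mixed_def)
      ultimately have "int (card {c. trivial (?\<sigma>(e := resistor c))}) + of_bool (trivial (?\<sigma>(e := opened)))
          = int CARD('k) * of_bool (trivial (?\<sigma>(e := dead))) + of_bool (trivial (?\<sigma>(e := UNIV)))"
        by (intro isotropic_pencil_edge[OF eE])
      then show ?thesis using nontriv unfolding opened by simp
    qed
    have psi: "psi I (\<alpha>(e := c)) = c * psi (I - {e}) \<alpha> + psi I (\<alpha>(e := 0))" for c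
      by (rule psi_upd[OF less.prems(1) e(1)])
    have psi_here: "psi I \<alpha> = \<alpha> e * psi (I - {e}) \<alpha> + psi I (\<alpha>(e := 0))"
      using psi[of "\<alpha> e"] by simp
    have sub: "{i \<in> I - {e}. \<alpha> i \<noteq> 0} \<subset> {i \<in> I. \<alpha> i \<noteq> 0}"
      "{i \<in> I. (\<alpha>(e := 0)) i \<noteq> 0} \<subset> {i \<in> I. \<alpha> i \<noteq> 0}" using e by auto
    have fin: "finite {i \<in> I. \<alpha> i \<noteq> 0}" using finI by simp
    show ?thesis
    proof (cases "trivial ?\<sigma>")
      case True
      have slope: "psi (I - {e}) \<alpha> \<noteq> 0"
        by (rule less.hyps[OF psubset_card_mono[OF fin sub(1)]]) (use less.prems(1) True in auto)
      have "{c. trivial (?\<sigma>(e := resistor c))} \<noteq> UNIV"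
      proof
        assume "{c. trivial (?\<sigma>(e := resistor c))} = UNIV"
        then have "int CARD('k) + 1 = int CARD('k) * of_bool (trivial (?\<sigma>(e := dead)))"
          using pencil True by simp
        then show False by (cases "trivial (?\<sigma>(e := dead))") simp_all
      qed
      then obtain c where c: "\<not> trivial (?\<sigma>(e := resistor c))" by blast
      then have "psi I (\<alpha>(e := c)) = 0"
        using trivial_of_psi[OF less.prems(1), of "\<alpha>(e := c)"] mixed by auto
      then have "psi I \<alpha> = (\<alpha> e - c) * psi (I - {e}) \<alpha>"
        using psi[of c] psi_here by (simp add: algebra_simps)
      moreover have "c \<noteq> \<alpha> e" using c here by auto
      ultimately show ?thesis using slope by simp
    next
      case False
      have "card {c. trivial (?\<sigma>(e := resistor c))} \<noteq> 0" using here by auto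
      then have "card {c. trivial (?\<sigma>(e := resistor c))} = card (UNIV :: 'k set)"
        using pencil False by (cases "trivial (?\<sigma>(e := dead))") simp_all
      then have "{c. trivial (?\<sigma>(e := resistor c))} = UNIV" by (simp add: card_eq_UNIV_imp_eq_UNIV)
      then have "trivial (mixed I (\<alpha>(e := 0)) all_open)" using mixed by auto
      then have "psi I (\<alpha>(e := 0)) \<noteq> 0"
        by (rule less.hyps[OF psubset_card_mono[OF fin sub(2)] less.prems(1)])
      moreover have "psi (I - {e}) \<alpha> = 0"
        using False trivial_of_psi[of "I - {e}" \<alpha>] less.prems(1) by blast
      ultimately show ?thesis using psi_here by simp
    qed
  qed
qed

lemma graph_poly_eq_psi:
  assumes "verts G = V" "edges G = E" "\<And>e. e \<in> E \<Longrightarrow> ends G e = Upair (t e) (h e)"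
  shows "graph_poly G \<alpha> = psi E (\<alpha> :: 'e \<Rightarrow> 'k::field)"
proof -
  have "{T. tree TYPE('k) T} = {T. tree TYPE('k) T \<and> T \<subseteq> E}" by (auto simp: tree_def)
  moreover have "spanning_trees G = {T. tree TYPE('k) T}" by (rule spanning_trees_eq[OF assms])
  ultimately have "spanning_trees G = {T. tree TYPE('k) T \<and> T \<subseteq> E}" by simp
  then show ?thesis unfolding graph_poly_def psi_def assms(2) by simp
qed

lemma point_count_eq:
  assumes G: "verts G = V" "edges G = E" "\<And>e. e \<in> E \<Longrightarrow> ends G e = Upair (t e) (h e)"
  shows "int (point_count TYPE('k::{field,finite}) G)
    = int CARD('k) ^ card E - count E (all_open :: 'e \<Rightarrow> ('k \<times> 'k) set)"
proof -
  let ?\<Psi> = "psi E :: ('e \<Rightarrow> 'k) \<Rightarrow> 'k" and ?U = "supp_on E :: ('e \<Rightarrow> 'k) set"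
  have local: "?\<Psi> \<alpha> = ?\<Psi> \<beta>" if "\<And>e. e \<in> E \<Longrightarrow> \<alpha> e = \<beta> e" for \<alpha> \<beta>
    unfolding psi_def using that by (intro sum.cong prod.cong refl) auto
  have "bij_betw (\<lambda>\<alpha>. restrict \<alpha> E) {\<alpha> \<in> ?U. ?\<Psi> \<alpha> = 0} {\<alpha> \<in> E \<rightarrow>\<^sub>E UNIV. ?\<Psi> \<alpha> = 0}"
  proof (rule bij_betwI[where g = "restrict0 E"])
    show "(\<lambda>\<alpha>. restrict \<alpha> E) \<in> {\<alpha> \<in> ?U. ?\<Psi> \<alpha> = 0} \<rightarrow> {\<alpha> \<in> E \<rightarrow>\<^sub>E UNIV. ?\<Psi> \<alpha> = 0}"
      using local[of "restrict _ E"] by auto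
    show "restrict0 E \<in> {\<alpha> \<in> E \<rightarrow>\<^sub>E UNIV. ?\<Psi> \<alpha> = 0} \<rightarrow> {\<alpha> \<in> ?U. ?\<Psi> \<alpha> = 0}"
      using local[of "restrict0 E _"] by (auto simp: restrict0_def supp_on_def)
    show "restrict0 E (restrict \<alpha> E) = \<alpha>" if "\<alpha> \<in> {\<alpha> \<in> ?U. ?\<Psi> \<alpha> = 0}" for \<alpha>
      using that by (auto simp: restrict0_def supp_on_def fun_eq_iff)
    show "restrict (restrict0 E \<alpha>) E = \<alpha>" if "\<alpha> \<in> {\<alpha> \<in> E \<rightarrow>\<^sub>E UNIV. ?\<Psi> \<alpha> = 0}" for \<alpha>
      using that by (auto simp: restrict0_def PiE_def extensional_def fun_eq_iff)
  qed
  then have "card {\<alpha> \<in> ?U. ?\<Psi> \<alpha> = 0} = card {\<alpha> \<in> E \<rightarrow>\<^sub>E UNIV. ?\<Psi> \<alpha> = 0}"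
    by (rule bij_betw_same_card)
  moreover have "graph_poly G \<alpha> = ?\<Psi> \<alpha>" for \<alpha> by (rule graph_poly_eq_psi[OF G])
  ultimately have "point_count TYPE('k) G = card {\<alpha> \<in> ?U. ?\<Psi> \<alpha> = 0}"
    unfolding point_count_def G(2) by simp
  moreover have "card ?U = card {\<alpha> \<in> ?U. ?\<Psi> \<alpha> = 0} + card {\<alpha> \<in> ?U. ?\<Psi> \<alpha> \<noteq> 0}"
    by (subst card_Un_disjoint[symmetric]) (auto intro!: arg_cong[where f = card])
  moreover have "count E (all_open :: 'e \<Rightarrow> ('k \<times> 'k) set) = int (card {\<alpha> \<in> ?U. ?\<Psi> \<alpha> \<noteq> 0})"
  proof -
    have "trivial (mixed E \<alpha> all_open) \<longleftrightarrow> ?\<Psi> \<alpha> \<noteq> 0" for \<alpha>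
      using trivial_of_psi psi_of_trivial by blast
    then show ?thesis by (simp add: count_def Collect_conj_eq)
  qed
  ultimately show ?thesis by (simp add: card_supp_on flip: of_nat_power)
qed

theorem has_c2_parallel_configs:
  assumes G: "verts G = V" "edges G = E" "\<And>e. e \<in> E \<Longrightarrow> ends G e = Upair (t e) (h e)"
    and K: "E = insert e (insert f (insert g K))" "{e, f, g} \<inter> K = {}" "distinct [e, f, g]"
    and few: "4 \<le> card V" "card E + 2 \<le> 2 * card V"
  shows "has_c2 TYPE('k::{field,finite}) G (int (card (parallel_configs K e f g :: ('e, 'v, 'k) config set)))"
proof -
  let ?q = "int CARD('k)" and ?p = "int (card (parallel_configs K e f g :: ('e, 'v, 'k) config set))"
  have W: "card W = card V - 1" using root by (simp add: card_Diff_singleton)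
  have "finite K" by (rule finite_subset[OF _ finite_E]) (use K(1) in auto)
  then have E: "card E = card K + 3" using K by simp
  have "[count E (all_open :: 'e \<Rightarrow> ('k \<times> 'k) set) = - (?q ^ 2 * ?p)] (mod ?q ^ 3)"
  proof -
    have "insert e (insert f (insert g K)) \<subseteq> E" using K(1) by blast
    moreover have "2 < card W" "card K + 3 \<le> 2 * card W" unfolding W using few E by linarith+
    ultimately show ?thesis
      using count_cong_parallel_configs[of e f g K, where 'k = 'k] K(2,3) unfolding K(1)[symmetric] by blast
  qed
  moreover have "[?q ^ card E = 0] (mod ?q ^ 3)"
    by (simp add: cong_0_iff E le_imp_power_dvd)
  ultimately have "[?q ^ card E - count E (all_open :: 'e \<Rightarrow> ('k \<times> 'k) set) = 0 - (- (?q ^ 2 * ?p))] (mod ?q ^ 3)"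
    by (intro cong_diff)
  moreover have "int (point_count TYPE('k) G) = ?q ^ card E - count E (all_open :: 'e \<Rightarrow> ('k \<times> 'k) set)"
    by (rule point_count_eq[OF G])
  ultimately show ?thesis
    unfolding has_c2_def by (simp add: mult.commute)
qed

end

lemma exists_orientation: "\<exists>t h. \<forall>e. \<psi> e = Upair (t e) (h e)"
proof -
  have "\<forall>e. \<exists>p. \<psi> e = Upair (fst p) (snd p)"
    by (metis fst_conv snd_conv uprod_exhaust)
  then obtain p where "\<forall>e. \<psi> e = Upair (fst (p e)) (snd (p e))" by metis
  then show ?thesis by (intro exI[of _ "\<lambda>e. fst (p e)"] exI[of _ "\<lambda>e. snd (p e)"])
qed

section \<open>Invariance under double triangle reduction\<close>

lemma betti_connected:
  assumes "connected_graph G"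
  shows "betti G = int (card (edges G)) - int (card (verts G)) + 1"
proof -
  have "connected_rel G = verts G \<times> verts G"
    using assms unfolding connected_graph_def connected_rel_def by blast
  then have "components G = {verts G}"
    using assms unfolding components_def connected_graph_def quotient_def by auto
  then show ?thesis by (simp add: betti_def)
qed

theorem corollary34:
  fixes G G' :: "('v, 'e) mgraph"
  assumes "finite_graph G"
    and "connected_graph G"
    and "2 * betti G \<le> int (card (edges G))"
    and "double_triangle_reduction G G'"
  shows "(\<exists>c. has_c2 TYPE('k::{field,finite}) G c) \<and> (\<exists>c. has_c2 TYPE('k) G' c) \<and>
         [c2 TYPE('k) G = c2 TYPE('k) G'] (mod int CARD('k))"
proof -
  obtain P Q A B C D R e1 e2 e3 e4 e5 e6 e7 f1 f2 f3 f4 f5 where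
    V: "{P, Q, A, B, C, D} \<subseteq> verts G" "distinct [P, Q, A, B, C, D]" and
    es: "distinct [e1, e2, e3, e4, e5, e6, e7]" and
    star: "{e \<in> edges G. P \<in> set_uprod (ends G e) \<or> Q \<in> set_uprod (ends G e)} = {e1, e2, e3, e4, e5, e6, e7}" and
    eends: "ends G e1 = Upair A P" "ends G e2 = Upair P Q" "ends G e3 = Upair Q D"
      "ends G e4 = Upair P B" "ends G e5 = Upair B Q" "ends G e6 = Upair P C" "ends G e7 = Upair C Q" and
    R: "R \<notin> verts G - {P, Q}" and
    fs: "distinct [f1, f2, f3, f4, f5]" "{f1, f2, f3, f4, f5} \<inter> (edges G - {e1, e2, e3, e4, e5, e6, e7}) = {}" and
    V': "verts G' = insert R (verts G - {P, Q})" and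
    E': "edges G' = (edges G - {e1, e2, e3, e4, e5, e6, e7}) \<union> {f1, f2, f3, f4, f5}" and
    keep: "\<forall>e \<in> edges G - {e1, e2, e3, e4, e5, e6, e7}. ends G' e = ends G e" and
    fends: "ends G' f1 = Upair A R" "ends G' f2 = Upair R D" "ends G' f3 = Upair B R"
      "ends G' f4 = Upair R C" "ends G' f5 = Upair B C"
    using assms(4) unfolding double_triangle_reduction_def
    by (elim exE conjE) (rule that; assumption)
  define VH where "VH = verts G - {P, Q}"
  define EH where "EH = edges G - {e1, e2, e3, e4, e5, e6, e7}"
  obtain t h where th: "\<And>e. ends G e = Upair (t e) (h e)" using exists_orientation[of "ends G"] by blast
  have fin: "finite (verts G)" "finite (edges G)" "\<And>e. e \<in> edges G \<Longrightarrow> set_uprod (ends G e) \<subseteq> verts G"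
    using assms(1) by (auto simp: finite_graph_def)
  have ends_VH: "t e \<in> VH" "h e \<in> VH" if "e \<in> EH" for e
  proof -
    have "P \<notin> set_uprod (ends G e)" "Q \<notin> set_uprod (ends G e)" "e \<in> edges G"
      using that star by (auto simp: EH_def)
    then show "t e \<in> VH" "h e \<in> VH" using fin(3)[of e] th[of e] by (auto simp: VH_def)
  qed
  (* No edge of H meets P or Q, since the seven removed edges are all the edges there. *)
  interpret H: network VH EH t h A
    by unfold_locales (use fin V ends_VH in \<open>auto simp: VH_def EH_def\<close>)
  have VG: "verts G = insert P (insert Q VH)" using V by (auto simp: VH_def)
  have EG: "edges G = insert e1 (insert e2 (insert e3 (insert e4 (insert e5 (insert e6 (insert e7 EH))))))"
    using star by (auto simp: EH_def)
  have VG': "verts G' = insert R VH" using V' by (simp add: VH_def)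
  have EG': "edges G' = insert f1 (insert f2 (insert f3 (insert f4 (insert f5 EH))))"
    using E' by (auto simp: EH_def)
  have new: "{e1, e2, e3, e4, e5, e6, e7} \<inter> EH = {}" "{f1, f2, f3, f4, f5} \<inter> EH = {}"
    using fs(2) by (auto simp: EH_def)
  (* The orientation on the gadgets is the one of the fibre lemmas; on H it is shared by both graphs. *)
  define tG hG where "tG = t(e1 := A, e2 := P, e3 := Q, e4 := P, e5 := B, e6 := P, e7 := C)"
    and "hG = h(e1 := P, e2 := Q, e3 := D, e4 := B, e5 := Q, e6 := C, e7 := Q)"
  define tG' hG' where "tG' = t(f1 := A, f2 := R, f3 := B, f4 := R, f5 := B)"
    and "hG' = h(f1 := R, f2 := D, f3 := R, f4 := C, f5 := C)"
  have terms: "{A, B, C, D} \<subseteq> VH" "P \<notin> VH" "Q \<notin> VH" "R \<notin> VH" "distinct [A, B, C, D, P, Q]" "distinct [A, B, C, D, R]"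
    using V R by (auto simp: VH_def)
  have tG: "tG e1 = A" "tG e2 = P" "tG e3 = Q" "tG e4 = P" "tG e5 = B" "tG e6 = P" "tG e7 = C"
    and hG: "hG e1 = P" "hG e2 = Q" "hG e3 = D" "hG e4 = B" "hG e5 = Q" "hG e6 = C" "hG e7 = Q"
    using es by (simp_all add: tG_def hG_def)
  have tG': "tG' f1 = A" "tG' f2 = R" "tG' f3 = B" "tG' f4 = R" "tG' f5 = B"
    and hG': "hG' f1 = R" "hG' f2 = D" "hG' f3 = R" "hG' f4 = C" "hG' f5 = C"
    using fs by (simp_all add: tG'_def hG'_def)
  have old: "tG e = t e" "hG e = h e" "tG' e = t e" "hG' e = h e" if "e \<in> EH" for e
    using that new by (auto simp: tG_def hG_def tG'_def hG'_def)
  have G_ends: "ends G e = Upair (tG e) (hG e)" if eG: "e \<in> edges G" for e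
  proof (cases "e \<in> EH")
    case True
    then show ?thesis using th[of e] old by simp
  next
    case False
    then consider "e = e1" | "e = e2" | "e = e3" | "e = e4" | "e = e5" | "e = e6" | "e = e7"
      using eG unfolding EG by blast
    then show ?thesis by cases (simp_all only: tG hG eends)
  qed
  have G'_ends: "ends G' e = Upair (tG' e) (hG' e)" if eG: "e \<in> edges G'" for e
  proof (cases "e \<in> EH")
    case True
    then have "ends G' e = ends G e" using keep by (simp add: EH_def)
    then show ?thesis using th[of e] old True by simp
  next
    case False
    then consider "e = f1" | "e = f2" | "e = f3" | "e = f4" | "e = f5"
      using eG unfolding EG' by blast
    then show ?thesis by cases (simp_all only: tG' hG' fends)
  qed
  interpret G: network "verts G" "edges G" tG hG A
  proof
    show "finite (verts G)" "finite (edges G)" by (rule fin(1), rule fin(2))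
    show "A \<in> verts G" using V(1) by simp
    show "tG e \<in> verts G" "hG e \<in> verts G" if "e \<in> edges G" for e
      using fin(3)[OF that] G_ends[OF that] by simp_all
  qed
  interpret G': network "verts G'" "edges G'" tG' hG' A
  proof
    show "finite (verts G')" "finite (edges G')" unfolding VG' EG' by simp_all
    show "A \<in> verts G'" unfolding VG' using terms(1) by simp
    have "tG' e \<in> insert R VH \<and> hG' e \<in> insert R VH" if eG: "e \<in> edges G'" for e
    proof (cases "e \<in> EH")
      case True
      then show ?thesis using ends_VH old by simp
    next
      case False
      then consider "e = f1" | "e = f2" | "e = f3" | "e = f4" | "e = f5"
        using eG unfolding EG' by blast
      then show ?thesis using terms(1) by cases (simp_all add: tG' hG')
    qed
    then show "tG' e \<in> verts G'" "hG' e \<in> verts G'" if "e \<in> edges G'" for e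
      using that unfolding VG' by blast+
  qed
  have cards: "card (verts G) = card VH + 2" "card (verts G') = card VH + 1"
      "card (edges G) = card EH + 7" "card (edges G') = card EH + 5"
    using terms new es fs unfolding VG VG' EG EG' by simp_all
  have "card {A, B, C, D} \<le> card VH" by (rule card_mono) (use terms in auto)
  then have four: "4 \<le> card VH" using V by simp
  have bound: "card EH + 7 + 2 \<le> 2 * (card VH + 2)"
  proof -
    have "int (card (edges G)) + 2 \<le> 2 * int (card (verts G))"
      using assms(3) unfolding betti_connected[OF assms(2)] by simp
    then show ?thesis unfolding cards by simp
  qed
  let ?K = "insert e4 (insert e5 (insert e6 (insert e7 EH)))" and ?K' = "insert f3 (insert f4 EH)"
  let ?p = "int (card (G.parallel_configs ?K e1 e2 e3 :: ('e, 'v, 'k) config set))"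
    and ?p' = "int (card (G'.parallel_configs ?K' f1 f5 f2 :: ('e, 'v, 'k) config set))"
  have c2G: "has_c2 TYPE('k) G ?p"
  proof (rule G.has_c2_parallel_configs[OF refl refl])
    show "ends G e = Upair (tG e) (hG e)" if "e \<in> edges G" for e by (rule G_ends[OF that])
    show "edges G = insert e1 (insert e2 (insert e3 ?K))" by (rule EG)
    show "{e1, e2, e3} \<inter> ?K = {}" using new(1) es by auto
    show "distinct [e1, e2, e3]" using es by simp
    show "4 \<le> card (verts G)" "card (edges G) + 2 \<le> 2 * card (verts G)"
      unfolding cards using four bound by simp_all
  qed
  have c2G': "has_c2 TYPE('k) G' ?p'"
  proof (rule G'.has_c2_parallel_configs[OF refl refl])
    show "ends G' e = Upair (tG' e) (hG' e)" if "e \<in> edges G'" for e by (rule G'_ends[OF that])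
    show "edges G' = insert f1 (insert f5 (insert f2 ?K'))" unfolding EG' by blast
    show "{f1, f5, f2} \<inter> ?K' = {}" using new(2) fs(1) by auto
    show "distinct [f1, f5, f2]" using fs(1) by auto
    show "4 \<le> card (verts G')" "card (edges G') + 2 \<le> 2 * card (verts G')"
      unfolding cards using four bound by simp_all
  qed
  have sub: "{B, C, D} \<subseteq> VH" using terms(1) by simp
  have "[?p = (\<Sum>(x, y, \<xi>, \<eta>)\<in>H.open_configs B C D.
        int (card {s :: 'k. \<xi> B * \<eta> D \<noteq> \<eta> B * s \<and> \<xi> C * \<eta> D \<noteq> \<eta> C * s}))] (mod int CARD('k))"
    unfolding VG EG
    by (rule H.double_triangle_fibres[OF sub terms(2,3,5) new(1) es old(1,2) tG hG])
  moreover have "[(\<Sum>(x, y, \<xi>, \<eta>)\<in>H.open_configs B C D.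
        int (card {s :: 'k. \<xi> B * \<eta> D \<noteq> \<eta> B * s \<and> \<xi> C * \<eta> D \<noteq> \<eta> C * s}))
      = (\<Sum>(x, y, \<xi>, \<eta>)\<in>H.open_configs B C D. of_bool (\<eta> D = (0 :: 'k) \<and> \<xi> B * \<eta> C \<noteq> \<eta> B * \<xi> C))]
      (mod int CARD('k))"
  proof (rule H.open_configs_cong)
    have "card (VH - {A}) = card VH - 1" using terms by (simp add: card_Diff_singleton)
    then show "card EH + 2 < 2 * card (VH - {A})" using four bound by simp
  qed
  moreover have "[?p' = (\<Sum>(x, y, \<xi>, \<eta>)\<in>H.open_configs B C D.
      of_bool (\<eta> D = (0 :: 'k) \<and> \<xi> B * \<eta> C \<noteq> \<eta> B * \<xi> C))] (mod int CARD('k))"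
    unfolding VG' EG'
    by (rule H.reduced_triangle_fibres[OF sub terms(4,6) new(2) fs(1) old(3,4) tG' hG'])
  ultimately have "[?p = ?p'] (mod int CARD('k))"
    by (meson cong_sym cong_trans)
  then have "[c2 TYPE('k) G = c2 TYPE('k) G'] (mod int CARD('k))"
    using c2_cong[OF c2G] c2_cong[OF c2G'] by (meson cong_sym cong_trans)
  then show ?thesis using c2G c2G' by blast
qed

end
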